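(* Let $\mathcal N$ be a semifinite von Neumann algebra on a separable Hilbert space with a faithful normal semifinite trace $\tau$, let $p>1$, and let $T\in\mathcal N$, $T\ge0$. Let $\omega$ be a state on $L_\infty(\mathbb R_+^* )$ which is $D_2$-invariant and $P^\alpha$-invariant for all $\alpha>1$, and let $\tilde\omega=\omega\circ L$. (a) If $T\in\mathcal Z_p$ or $T\in\mathcal L^{(p,\infty)}(\mathcal N,\tau)$, then $$\tilde\omega\text{-}\lim_{r\to\infty}\frac1r\tau(T^{p+\frac1r})=p\,\tau_\omega(T^p),$$ and if one of the limits $\lim_{r\to\infty}\frac1r\tau(T^{p+\frac1r})$, $\lim_{t\to\infty}\frac1{\log(1+t)}\int_0^t\mu_s(T^p)\,ds$ exists as a true limit, then so does the other. (b) If $\lim_{r\to\infty}\frac1r\tau(T^{p+\frac1r})$ exists, then $T\in\mathcal Z_p$ and $$\lim_{r\to\infty}\frac1r\tau(T^{p+\frac1r})=p\lim_{t\to\infty}\frac1{\log(1+t)}\int_0^t\mu_s(T^p)\,ds .$$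
   Context: For $A\in\mathcal N$ and $t\ge0$, $\mu_t(A)=\inf\{s\ge 0:\tau(E^{|A|}(s,\infty))\le t\}$, where $E^{|A|}$ is the spectral measure of $|A|$. $\mathcal Z_p$ is the set of positive $T\in\mathcal N$ with $\limsup_{s\downarrow p}\bigl((s-p)\tau(T^s)\bigr)^{1/s}<\infty$. Let $\psi_1(t)=t\log2$ for $0\le t\le1$ and $\psi_1(t)=\log(1+t)$ for $t\ge1$; for $p>1$ let $\psi_p(t)=t$ for $0\le t\le1$ and $\psi_p(t)=t^{1-1/p}$ for $t\ge1$. $\mathcal L^{(p,\infty)}(\mathcal N,\tau)$, $p\ge1$, is the set of $A\in\mathcal N$ with $\sup_{t>0}\frac1{\psi_p(t)}\int_0^t\mu_s(A)\,ds<\infty$. It is known that $T\in \mathcal Z_p$ iff $T^p\in\mathcal L^{(1,\infty)}(\mathcal N,\tau)$, and that positive elements of $\mathcal L^{(p,\infty)}$ lie in $\mathcal Z_p$, so that $\tau_\omega(T^p)$ below makes sense. $\mathbb R_+^*=(0,\infty)$. For functions $f$ on $\mathbb R_+^*$: $(D_af)(x)=f(x/a)$ and $(P^af)(x)=f(x^a)$, $a>0$; "invariant" means $\omega\circ D_a=\omega$, resp. $\omega\circ P^a=\omega$. $L:L_\infty(\mathbb R)\to L_\infty(\mathbb R_+^* )$ is $L(f)=f\circ\log$. Standing convention on states $\omega$ on $L_\infty(\mathbb R_+^* )$: (1) $\omega$ vanishes on continuous functions on $\mathbb R_+^*$ vanishing at $0$ and at $\infty$; (2) $\operatorname{ess\,liminf}_{t\to\infty}f(t)\le\omega(f)\le\operatorname{ess\,limsup}_{t\to\infty}f(t)$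 for real-valued $f$; (3) $\omega(f)=0$ if $f$ has compact essential support. In particular $\omega(f)$ and $\tilde\omega(f)$ depend only on the values of $f$ at large arguments; we write $\omega\text{-}\lim_{t\to\infty}f(t)$ for $\omega(f)$ (similarly for $\tilde\omega$), also when $f$ is defined and bounded only for large arguments. For $0\le S\in\mathcal L^{(1,\infty)}(\mathcal N,\tau)$, $\tau_\omega(S)=\omega\text{-}\lim_{t\to\infty}\frac1{\log(1+t)}\int_0^t\mu_s(S)\,ds$. *)

theory Defs
  imports "HOL-Analysis.Analysis" "HOL-Probability.Essential_Supremum"
begin

section \<open>Complex Hilbert spaces and bounded operators\<close>

text \<open>The inner product is linear in its first argument.\<close>

class complex_hilbert_space = banach +
  fixes scaleC :: "complex \<Rightarrow> 'a \<Rightarrow> 'a"  (infixr \<open>*\<^sub>C\<close> 75)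
    and cinner :: "'a \<Rightarrow> 'a \<Rightarrow> complex"
  assumes scaleC_add_right: "a *\<^sub>C (x + y) = a *\<^sub>C x + a *\<^sub>C y"
    and scaleC_add_left: "(a + b) *\<^sub>C x = a *\<^sub>C x + b *\<^sub>C x"
    and scaleC_scaleC: "a *\<^sub>C (b *\<^sub>C x) = (a * b) *\<^sub>C x"
    and scaleC_of_real: "complex_of_real r *\<^sub>C x = r *\<^sub>R x"
    and cinner_add_left: "cinner (x + y) z = cinner x z + cinner y z"
    and cinner_scaleC_left: "cinner (a *\<^sub>C x) y = a * cinner x y"
    and cinner_commute: "cinner y x = cnj (cinner x y)"
    and cinner_self: "cinner x x = complex_of_real ((norm x)\<^sup>2)"

text \<open>The type of \<open>\<Rightarrow>\<^sub>L\<close> consists of the bounded real-linear maps; the operators of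
  interest are the complex-linear ones among them. The two operator norms agree.\<close>

definition bounded_ops :: "('h::complex_hilbert_space \<Rightarrow>\<^sub>L 'h) set" where
  "bounded_ops = {A. \<forall>c x. blinfun_apply A (c *\<^sub>C x) = c *\<^sub>C blinfun_apply A x}"

definition adj_op :: "('h::complex_hilbert_space \<Rightarrow>\<^sub>L 'h) \<Rightarrow> 'h \<Rightarrow>\<^sub>L 'h" where
  "adj_op A = (THE B. \<forall>x y. cinner (blinfun_apply A x) y = cinner x (blinfun_apply B y))"

definition positive_op :: "('h::complex_hilbert_space \<Rightarrow>\<^sub>L 'h) \<Rightarrow> bool" where
  "positive_op A \<longleftrightarrow> A \<in> bounded_ops \<and> (\<forall>x. cinner (blinfun_apply A x) x \<in> \<real>\<^sub>\<ge>\<^sub>0)"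

definition le_op :: "('h::complex_hilbert_space \<Rightarrow>\<^sub>L 'h) \<Rightarrow> ('h \<Rightarrow>\<^sub>L 'h) \<Rightarrow> bool"
    (infix \<open>\<le>\<^sub>o\<^sub>p\<close> 50) where
  "A \<le>\<^sub>o\<^sub>p B \<longleftrightarrow> positive_op (B - A)"

definition projection_op :: "('h::complex_hilbert_space \<Rightarrow>\<^sub>L 'h) \<Rightarrow> bool" where
  "projection_op P \<longleftrightarrow> P \<in> bounded_ops \<and> adj_op P = P \<and> P o\<^sub>L P = P"


section \<open>Spectral measures and Borel functional calculus\<close>

text \<open>A projection-valued measure on the Borel sets of the real line; it is set to zero
  on all other sets, so that it is determined as a function.\<close>

definition proj_valued_measure :: "(real set \<Rightarrow> 'h::complex_hilbert_space \<Rightarrow>\<^sub>L 'h) \<Rightarrow> bool" where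
  "proj_valued_measure E \<longleftrightarrow>
     (\<forall>B\<in>sets borel. projection_op (E B)) \<and>
     (\<forall>B. B \<notin> sets borel \<longrightarrow> E B = 0) \<and>
     E UNIV = id_blinfun \<and>
     (\<forall>B\<in>sets borel. \<forall>C\<in>sets borel. E (B \<inter> C) = E B o\<^sub>L E C) \<and>
     (\<forall>F::nat \<Rightarrow> real set. range F \<subseteq> sets borel \<longrightarrow> disjoint_family F \<longrightarrow>
        (\<forall>x. (\<lambda>n. blinfun_apply (E (F n)) x) sums blinfun_apply (E (\<Union>n. F n)) x))"

definition scalar_measure ::
    "(real set \<Rightarrow> 'h::complex_hilbert_space \<Rightarrow>\<^sub>L 'h) \<Rightarrow> 'h \<Rightarrow> real measure" where
  "scalar_measure E x =
     measure_of UNIV (sets borel) (\<lambda>B. ennreal (Re (cinner (blinfun_apply (E B) x) x)))"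

text \<open>For a self-adjoint \<open>A\<close>: the unique compactly supported \<open>E\<close> such that
  \<open>A = \<integral> u dE(u)\<close> weakly. By polarization it suffices to test on the diagonal.\<close>

definition spectral_measure ::
    "('h::complex_hilbert_space \<Rightarrow>\<^sub>L 'h) \<Rightarrow> real set \<Rightarrow> 'h \<Rightarrow>\<^sub>L 'h" where
  "spectral_measure A = (THE E. proj_valued_measure E \<and> (\<exists>K. E {-K..K} = id_blinfun) \<and>
     (\<forall>x. cinner (blinfun_apply A x) x = complex_of_real (\<integral>u. u \<partial>scalar_measure E x)))"

text \<open>\<open>f(A) = \<integral> f dE\<close> for self-adjoint \<open>A\<close> and a real Borel function \<open>f\<close> that is bounded on
  bounded sets.\<close>

definition fun_calc ::
    "(real \<Rightarrow> real) \<Rightarrow> ('h::complex_hilbert_space \<Rightarrow>\<^sub>L 'h) \<Rightarrow> 'h \<Rightarrow>\<^sub>L 'h" where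
  "fun_calc f A = (THE B. B \<in> bounded_ops \<and>
     (\<forall>x. cinner (blinfun_apply B x) x =
        complex_of_real (\<integral>u. f u \<partial>scalar_measure (spectral_measure A) x)))"

definition abs_op :: "('h::complex_hilbert_space \<Rightarrow>\<^sub>L 'h) \<Rightarrow> 'h \<Rightarrow>\<^sub>L 'h" where
  "abs_op A = fun_calc sqrt (adj_op A o\<^sub>L A)"

text \<open>\<open>T\<^sup>s\<close> for positive \<open>T\<close> and \<open>s > 0\<close>.\<close>

definition powr_op :: "('h::complex_hilbert_space \<Rightarrow>\<^sub>L 'h) \<Rightarrow> real \<Rightarrow> 'h \<Rightarrow>\<^sub>L 'h" where
  "powr_op T s = fun_calc (\<lambda>u. u powr s) T"


section \<open>Von Neumann algebras and traces\<close>

definition commutant ::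
    "('h::complex_hilbert_space \<Rightarrow>\<^sub>L 'h) set \<Rightarrow> ('h \<Rightarrow>\<^sub>L 'h) set" where
  "commutant S = {A \<in> bounded_ops. \<forall>B\<in>S. A o\<^sub>L B = B o\<^sub>L A}"

text \<open>Dixmier's definition: a self-adjoint set of operators equal to its bicommutant.\<close>

definition von_neumann_algebra :: "('h::complex_hilbert_space \<Rightarrow>\<^sub>L 'h) set \<Rightarrow> bool" where
  "von_neumann_algebra N \<longleftrightarrow>
     N \<subseteq> bounded_ops \<and> (\<forall>A\<in>N. adj_op A \<in> N) \<and> commutant (commutant N) = N"

definition pos_part :: "('h::complex_hilbert_space \<Rightarrow>\<^sub>L 'h) set \<Rightarrow> ('h \<Rightarrow>\<^sub>L 'h) set" where
  "pos_part N = {A \<in> N. positive_op A}"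

text \<open>Only the values of \<open>\<tau>\<close> on the positive part of \<open>N\<close> are meaningful.
  The product in \<^typ>\<open>ennreal\<close> satisfies \<open>0 * \<infinity> = 0\<close>.\<close>

definition trace_on ::
    "('h::complex_hilbert_space \<Rightarrow>\<^sub>L 'h) set \<Rightarrow> (('h \<Rightarrow>\<^sub>L 'h) \<Rightarrow> ennreal) \<Rightarrow> bool" where
  "trace_on N \<tau> \<longleftrightarrow>
     (\<forall>A\<in>pos_part N. \<forall>B\<in>pos_part N. \<tau> (A + B) = \<tau> A + \<tau> B) \<and>
     (\<forall>A\<in>pos_part N. \<forall>c\<ge>0. \<tau> (c *\<^sub>R A) = ennreal c * \<tau> A) \<and>
     (\<forall>A\<in>N. \<tau> (adj_op A o\<^sub>L A) = \<tau> (A o\<^sub>L adj_op A))"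

definition faithful_trace ::
    "('h::complex_hilbert_space \<Rightarrow>\<^sub>L 'h) set \<Rightarrow> (('h \<Rightarrow>\<^sub>L 'h) \<Rightarrow> ennreal) \<Rightarrow> bool" where
  "faithful_trace N \<tau> \<longleftrightarrow> (\<forall>A\<in>pos_part N. \<tau> A = 0 \<longrightarrow> A = 0)"

definition is_lub_op ::
    "('h::complex_hilbert_space \<Rightarrow>\<^sub>L 'h) set \<Rightarrow> ('h \<Rightarrow>\<^sub>L 'h) set \<Rightarrow> ('h \<Rightarrow>\<^sub>L 'h) \<Rightarrow> bool" where
  "is_lub_op N D A \<longleftrightarrow> A \<in> pos_part N \<and> (\<forall>B\<in>D. B \<le>\<^sub>o\<^sub>p A) \<and>
     (\<forall>C\<in>pos_part N. (\<forall>B\<in>D. B \<le>\<^sub>o\<^sub>p C) \<longrightarrow> A \<le>\<^sub>o\<^sub>p C)"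

definition normal_trace ::
    "('h::complex_hilbert_space \<Rightarrow>\<^sub>L 'h) set \<Rightarrow> (('h \<Rightarrow>\<^sub>L 'h) \<Rightarrow> ennreal) \<Rightarrow> bool" where
  "normal_trace N \<tau> \<longleftrightarrow> (\<forall>D A. D \<noteq> {} \<longrightarrow> D \<subseteq> pos_part N \<longrightarrow>
     (\<forall>B\<in>D. \<forall>C\<in>D. \<exists>F\<in>D. B \<le>\<^sub>o\<^sub>p F \<and> C \<le>\<^sub>o\<^sub>p F) \<longrightarrow>
     is_lub_op N D A \<longrightarrow> \<tau> A = (SUP B\<in>D. \<tau> B))"

definition semifinite_trace ::
    "('h::complex_hilbert_space \<Rightarrow>\<^sub>L 'h) set \<Rightarrow> (('h \<Rightarrow>\<^sub>L 'h) \<Rightarrow> ennreal) \<Rightarrow> bool" where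
  "semifinite_trace N \<tau> \<longleftrightarrow>
     (\<forall>A\<in>pos_part N. A \<noteq> 0 \<longrightarrow> (\<exists>B\<in>pos_part N. B \<noteq> 0 \<and> B \<le>\<^sub>o\<^sub>p A \<and> \<tau> B < \<infinity>))"


section \<open>Generalised singular values and operator ideals\<close>

definition sing_val ::
    "(('h::complex_hilbert_space \<Rightarrow>\<^sub>L 'h) \<Rightarrow> ennreal) \<Rightarrow> real \<Rightarrow> ('h \<Rightarrow>\<^sub>L 'h) \<Rightarrow> real" where
  "sing_val \<tau> t A = Inf {s. 0 \<le> s \<and> \<tau> (spectral_measure (abs_op A) {s<..}) \<le> ennreal t}"

definition sing_val_integral ::
    "(('h::complex_hilbert_space \<Rightarrow>\<^sub>L 'h) \<Rightarrow> ennreal) \<Rightarrow> ('h \<Rightarrow>\<^sub>L 'h) \<Rightarrow> real \<Rightarrow> real" where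
  "sing_val_integral \<tau> A t = (LINT s:{0..t}|lborel. sing_val \<tau> s A)"

definition psi :: "real \<Rightarrow> real \<Rightarrow> real" where
  "psi p t = (if p = 1 then (if t \<le> 1 then t * ln 2 else ln (1 + t))
              else (if t \<le> 1 then t else t powr (1 - 1 / p)))"

definition weak_ideal ::
    "('h::complex_hilbert_space \<Rightarrow>\<^sub>L 'h) set \<Rightarrow> (('h \<Rightarrow>\<^sub>L 'h) \<Rightarrow> ennreal) \<Rightarrow> real \<Rightarrow> ('h \<Rightarrow>\<^sub>L 'h) set"
  where "weak_ideal N \<tau> p =
     {A \<in> N. (SUP t\<in>{0<..}. ereal (1 / psi p t * sing_val_integral \<tau> A t)) < \<infinity>}"

text \<open>Real powers on \<open>[0, \<infinity>]\<close>, for exponents \<open>a > 0\<close>.\<close>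

definition ennreal_powr :: "ennreal \<Rightarrow> real \<Rightarrow> ennreal" where
  "ennreal_powr x a = (if x = \<infinity> then \<infinity> else ennreal (enn2real x powr a))"

definition zeta_space ::
    "('h::complex_hilbert_space \<Rightarrow>\<^sub>L 'h) set \<Rightarrow> (('h \<Rightarrow>\<^sub>L 'h) \<Rightarrow> ennreal) \<Rightarrow> real \<Rightarrow> ('h \<Rightarrow>\<^sub>L 'h) set"
  where "zeta_space N \<tau> p =
     {T \<in> pos_part N.
        Limsup (at_right p) (\<lambda>s. ennreal_powr (ennreal (s - p) * \<tau> (powr_op T s)) (1 / s)) < \<infinity>}"


section \<open>States on essentially bounded functions and generalised limits\<close>

text \<open>Elements of \<open>L\<^sub>\<infinity>(M)\<close> are represented by functions; functionals on \<open>L\<^sub>\<infinity>(M)\<close> are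
  represented by functionals on functions that respect equality almost everywhere. The values
  of the functions outside the space of \<open>M\<close> are irrelevant, and so are the values of the
  functionals outside \<open>L\<^sub>\<infinity>(M)\<close>.\<close>

definition L_infinity :: "real measure \<Rightarrow> (real \<Rightarrow> complex) set" where
  "L_infinity M = {f \<in> borel_measurable M. \<exists>C. AE x in M. cmod (f x) \<le> C}"

definition state_on :: "real measure \<Rightarrow> ((real \<Rightarrow> complex) \<Rightarrow> complex) \<Rightarrow> bool" where
  "state_on M \<omega> \<longleftrightarrow>
     (\<forall>f\<in>L_infinity M. \<forall>g\<in>L_infinity M. (AE x in M. f x = g x) \<longrightarrow> \<omega> f = \<omega> g) \<and>
     (\<forall>f\<in>L_infinity M. \<forall>g\<in>L_infinity M. \<omega> (\<lambda>x. f x + g x) = \<omega> f + \<omega> g) \<and>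
     (\<forall>f\<in>L_infinity M. \<forall>c. \<omega> (\<lambda>x. c * f x) = c * \<omega> f) \<and>
     (\<forall>f\<in>L_infinity M. (AE x in M. f x \<in> \<real>\<^sub>\<ge>\<^sub>0) \<longrightarrow> \<omega> f \<in> \<real>\<^sub>\<ge>\<^sub>0) \<and>
     \<omega> (\<lambda>x. 1) = 1"

abbreviation pos_reals_measure :: "real measure" where
  "pos_reals_measure \<equiv> lebesgue_on {0<..}"

definition ess_limsup :: "(real \<Rightarrow> real) \<Rightarrow> ereal" where
  "ess_limsup f = (INF N\<in>{0<..}. esssup (lebesgue_on {N<..}) (\<lambda>t. ereal (f t)))"

definition ess_liminf :: "(real \<Rightarrow> real) \<Rightarrow> ereal" where
  "ess_liminf f = - ess_limsup (\<lambda>t. - f t)"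

definition admissible_state :: "((real \<Rightarrow> complex) \<Rightarrow> complex) \<Rightarrow> bool" where
  "admissible_state \<omega> \<longleftrightarrow> state_on pos_reals_measure \<omega> \<and>
     (\<forall>f. continuous_on {0<..} f \<longrightarrow> (f \<longlongrightarrow> 0) (at_right 0) \<longrightarrow> (f \<longlongrightarrow> 0) at_top \<longrightarrow> \<omega> f = 0) \<and>
     (\<forall>f::real \<Rightarrow> real. (\<lambda>x. complex_of_real (f x)) \<in> L_infinity pos_reals_measure \<longrightarrow>
        ess_liminf f \<le> ereal (Re (\<omega> (\<lambda>x. complex_of_real (f x)))) \<and>
        ereal (Re (\<omega> (\<lambda>x. complex_of_real (f x)))) \<le> ess_limsup f) \<and>
     (\<forall>f\<in>L_infinity pos_reals_measure.
        (\<exists>K. compact K \<and> K \<subseteq> {0<..} \<and> (AE x in pos_reals_measure. x \<notin> K \<longrightarrow> f x = 0)) \<longrightarrow>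
        \<omega> f = 0)"

definition D_invariant :: "real \<Rightarrow> ((real \<Rightarrow> complex) \<Rightarrow> complex) \<Rightarrow> bool" where
  "D_invariant a \<omega> \<longleftrightarrow> (\<forall>f\<in>L_infinity pos_reals_measure. \<omega> (\<lambda>x. f (x / a)) = \<omega> f)"

definition P_invariant :: "real \<Rightarrow> ((real \<Rightarrow> complex) \<Rightarrow> complex) \<Rightarrow> bool" where
  "P_invariant a \<omega> \<longleftrightarrow> (\<forall>f\<in>L_infinity pos_reals_measure. \<omega> (\<lambda>x. f (x powr a)) = \<omega> f)"

text \<open>The functional \<open>\<omega> \<circ> L\<close> on \<open>L\<^sub>\<infinity>(\<real>)\<close>, where \<open>L f = f \<circ> log\<close>.\<close>

definition log_transfer ::
    "((real \<Rightarrow> complex) \<Rightarrow> complex) \<Rightarrow> (real \<Rightarrow> complex) \<Rightarrow> complex" where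
  "log_transfer \<omega> f = \<omega> (f \<circ> ln)"

text \<open>\<open>state_lim M \<omega> f l\<close>: the function \<open>f\<close> agrees for large arguments with an element of
  \<open>L\<^sub>\<infinity>(M)\<close>, and \<open>\<omega>\<close> takes the value \<open>l\<close> there. The functionals considered here do not depend
  on the chosen representative.\<close>

definition state_lim ::
    "real measure \<Rightarrow> ((real \<Rightarrow> complex) \<Rightarrow> complex) \<Rightarrow> (real \<Rightarrow> ereal) \<Rightarrow> real \<Rightarrow> bool" where
  "state_lim M \<omega> f l \<longleftrightarrow> (\<exists>g::real \<Rightarrow> real.
     (\<lambda>t. complex_of_real (g t)) \<in> L_infinity M \<and>
     (\<forall>\<^sub>F t in at_top. f t = ereal (g t)) \<and>
     \<omega> (\<lambda>t. complex_of_real (g t)) = complex_of_real l)"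

definition log_mean ::
    "(('h::complex_hilbert_space \<Rightarrow>\<^sub>L 'h) \<Rightarrow> ennreal) \<Rightarrow> ('h \<Rightarrow>\<^sub>L 'h) \<Rightarrow> real \<Rightarrow> real" where
  "log_mean \<tau> S t = 1 / ln (1 + t) * sing_val_integral \<tau> S t"

definition dixmier_trace ::
    "(('h::complex_hilbert_space \<Rightarrow>\<^sub>L 'h) \<Rightarrow> ennreal) \<Rightarrow> ((real \<Rightarrow> complex) \<Rightarrow> complex) \<Rightarrow>
     ('h \<Rightarrow>\<^sub>L 'h) \<Rightarrow> real" where
  "dixmier_trace \<tau> \<omega> S =
     (THE l. state_lim pos_reals_measure \<omega> (\<lambda>t. ereal (log_mean \<tau> S t)) l)"

text \<open>The function \<open>r \<mapsto> (1/r) \<tau>(T\<^bsup>p+1/r\<^esup>)\<close>, which may take the value \<open>\<infinity>\<close>.\<close>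

definition zeta_mean ::
    "(('h::complex_hilbert_space \<Rightarrow>\<^sub>L 'h) \<Rightarrow> ennreal) \<Rightarrow> real \<Rightarrow> ('h \<Rightarrow>\<^sub>L 'h) \<Rightarrow> real \<Rightarrow> ereal" where
  "zeta_mean \<tau> p T r = enn2ereal (ennreal (1 / r) * \<tau> (powr_op T (p + 1 / r)))"

end

theory Submission
  imports Defs "HOL-Probability.Helly_Selection" "HOL-Real_Asymp.Real_Asymp"
begin

text \<open>For a positive operator \<open>T\<close> and a vector \<open>x\<close>, the numbers \<open>\<langle>T\<^sup>n x, x\<rangle>\<close> are the moments of a
  measure, by the solution of the Hausdorff moment problem; polarisation of these measures gives the
  Borel functional calculus and the spectral measure. Normality of the trace makes \<open>\<tau> \<circ> E\<close> a
  measure \<open>\<nu>\<close> with \<open>\<tau>(T\<^sup>s) = \<integral>u\<^sup>s d\<nu>\<close>, and the singular values of \<open>T\<^sup>p\<close> are the decreasing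
  rearrangement of \<open>u\<^sup>p\<close>.

  In the variable \<open>-log u\<^sup>p\<close>, the function \<open>r \<mapsto> \<tau>(T\<^bsup>p+1/r\<^esup>)\<close> is, up to a bounded term, a Laplace
  transform at \<open>1/(pr)\<close> of the measure \<open>u\<^sup>p d\<nu>\<close>, and \<open>\<integral>\<^sub>0\<^sup>t \<mu>\<^sub>s(T\<^sup>p) ds\<close> lies, up to bounded terms,
  between the values at \<open>(log t)/\<alpha>\<close> and \<open>log t\<close> of its distribution function, for every \<open>\<alpha> > 1\<close>.
  Karamata's polynomial approximation argument compares the Laplace transform with the distribution
  function; it needs only linearity, monotonicity and dilation invariance of the limit. True limits
  have these properties, and so does \<open>\<omega> \<circ> L\<close>, since \<open>L\<close> turns dilations into powers.\<close>

section \<open>The real inner product of a complex Hilbert space\<close>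

text \<open>Spectral measures, the functional calculus and the Dixmier trace are given by definite
  descriptions, so existence and uniqueness have to be proved before any of their values is known.
  Uniqueness of the spectral measure is the delicate one: the description fixes only the first
  moment of each scalar measure, and multiplicativity of the projections has to produce the higher
  moments. Both hypotheses of (a) are reduced to one consequence, boundedness of the logarithmic
  means of \<mu>(T^p), and the limit theorems start from that bound; a finite limit in (b) implies
  it through membership in Z_p. The bounded error terms come from the spectrum of T^p above 1, whose
  projection has finite trace, and one unit comes from the levels below 1/t. The loss \<alpha> > 1
  arises because bounded means give only \<mu>_t = O(log t / t), hence \<tau>(E(exp(-y),
  \<infinity>)) <= exp(\<alpha> y) for large y and each \<alpha> > 1. It changes a limit by a factor
  \<alpha>, and a squeeze with \<alpha> close to 1 removes it.\<close>

definition rinner :: "'h::complex_hilbert_space \<Rightarrow> 'h \<Rightarrow> real" where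
  "rinner x y = Re (cinner x y)"

lemma rinner_commute: "rinner x y = rinner y x"
  unfolding rinner_def by (subst cinner_commute) simp

lemma rinner_add_left: "rinner (x + y) z = rinner x z + rinner y z"
  by (simp add: rinner_def cinner_add_left)

lemma rinner_scaleR_left: "rinner (r *\<^sub>R x) y = r * rinner x y"
  by (simp add: rinner_def cinner_scaleC_left flip: scaleC_of_real)

lemma rinner_self: "rinner x x = (norm x)\<^sup>2"
  by (simp add: rinner_def cinner_self)

lemma rinner_add_right: "rinner z (x + y) = rinner z x + rinner z y"
  by (metis rinner_commute rinner_add_left)

lemma rinner_scaleR_right: "rinner x (r *\<^sub>R y) = r * rinner x y"
  by (metis rinner_commute rinner_scaleR_left)

lemma rinner_le: "rinner x y \<le> norm x * norm y"
proof -
  have "(norm (x + y))\<^sup>2 \<le> (norm x + norm y)\<^sup>2"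
    by (intro power_mono norm_triangle_ineq) simp
  moreover have "(norm (x + y))\<^sup>2 = (norm x)\<^sup>2 + 2 * rinner x y + (norm y)\<^sup>2"
    by (simp flip: rinner_self add: rinner_add_left rinner_add_right rinner_commute)
  ultimately show ?thesis by (simp add: power2_sum)
qed

lemma rinner_uminus_left: "rinner (- x) y = - rinner x y"
  using rinner_scaleR_left[of "-1"] by simp

lemma abs_rinner_le: "\<bar>rinner x y\<bar> \<le> norm x * norm y"
  using rinner_le[of x y] rinner_le[of "-x" y] by (simp add: rinner_uminus_left)

interpretation rinner: bounded_bilinear "rinner :: 'h::complex_hilbert_space \<Rightarrow> _"
  by unfold_locales
    (use abs_rinner_le in \<open>auto simp: rinner_add_left rinner_add_right rinner_scaleR_left
       rinner_scaleR_right intro!: exI[of _ 1]\<close>)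

lemma rinner_ii: "rinner (\<i> *\<^sub>C x) y = - rinner x (\<i> *\<^sub>C y)"
  unfolding rinner_def
  by (subst (2) cinner_commute) (simp add: cinner_scaleC_left, subst cinner_commute, simp)

lemma ii_ii: "\<i> *\<^sub>C (\<i> *\<^sub>C x) = - x"
  using scaleC_of_real[of "-1" x] by (simp add: scaleC_scaleC)

text \<open>Multiplication by i exchanges real and imaginary parts, so the real inner product
  determines the complex one. Representation and uniqueness arguments can therefore run over the
  reals, as the real-linear type of operators suggests.\<close>

lemma cinner_eq: "cinner x y = Complex (rinner x y) (- rinner (\<i> *\<^sub>C x) y)"
  by (simp add: complex_eq_iff rinner_def cinner_scaleC_left)

lemma rinner_eqI:
  assumes "\<And>y. rinner x y = rinner x' y"
  shows "x = x'"
proof -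
  have "rinner (x - x') (x - x') = 0"
    using assms by (simp add: rinner.diff_left)
  then show ?thesis by (simp add: rinner_self)
qed

lemma parallelogram:
  "(norm (x + y))\<^sup>2 + (norm (x - y))\<^sup>2 = 2 * (norm x)\<^sup>2 + 2 * (norm (y::'h::complex_hilbert_space))\<^sup>2"
  by (simp flip: rinner_self
      add: rinner.add_left rinner.add_right rinner.diff_left rinner.diff_right)

text \<open>The representing vector minimises \<open>\<parallel>x\<parallel>\<^sup>2 - 2 f x\<close>; minimising sequences are Cauchy by the
  parallelogram law.\<close>

theorem Riesz_representation:
  fixes f :: "'h::complex_hilbert_space \<Rightarrow> real"
  assumes f: "bounded_linear f"
  obtains z where "\<And>x. f x = rinner z x"
proof -
  interpret f: bounded_linear f by fact
  define J where "J x = (norm x)\<^sup>2 - 2 * f x" for x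
  obtain C where C: "\<And>x. \<bar>f x\<bar> \<le> norm x * C" using f.bounded by auto
  have low: "- C\<^sup>2 \<le> J x" for x
  proof -
    \<comment> \<open>Completing the square: \<open>J x\<close> is at least (|x| - C)^2 - C^2, so
      the infimum of \<open>J\<close> is finite.\<close>
    have "0 \<le> (norm x - C)\<^sup>2" by simp
    then show ?thesis using C[of x] by (simp add: J_def power2_diff algebra_simps)
  qed
  define d where "d = Inf (range J)"
  have d: "d \<le> J x" for x
    unfolding d_def by (rule cInf_lower) (use low in \<open>auto intro!: bdd_belowI\<close>)
  have "\<exists>x. J x < d + 1 / Suc n" for n
    using cInf_lessD[of "range J" "d + 1 / Suc n"] by (auto simp: d_def)
  then obtain x where x: "\<And>n. J (x n) < d + 1 / Suc n" by metis
  have dist: "(norm (x n - x m))\<^sup>2 \<le> 2 / Suc n + 2 / Suc m" for n m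
  proof -
    have "(norm (x n + x m))\<^sup>2 = 4 * (norm ((1/2) *\<^sub>R (x n + x m)))\<^sup>2"
      by (simp add: power_mult_distrib power2_eq_square)
    moreover have "f ((1/2) *\<^sub>R (x n + x m)) = (f (x n) + f (x m)) / 2"
      by (simp only: f.scaleR f.add) simp
    \<comment> \<open>The linear parts cancel in this combination, and \<open>J\<close> at the
      midpoint is at least \<open>d\<close>, so near-minimisers are close to each other.\<close>
    ultimately have "(norm (x n - x m))\<^sup>2 = 2 * J (x n) + 2 * J (x m) - 4 * J ((1/2) *\<^sub>R (x n + x m))"
      using parallelogram[of "x n" "x m"] by (simp add: J_def)
    also have "\<dots> \<le> 2 * (d + 1 / Suc n) + 2 * (d + 1 / Suc m) - 4 * d"
    proof -
      have "2 * a + 2 * b - 4 * c \<le> 2 * (d + e) + 2 * (d + e') - 4 * d"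
        if "a < d + e" "b < d + e'" "d \<le> c" for a b c e e'
        using that by argo
      then show ?thesis using x d by blast
    qed
    finally show ?thesis by simp
  qed
  have "Cauchy x"
  proof (rule CauchyI)
    fix e :: real assume "0 < e"
    obtain M where M: "real M > 4 / e\<^sup>2" using reals_Archimedean2 by blast
    have "norm (x m - x n) < e" if "M \<le> m" "M \<le> n" for m n
    proof -
      have *: "2 / Suc k < e\<^sup>2 / 2" if "M \<le> k" for k
      proof -
        have "4 / e\<^sup>2 < Suc k" using M that by linarith
        then show ?thesis using \<open>0 < e\<close> by (simp add: field_simps)
      qed
      have "(norm (x m - x n))\<^sup>2 < e\<^sup>2"
        using dist[of m n] *[OF that(1)] *[OF that(2)] by linarith
      then show ?thesis using \<open>0 < e\<close> by (simp add: power_less_imp_less_base)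
    qed
    then show "\<exists>M. \<forall>m\<ge>M. \<forall>n\<ge>M. norm (x m - x n) < e" by blast
  qed
  then obtain z where z: "x \<longlonglongrightarrow> z"
    using Cauchy_convergent_iff convergent_def by metis
  have "(\<lambda>n. J (x n)) \<longlonglongrightarrow> J z"
    unfolding J_def using f.tendsto[OF z] z by (intro tendsto_intros) auto
  moreover have "(\<lambda>n. d + 1 / Suc n) \<longlonglongrightarrow> d + 0"
    by (intro tendsto_intros LIMSEQ_Suc[OF lim_1_over_n])
  ultimately have "J z \<le> d"
    using LIMSEQ_le[of "\<lambda>n. J (x n)" "J z" "\<lambda>n. d + 1 / Suc n" d] x
    by (metis add.right_neutral less_imp_le)
  then have Jz: "J z \<le> J y" for y using d[of y] by linarith
  have "f y = rinner z y" for y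
  proof -
    have q: "0 \<le> 2 * t * (rinner z y - f y) + t\<^sup>2 * (norm y)\<^sup>2" for t
    proof -
      have "(norm (z + t *\<^sub>R y))\<^sup>2 = (norm z)\<^sup>2 + 2 * t * rinner z y + t\<^sup>2 * (norm y)\<^sup>2"
        unfolding rinner_self[symmetric]
        by (simp add: rinner.add_left rinner.add_right rinner.scaleR_left rinner.scaleR_right
            rinner_commute[of y z] power2_eq_square algebra_simps)
      moreover have "f (z + t *\<^sub>R y) = f z + t * f y" by (simp add: f.add f.scaleR)
      ultimately show ?thesis
        using Jz[of "z + t *\<^sub>R y"] by (simp add: J_def algebra_simps)
    qed
    \<comment> \<open>A quadratic in t that never becomes negative is tested at t = -a/b. The
      summand 1 in \<open>b\<close> keeps the division legitimate for y = 0.\<close>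
    define a where "a = rinner z y - f y"
    define b where "b = (norm y)\<^sup>2 + 1"
    have "b > 0" by (simp add: b_def add_nonneg_pos)
    have "0 \<le> 2 * (- a / b) * a + (- a / b)\<^sup>2 * b"
      using q[of "- a / b"] unfolding a_def[symmetric] b_def
      by (smt (verit, ccfv_SIG) mult_left_mono zero_le_power2)
    also have "\<dots> = - (a\<^sup>2 / b)"
      using \<open>b > 0\<close> by (simp add: power2_eq_square field_simps)
    finally have "a\<^sup>2 / b \<le> 0" by simp
    then have "a = 0"
      using \<open>b > 0\<close> by (simp add: divide_le_0_iff)
    then show ?thesis by (simp add: a_def)
  qed
  then show ?thesis by (rule that)
qed

text \<open>Riesz applied to each \<open>b x\<close> gives the value of the operator; testing the
  form on that value itself bounds its norm.\<close>

lemma bounded_form_representation: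
  fixes b :: "'h::complex_hilbert_space \<Rightarrow> 'h \<Rightarrow> real"
  assumes b: "bounded_bilinear b"
  obtains A :: "'h \<Rightarrow>\<^sub>L 'h" where "\<And>x y. rinner (blinfun_apply A x) y = b x y"
proof -
  interpret b: bounded_bilinear b by fact
  have "\<exists>z. \<forall>y. b x y = rinner z y" for x
    using Riesz_representation[OF b.bounded_linear_right[of x]] by metis
  then obtain g where g: "\<And>x y. b x y = rinner (g x) y" by metis
  obtain K where K: "\<And>x y. norm (b x y) \<le> norm x * norm y * K" and "0 \<le> K"
    using b.nonneg_bounded by blast
  have "bounded_linear g"
  proof (rule bounded_linear_intro)
    show "g (x + y) = g x + g y" for x y
      by (rule rinner_eqI) (simp add: rinner.add_left flip: g, simp add: b.add_left)
    show "g (r *\<^sub>R x) = r *\<^sub>R g x" for r x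
      by (rule rinner_eqI) (simp add: rinner.scaleR_left flip: g, simp add: b.scaleR_left)
    show "norm (g x) \<le> norm x * K" for x
    proof (cases "g x = 0")
      case True
      then show ?thesis using \<open>0 \<le> K\<close> by simp
    next
      case False
      have "norm (g x) * norm (g x) \<le> norm x * norm (g x) * K"
        using K[of x "g x"] by (simp add: g rinner_self power2_eq_square)
      then have "norm (g x) * norm (g x) \<le> norm (g x) * (norm x * K)" by (simp add: ac_simps)
      then show ?thesis using False by (simp add: mult_le_cancel_left)
    qed
  qed
  then show ?thesis
    by (intro that[of "Blinfun g"]) (simp add: bounded_linear_Blinfun_apply g)
qed

lemma exists_real_adjoint:
  fixes A :: "'h::complex_hilbert_space \<Rightarrow>\<^sub>L 'h"
  obtains B :: "'h \<Rightarrow>\<^sub>L 'h"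
  where "\<And>x y. rinner (blinfun_apply A x) y = rinner x (blinfun_apply B y)"
proof -
  have "bounded_bilinear (\<lambda>y x. rinner (blinfun_apply A x) y)"
    by (rule bounded_bilinear.flip) 
       (rule rinner.comp1[OF blinfun.bounded_linear_right])
  then show ?thesis
    by (rule bounded_form_representation) (metis that rinner_commute)
qed

section \<open>Complex-linear operators, adjoints and positivity\<close>

lemma bounded_ops_ii:
  "A \<in> bounded_ops \<Longrightarrow> blinfun_apply A (\<i> *\<^sub>C x) = \<i> *\<^sub>C blinfun_apply A x"
  by (simp add: bounded_ops_def)

text \<open>Real linearity is built into the type, so commuting with i is all that complex linearity
  adds.\<close>

lemma bounded_opsI:
  assumes "\<And>x. blinfun_apply A (\<i> *\<^sub>C x) = \<i> *\<^sub>C blinfun_apply A x"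
  shows "A \<in> bounded_ops"
proof -
  have *: "c *\<^sub>C x = Re c *\<^sub>R x + Im c *\<^sub>R (\<i> *\<^sub>C x)" for c and x :: 'a
    using complex_eq[of c] by (simp add: scaleC_scaleC mult.commute flip: scaleC_of_real scaleC_add_left)
  have "blinfun_apply A (c *\<^sub>C x) = c *\<^sub>C blinfun_apply A x" for c x
    unfolding *[of c x] *[of c "blinfun_apply A x"]
    by (simp only: blinfun.add_right blinfun.scaleR_right assms)
  then show ?thesis by (simp add: bounded_ops_def)
qed

lemma adjoint_cinner:
  assumes "A \<in> bounded_ops" "\<And>x y. rinner (blinfun_apply A x) y = rinner x (blinfun_apply B y)"
  shows "cinner (blinfun_apply A x) y = cinner x (blinfun_apply B y)"
  using assms(1) assms(2)[of x y] assms(2)[of "\<i> *\<^sub>C x" y]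
  by (simp add: cinner_eq bounded_ops_ii)

lemma adj_op_eqI:
  assumes "A \<in> bounded_ops" "\<And>x y. rinner (blinfun_apply A x) y = rinner x (blinfun_apply B y)"
  shows "adj_op A = B"
  unfolding adj_op_def
proof (rule the_equality)
  fix C assume C: "\<forall>x y. cinner (blinfun_apply A x) y = cinner x (blinfun_apply C y)"
  have "rinner (blinfun_apply C y) x = rinner (blinfun_apply B y) x" for x y
    using C assms(2) by (metis rinner_commute rinner_def)
  then show "C = B" by (intro blinfun_eqI rinner_eqI)
qed (use adjoint_cinner[OF assms] in auto)

lemma rinner_adj_op:
  assumes "A \<in> bounded_ops"
  shows "rinner (blinfun_apply A x) y = rinner x (blinfun_apply (adj_op A) y)"
  using exists_real_adjoint[of A] adj_op_eqI[OF assms] by metis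

text \<open>A quadratic form with real values on a complex space is hermitian: evaluating the
  vanishing imaginary part at x + i y isolates the cross terms.\<close>

lemma positive_op_symmetric:
  assumes "positive_op A"
  shows "rinner (blinfun_apply A x) y = rinner x (blinfun_apply A y)"
proof -
  have A: "A \<in> bounded_ops" and "\<And>x. cinner (blinfun_apply A x) x \<in> \<real>\<^sub>\<ge>\<^sub>0"
    using assms by (auto simp: positive_op_def)
  then have im: "rinner (\<i> *\<^sub>C blinfun_apply A x) x = 0" for x
    by (auto simp: cinner_eq nonneg_Reals_def complex_eq_iff)
  then have im': "\<And>x. rinner (blinfun_apply A x) (\<i> *\<^sub>C x) = 0"
    by (simp add: rinner_ii)
  show ?thesis
    using im'[of "x + \<i> *\<^sub>C y"] im'[of x] im'[of y] A
    by (simp add: scaleC_add_right blinfun.add_right bounded_ops_ii rinner.add_left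
        rinner.add_right ii_ii rinner_ii rinner.minus_left rinner.minus_right
        rinner.diff_left rinner.diff_right rinner_commute[of x])
qed

lemma positive_op_nonneg: "positive_op A \<Longrightarrow> 0 \<le> rinner (blinfun_apply A x) x"
  by (auto simp: positive_op_def rinner_def complex_nonneg_Reals_iff)

lemma symmetric_op_cinner:
  assumes "A \<in> bounded_ops" "\<And>x y. rinner (blinfun_apply A x) y = rinner x (blinfun_apply A y)"
  shows "cinner (blinfun_apply A x) x = complex_of_real (rinner (blinfun_apply A x) x)"
proof -
  have "rinner (\<i> *\<^sub>C blinfun_apply A x) x = rinner (blinfun_apply A (\<i> *\<^sub>C x)) x"
    by (simp add: assms bounded_ops_ii)
  also have "\<dots> = - rinner x (\<i> *\<^sub>C blinfun_apply A x)" by (simp only: assms(2) rinner_ii)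
  finally have "rinner (\<i> *\<^sub>C blinfun_apply A x) x = 0" by (simp add: rinner_commute)
  then show ?thesis by (simp add: cinner_eq complex_eq_iff)
qed

lemma positive_opI:
  assumes "A \<in> bounded_ops" "\<And>x y. rinner (blinfun_apply A x) y = rinner x (blinfun_apply A y)"
    "\<And>x. 0 \<le> rinner (blinfun_apply A x) x"
  shows "positive_op A"
  unfolding positive_op_def using assms by (auto simp: symmetric_op_cinner nonneg_Reals_of_real_iff)

lemma symmetric_op_eqI:
  assumes "\<And>x y. rinner (blinfun_apply A x) y = rinner x (blinfun_apply A y)"
    "\<And>x y. rinner (blinfun_apply B x) y = rinner x (blinfun_apply B y)"
    "\<And>x. rinner (blinfun_apply A x) x = rinner (blinfun_apply B x) x"
  shows "A = B"
proof (intro blinfun_eqI rinner_eqI)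
  fix x y
  show "rinner (blinfun_apply A x) y = rinner (blinfun_apply B x) y"
    using assms(3)[of "x + y"] assms(3)[of x] assms(3)[of y] assms(1)[of y x] assms(2)[of y x]
    by (simp add: blinfun.add_right rinner.add_left rinner.add_right rinner_commute)
qed

text \<open>Complex polarisation: the vectors x + y give the sum of the two cross terms, and x + i y
  their difference. Symmetry is not assumed, since a competitor in the description of
  \<open>fun_calc\<close> is merely complex-linear.\<close>

lemma bounded_ops_eqI:
  assumes "A \<in> bounded_ops" "B \<in> bounded_ops"
    "\<And>x. cinner (blinfun_apply A x) x = cinner (blinfun_apply B x) x"
  shows "A = B"
proof (intro blinfun_eqI rinner_eqI)
  have *: "rinner (blinfun_apply A x) x = rinner (blinfun_apply B x) x" 
    "rinner (\<i> *\<^sub>C blinfun_apply A x) x = rinner (\<i> *\<^sub>C blinfun_apply B x) x" for x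
    using assms(3)[of x] by (auto simp: cinner_eq)
  fix x y
  have "rinner (blinfun_apply A x) y + rinner (blinfun_apply A y) x
      = rinner (blinfun_apply B x) y + rinner (blinfun_apply B y) x"
    using *(1)[of "x + y"] *(1)[of x] *(1)[of y]
    by (simp add: blinfun.add_right rinner.add_left rinner.add_right)
  moreover have "rinner (blinfun_apply A x) y - rinner (blinfun_apply A y) x
      = rinner (blinfun_apply B x) y - rinner (blinfun_apply B y) x"
    using *(2)[of "x + \<i> *\<^sub>C y"] *(2)[of x] *(2)[of y] *(2)[of "\<i> *\<^sub>C y"] assms(1,2)
    by (simp add: scaleC_add_right blinfun.add_right bounded_ops_ii rinner.add_left
        rinner.add_right ii_ii rinner_ii rinner.minus_left rinner.minus_right
        rinner.diff_left rinner.diff_right)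
  ultimately show "rinner (blinfun_apply A x) y = rinner (blinfun_apply B x) y" by simp
qed


section \<open>Functionals given by signed measures on an interval\<close>

text \<open>Measurability refers to the whole line and boundedness to \<open>S\<close> alone, so
  that powers qualify on an interval containing the spectrum.\<close>

definition bdd_borel :: "real set \<Rightarrow> (real \<Rightarrow> real) set" where
  "bdd_borel S = {f \<in> borel_measurable borel. \<exists>C. \<forall>u\<in>S. \<bar>f u\<bar> \<le> C}"

text \<open>The functionals \<open>f \<mapsto> \<integral>f dM\<close> for signed measures \<open>M\<close> on \<open>S\<close>.\<close>

definition bdd_functional :: "real set \<Rightarrow> ((real \<Rightarrow> real) \<Rightarrow> real) \<Rightarrow> bool" where
  "bdd_functional S \<Lambda> \<longleftrightarrow>
     (\<forall>f\<in>bdd_borel S. \<forall>g\<in>bdd_borel S. \<Lambda> (\<lambda>u. f u + g u) = \<Lambda> f + \<Lambda> g) \<and>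
     (\<forall>f\<in>bdd_borel S. \<forall>c. \<Lambda> (\<lambda>u. c * f u) = c * \<Lambda> f) \<and>
     (\<forall>F f C. (\<forall>n. F n \<in> borel_measurable borel) \<longrightarrow> f \<in> borel_measurable borel \<longrightarrow>
        (\<forall>n. \<forall>u\<in>S. \<bar>F n u\<bar> \<le> C) \<longrightarrow> (\<forall>u\<in>S. (\<lambda>n. F n u) \<longlonglongrightarrow> f u) \<longrightarrow>
        (\<lambda>n. \<Lambda> (F n)) \<longlonglongrightarrow> \<Lambda> f)"

lemma bdd_borelI: "f \<in> borel_measurable borel \<Longrightarrow> (\<And>u. u \<in> S \<Longrightarrow> \<bar>f u\<bar> \<le> C) \<Longrightarrow> f \<in> bdd_borel S"
  by (auto simp: bdd_borel_def)

lemma bdd_borel_bound: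
  assumes "f \<in> bdd_borel S"
  obtains C where "0 \<le> C" "\<And>u. u \<in> S \<Longrightarrow> \<bar>f u\<bar> \<le> C"
proof -
  obtain C where "\<forall>u\<in>S. \<bar>f u\<bar> \<le> C" using assms by (auto simp: bdd_borel_def)
  then show ?thesis by (intro that[of "max 0 C"]) (auto intro: max.coboundedI2)
qed

lemma bdd_borel_measurable: "f \<in> bdd_borel S \<Longrightarrow> f \<in> borel_measurable borel"
  by (simp add: bdd_borel_def)

lemma bdd_borel_add:
  assumes "f \<in> bdd_borel S" "g \<in> bdd_borel S" shows "(\<lambda>u. f u + g u) \<in> bdd_borel S"
proof -
  note [measurable] = assms[THEN bdd_borel_measurable]
  obtain C D where "\<And>u. u \<in> S \<Longrightarrow> \<bar>f u\<bar> \<le> C" "\<And>u. u \<in> S \<Longrightarrow> \<bar>g u\<bar> \<le> D"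
    using assms[THEN bdd_borel_bound] by metis
  then show ?thesis by (intro bdd_borelI[of _ _ "C + D"]) (auto, fastforce)
qed

lemma bdd_borel_mult:
  assumes "f \<in> bdd_borel S" "g \<in> bdd_borel S" shows "(\<lambda>u. f u * g u) \<in> bdd_borel S"
proof -
  note [measurable] = assms[THEN bdd_borel_measurable]
  obtain C D where "0 \<le> C" "\<And>u. u \<in> S \<Longrightarrow> \<bar>f u\<bar> \<le> C" "\<And>u. u \<in> S \<Longrightarrow> \<bar>g u\<bar> \<le> D"
    using assms[THEN bdd_borel_bound] by metis
  then show ?thesis by (intro bdd_borelI[of _ _ "C * D"]) (auto simp: abs_mult intro!: mult_mono)
qed

lemma bdd_borel_const: "(\<lambda>u. c) \<in> bdd_borel S"
  by (rule bdd_borelI[of _ _ "\<bar>c\<bar>"]) auto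

lemma bdd_borel_continuous:
  assumes "continuous_on UNIV f" shows "f \<in> bdd_borel {a..b}"
proof -
  have "compact (f ` {a..b})"
    using assms continuous_on_subset by (intro compact_continuous_image) blast+
  then obtain C where "\<forall>x\<in>f ` {a..b}. norm x \<le> C"
    using compact_imp_bounded bounded_iff by blast
  then show ?thesis
    by (intro bdd_borelI[of _ _ C]) (auto intro: borel_measurable_continuous_onI assms)
qed

lemma bdd_borel_power: "(\<lambda>u. u ^ n) \<in> bdd_borel {a..b}"
  by (intro bdd_borel_continuous continuous_intros)

lemma bdd_borel_id: "(\<lambda>u. u) \<in> bdd_borel {a..b}"
  by (intro bdd_borel_continuous continuous_intros)

lemma bdd_borel_indicator: "B \<in> sets borel \<Longrightarrow> indicator B \<in> bdd_borel S"
  by (rule bdd_borelI[of _ _ 1]) (auto simp: indicator_def)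

lemma bdd_borel_sum:
  "(\<And>i. i \<in> I \<Longrightarrow> f i \<in> bdd_borel S) \<Longrightarrow> (\<lambda>u. \<Sum>i\<in>I. f i u) \<in> bdd_borel S"
  by (induction I rule: infinite_finite_induct) (auto intro: bdd_borel_const bdd_borel_add)

lemma bdd_functional_add:
  "bdd_functional S \<Lambda> \<Longrightarrow> f \<in> bdd_borel S \<Longrightarrow> g \<in> bdd_borel S \<Longrightarrow> \<Lambda> (\<lambda>u. f u + g u) = \<Lambda> f + \<Lambda> g"
  by (simp add: bdd_functional_def)

lemma bdd_functional_cmult:
  "bdd_functional S \<Lambda> \<Longrightarrow> f \<in> bdd_borel S \<Longrightarrow> \<Lambda> (\<lambda>u. c * f u) = c * \<Lambda> f"
  by (simp add: bdd_functional_def)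

lemma bdd_functional_LIMSEQ:
  "\<lbrakk>bdd_functional S \<Lambda>; \<And>n. F n \<in> borel_measurable borel; f \<in> borel_measurable borel;
    \<And>n u. u \<in> S \<Longrightarrow> \<bar>F n u\<bar> \<le> C; \<And>u. u \<in> S \<Longrightarrow> (\<lambda>n. F n u) \<longlonglongrightarrow> f u\<rbrakk> \<Longrightarrow> (\<lambda>n. \<Lambda> (F n)) \<longlonglongrightarrow> \<Lambda> f"
  unfolding bdd_functional_def by blast

lemma bdd_functional_zero: "bdd_functional S \<Lambda> \<Longrightarrow> \<Lambda> (\<lambda>u. 0) = 0"
  using bdd_functional_cmult[of S \<Lambda> "\<lambda>u. 0" 0] by (simp add: bdd_borel_const)

lemma bdd_functional_sum:
  assumes "bdd_functional S \<Lambda>" "\<And>i. i \<in> I \<Longrightarrow> f i \<in> bdd_borel S"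
  shows "\<Lambda> (\<lambda>u. \<Sum>i\<in>I. f i u) = (\<Sum>i\<in>I. \<Lambda> (f i))"
  using assms(2)
  by (induction I rule: infinite_finite_induct)
    (auto simp: bdd_functional_zero[OF assms(1)] bdd_functional_add[OF assms(1)] bdd_borel_sum)

lemma bdd_functional_plus:
  assumes "bdd_functional S \<Lambda>" "bdd_functional S \<Lambda>'"
  shows "bdd_functional S (\<lambda>f. \<Lambda> f + \<Lambda>' f)"
  unfolding bdd_functional_def
  by (auto simp: bdd_functional_add[OF assms(1)] bdd_functional_add[OF assms(2)]
      bdd_functional_cmult[OF assms(1)] bdd_functional_cmult[OF assms(2)] algebra_simps
      intro!: tendsto_add bdd_functional_LIMSEQ[OF assms(1)] bdd_functional_LIMSEQ[OF assms(2)])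

lemma bdd_functional_scale:
  assumes "bdd_functional S \<Lambda>" shows "bdd_functional S (\<lambda>f. c * \<Lambda> f)"
  unfolding bdd_functional_def
  by (auto simp: bdd_functional_add[OF assms(1)] bdd_functional_cmult[OF assms(1)] algebra_simps
      intro!: tendsto_mult_left bdd_functional_LIMSEQ[OF assms(1)])

lemma bdd_functional_minus:
  assumes "bdd_functional S \<Lambda>" "bdd_functional S \<Lambda>'"
  shows "bdd_functional S (\<lambda>f. \<Lambda> f - \<Lambda>' f)"
  using bdd_functional_plus[OF assms(1) bdd_functional_scale[OF assms(2), of "-1"]] by simp

text \<open>Lets a product of two functions be viewed as a functional of one factor with the other
  fixed, so that multiplicative identities can be checked by uniqueness theorems one factor at a
  time.\<close>

lemma bdd_functional_density:
  assumes "bdd_functional S \<Lambda>" "g \<in> bdd_borel S"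
  shows "bdd_functional S (\<lambda>f. \<Lambda> (\<lambda>u. g u * f u))"
proof -
  have a: "\<Lambda> (\<lambda>u. g u * (f u + h u)) = \<Lambda> (\<lambda>u. g u * f u) + \<Lambda> (\<lambda>u. g u * h u)"
    if "f \<in> bdd_borel S" "h \<in> bdd_borel S" for f h
    using that bdd_functional_add[OF assms(1) bdd_borel_mult[OF assms(2)] bdd_borel_mult[OF assms(2)]]
    by (simp add: distrib_left)
  have b: "\<Lambda> (\<lambda>u. g u * (c * f u)) = c * \<Lambda> (\<lambda>u. g u * f u)" if "f \<in> bdd_borel S" for f c
    using that bdd_functional_cmult[OF assms(1) bdd_borel_mult[OF assms(2)], of f c]
    by (simp add: mult.left_commute)
  obtain D where D: "0 \<le> D" "\<And>u. u \<in> S \<Longrightarrow> \<bar>g u\<bar> \<le> D"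
    using assms(2) bdd_borel_bound by blast
  note [measurable] = bdd_borel_measurable[OF assms(2)]
  have "(\<lambda>n. \<Lambda> (\<lambda>u. g u * F n u)) \<longlonglongrightarrow> \<Lambda> (\<lambda>u. g u * f u)"
    if [measurable]: "\<And>n. F n \<in> borel_measurable borel" "f \<in> borel_measurable borel"
      and "\<forall>n. \<forall>u\<in>S. \<bar>F n u\<bar> \<le> C" "\<forall>u\<in>S. (\<lambda>n. F n u) \<longlonglongrightarrow> f u" for F f C
    using that D
    by (intro bdd_functional_LIMSEQ[OF assms(1), where C="D * C"])
       (auto simp: abs_mult intro!: mult_mono tendsto_mult_left)
  with a b show ?thesis unfolding bdd_functional_def by blast
qed

lemma bdd_borel_integrable:
  assumes "finite_measure M" "sets M = sets borel" "AE u in M. u \<in> S" "f \<in> bdd_borel S"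
  shows "integrable M f"
proof -
  interpret finite_measure M by fact
  obtain C where C: "\<And>u. u \<in> S \<Longrightarrow> \<bar>f u\<bar> \<le> C" using assms(4) bdd_borel_bound by blast
  have "f \<in> borel_measurable M"
    using bdd_borel_measurable[OF assms(4)] measurable_cong_sets[OF assms(2) refl] by blast
  then show ?thesis
    using assms(3) C by (intro integrable_const_bound[of _ C]) (auto elim!: eventually_mono)
qed

lemma bdd_functional_integral:
  assumes "finite_measure M" "sets M = sets borel" "AE u in M. u \<in> S"
  shows "bdd_functional S (\<lambda>f. \<integral>u. f u \<partial>M)"
proof -
  interpret finite_measure M by fact
  note int = bdd_borel_integrable[OF assms]
  have meas: "borel_measurable M = borel_measurable borel"
    by (rule measurable_cong_sets[OF assms(2) refl])
  have "(\<lambda>n. \<integral>u. F n u \<partial>M) \<longlonglongrightarrow> (\<integral>u. f u \<partial>M)"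
    if F: "\<forall>n. F n \<in> borel_measurable borel" "f \<in> borel_measurable borel"
      and "\<forall>n. \<forall>u\<in>S. \<bar>F n u\<bar> \<le> C" "\<forall>u\<in>S. (\<lambda>n. F n u) \<longlonglongrightarrow> f u" for F f and C :: real
    using that assms(3)
    by (intro integral_dominated_convergence[where w="\<lambda>_. C"])
       (auto elim!: eventually_mono simp: meas)
  then show ?thesis unfolding bdd_functional_def by (auto simp: int)
qed

text \<open>Monotone class induction on nonnegative functions. The bound on \<open>S\<close> is
  carried as a premise; it descends to summands and to the members of an increasing sequence because
  all of them are nonnegative, and it then dominates the limit.\<close>

lemma bdd_functional_eq_0_indicator:
  assumes \<Lambda>: "bdd_functional S \<Lambda>" and ind: "\<And>B. B \<in> sets borel \<Longrightarrow> \<Lambda> (indicator B) = 0"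
    and f: "f \<in> bdd_borel S"
  shows "\<Lambda> f = 0"
proof -
  have pos: "(\<exists>C. \<forall>u\<in>S. \<bar>g u\<bar> \<le> C) \<longrightarrow> \<Lambda> g = 0"
    if "g \<in> borel_measurable borel" "\<And>u. 0 \<le> g u" for g
    using that
  proof (induction rule: borel_measurable_induct_real)
    case (set A)
    then show ?case using ind by simp
  next
    case (mult u c)
    show ?case
    proof (cases "c = 0")
      case True
      then show ?thesis using bdd_functional_zero[OF \<Lambda>] by simp
    next
      case False
      show ?thesis
      proof
        assume "\<exists>C. \<forall>x\<in>S. \<bar>c * u x\<bar> \<le> C"
        then obtain C where "\<forall>x\<in>S. \<bar>c * u x\<bar> \<le> C" by blast
        then have "\<forall>x\<in>S. \<bar>u x\<bar> \<le> C / c" using False mult.hyps by (simp add: field_simps abs_mult)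
        then show "\<Lambda> (\<lambda>x. c * u x) = 0"
          using mult by (subst bdd_functional_cmult[OF \<Lambda>]) (auto simp: bdd_borel_def)
      qed
    qed
  next
    case (add u v)
    show ?case
    proof
      assume "\<exists>C. \<forall>x\<in>S. \<bar>v x + u x\<bar> \<le> C"
      then obtain C where C: "\<And>x. x \<in> S \<Longrightarrow> \<bar>v x + u x\<bar> \<le> C" by blast
      have "\<forall>x\<in>S. \<bar>v x\<bar> \<le> C" "\<forall>x\<in>S. \<bar>u x\<bar> \<le> C"
        using C add.hyps(2,4) by (auto simp: abs_of_nonneg add_nonneg_nonneg)
          (metis add_increasing add_increasing2 abs_of_nonneg add_nonneg_nonneg order_trans order_refl)+
      then show "\<Lambda> (\<lambda>x. v x + u x) = 0"
        using add by (subst bdd_functional_add[OF \<Lambda>]) (auto simp: bdd_borel_def)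
    qed
  next
    case (seq U)
    show ?case
    proof
      assume "\<exists>C. \<forall>x\<in>S. \<bar>g x\<bar> \<le> C"
      then obtain C where C: "\<And>x. x \<in> S \<Longrightarrow> \<bar>g x\<bar> \<le> C" by blast
      have U: "\<bar>U i x\<bar> \<le> C" if "x \<in> S" for i x
      proof -
        have "U i x \<le> g x"
          using seq.hyps by (intro incseq_le) (auto simp: incseq_def le_fun_def)
        then show ?thesis using C[OF that] seq.hyps(2)[of i x] by linarith
      qed
      have "(\<lambda>n. \<Lambda> (U n)) \<longlonglongrightarrow> \<Lambda> g"
        using seq U \<open>g \<in> borel_measurable borel\<close>
        by (intro bdd_functional_LIMSEQ[OF \<Lambda>, where C=C]) auto
      moreover have "\<Lambda> (U n) = 0" for n using seq U by blast
      ultimately show "\<Lambda> g = 0" by (simp add: LIMSEQ_const_iff)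
    qed
  qed
  note [measurable] = bdd_borel_measurable[OF f]
  obtain C where C: "\<And>u. u \<in> S \<Longrightarrow> \<bar>f u\<bar> \<le> C" using f bdd_borel_bound by blast
  have "\<Lambda> (\<lambda>u. max 0 (f u) + (-1) * max 0 (- f u)) = 0"
  proof -
    have 1: "(\<lambda>u. max 0 (f u)) \<in> bdd_borel S" "(\<lambda>u. max 0 (- f u)) \<in> bdd_borel S"
      by (rule bdd_borelI[of _ _ C]; use C in fastforce)+
    have "\<Lambda> (\<lambda>u. max 0 (f u)) = 0" "\<Lambda> (\<lambda>u. max 0 (- f u)) = 0"
      using pos[of "\<lambda>u. max 0 (f u)"] pos[of "\<lambda>u. max 0 (- f u)"] 1 by (auto simp: bdd_borel_def)
    then show ?thesis
      using 1 by (simp only: bdd_functional_add[OF \<Lambda>] bdd_functional_cmult[OF \<Lambda>] bdd_borel_mult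
          bdd_borel_const)
  qed
  also have "(\<lambda>u. max 0 (f u) + (-1) * max 0 (- f u)) = f" by (auto simp: max_def)
  finally show ?thesis .
qed

text \<open>Moments determine a signed measure on a compact interval: Weierstrass approximation
  passes from powers to continuous functions, piecewise linear cut-offs pass to closed rays, and
  Dynkin's theorem passes to Borel sets.\<close>

lemma bdd_functional_eq_0:
  assumes \<Lambda>: "bdd_functional {a..b} \<Lambda>" and pow: "\<And>n. \<Lambda> (\<lambda>u. u ^ n) = 0" and f: "f \<in> bdd_borel {a..b}"
  shows "\<Lambda> f = 0"
proof -
  let ?S = "{a..b}"
  have cont: "\<Lambda> g = 0" if g: "continuous_on UNIV g" for g
  proof -
    have "\<exists>q. real_polynomial_function q \<and> (\<forall>x\<in>?S. \<bar>g x - q x\<bar> < 1 / Suc n)" for n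
      by (rule Stone_Weierstrass_real_polynomial_function[of ?S g "1 / Suc n"])
         (use g continuous_on_subset in \<open>auto simp del: of_nat_Suc\<close>)
    then obtain q where q: "\<And>n. real_polynomial_function (q n)"
      and gq: "\<And>n x. x \<in> ?S \<Longrightarrow> \<bar>g x - q n x\<bar> < 1 / Suc n" by metis
    have "\<Lambda> (q n) = 0" for n
    proof -
      obtain c m where c: "q n = (\<lambda>x. \<Sum>i\<le>m. c i * x ^ i)"
        using q[of n] real_polynomial_function_iff_sum by blast
      show ?thesis
        unfolding c
        by (subst bdd_functional_sum[OF \<Lambda>])
          (auto simp: bdd_functional_cmult[OF \<Lambda>] bdd_borel_power pow
             intro: bdd_borel_mult bdd_borel_const)
    qed
    moreover have "(\<lambda>n. \<Lambda> (q n)) \<longlonglongrightarrow> \<Lambda> g"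
    proof -
      have "continuous_on UNIV (q n)" for n
        using q continuous_real_polymonial_function continuous_at_imp_continuous_on by blast
      moreover have "\<exists>C. \<forall>u\<in>?S. \<bar>g u\<bar> \<le> C"
        using bdd_borel_continuous[OF g] by (simp add: bdd_borel_def)
      then obtain C where C: "\<And>u. u \<in> ?S \<Longrightarrow> \<bar>g u\<bar> \<le> C" by blast
      moreover have "\<bar>q n u\<bar> \<le> C + 1" if "u \<in> ?S" for n u
      proof -
        have "1 / real (Suc n) \<le> 1" by simp
        then show ?thesis using C[OF that] gq[OF that, of n] by linarith
      qed
      moreover have "(\<lambda>n. q n u) \<longlonglongrightarrow> g u" if "u \<in> ?S" for u
      proof (rule Lim_transform)
        show "(\<lambda>n. g u) \<longlonglongrightarrow> g u" by simp
        show "(\<lambda>n. q n u - g u) \<longlonglongrightarrow> 0"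
          by (rule Lim_null_comparison[of _ "\<lambda>n. 1 / Suc n"])
            (use gq[OF that] LIMSEQ_Suc[OF lim_1_over_n] in
              \<open>auto simp: abs_minus_commute intro!: always_eventually less_imp_le\<close>)
      qed
      ultimately show ?thesis
        by (intro bdd_functional_LIMSEQ[OF \<Lambda>, where C="C + 1"])
           (auto intro: borel_measurable_continuous_onI g)
    qed
    ultimately show ?thesis by (simp add: LIMSEQ_const_iff)
  qed
  have ray: "\<Lambda> (indicator {..c}) = 0" for c
  proof -
    \<comment> \<open>For n > 0 this is 1 up to \<open>c\<close> and falls linearly to 0 over a
      distance 1/n, so it decreases to the indicator of the closed ray.\<close>
    define F where "F n u = max 0 (min 1 (1 - real n * (u - c)))" for n u
    have "(\<lambda>n. F n u) \<longlonglongrightarrow> indicator {..c} u" for u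
    proof (cases "u \<le> c")
      case True
      then have "F n u = 1" for n
        by (auto simp: F_def min_def max_def mult_nonneg_nonpos)
      then show ?thesis using True by simp
    next
      case False
      have "\<forall>\<^sub>F n in sequentially. F n u = 0"
      proof (rule eventually_sequentiallyI)
        fix n assume n: "nat \<lceil>1 / (u - c)\<rceil> \<le> n"
        then have "1 / (u - c) \<le> n" by linarith
        then show "F n u = 0" using False by (auto simp: F_def field_simps)
      qed
      then show ?thesis using False by (simp add: tendsto_eventually)
    qed
    then have "(\<lambda>n. \<Lambda> (F n)) \<longlonglongrightarrow> \<Lambda> (indicator {..c})"
      by (intro bdd_functional_LIMSEQ[OF \<Lambda>, of _ _ 1])
         (auto simp: F_def[abs_def] abs_le_iff)
    moreover have "\<Lambda> (F n) = 0" for n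
      unfolding F_def[abs_def] by (intro cont continuous_intros)
    ultimately show ?thesis by (simp add: LIMSEQ_const_iff)
  qed
  have ind: "\<Lambda> (indicator B) = 0" if "B \<in> sets borel" for B
  proof -
    have "Int_stable (range (\<lambda>a. {..a::real}))" by (auto simp: Int_stable_def)
    moreover have "range (\<lambda>a. {..a::real}) \<subseteq> Pow UNIV" by simp
    moreover have "B \<in> sigma_sets UNIV (range (\<lambda>a. {..a}))"
      using that by (simp add: borel_eq_atMost)
    ultimately show ?thesis
    proof (induction rule: sigma_sets_induct_disjoint)
      case (basic A) then show ?case using ray by auto
    next
      case empty then show ?case using bdd_functional_zero[OF \<Lambda>] by simp
    next
      case (compl A)
      have A: "A \<in> sets borel" using compl by (simp add: borel_eq_atMost)
      \<comment> \<open>The zeroth moment is the total mass; its vanishing handles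
        complements.\<close>
      have "indicator (UNIV - A) = (\<lambda>u. 1 + (-1) * indicator A u :: real)"
        by (auto simp: indicator_def)
      then show ?case
        using pow[of 0] compl A
        by (simp only: bdd_functional_add[OF \<Lambda>] bdd_functional_cmult[OF \<Lambda>] bdd_borel_const
            bdd_borel_mult bdd_borel_indicator) simp
    next
      case (union A)
      have A: "A i \<in> sets borel" for i using union by (auto simp: borel_eq_atMost)
      have "(\<lambda>n. \<Lambda> (\<lambda>u. \<Sum>i<n. indicator (A i) u)) \<longlonglongrightarrow> \<Lambda> (indicator (\<Union>i. A i))"
      proof (rule bdd_functional_LIMSEQ[OF \<Lambda>, where C=1])
        have *: "(\<Sum>i<n. indicator (A i) u) = (indicator (\<Union>i<n. A i) u :: real)" for n u
          using union(1) by (intro indicator_UN_disjoint[symmetric])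
            (auto simp: disjoint_family_on_def)
        show "\<bar>\<Sum>i<n. indicator (A i) u\<bar> \<le> (1::real)" for n u
          unfolding * by (simp add: indicator_def)
        show "(\<lambda>n. \<Sum>i<n. indicator (A i) u) \<longlonglongrightarrow> (indicator (\<Union>i. A i) u :: real)" for u
          unfolding * by (rule LIMSEQ_indicator_UN)
        show "(\<lambda>u. \<Sum>i<n. indicator (A i) u :: real) \<in> borel_measurable borel" for n
          using A by measurable
        show "(indicator (\<Union>i. A i) :: real \<Rightarrow> real) \<in> borel_measurable borel"
          using A by measurable
      qed
      moreover have "\<Lambda> (\<lambda>u. \<Sum>i<n. indicator (A i) u) = 0" for n
        by (subst bdd_functional_sum[OF \<Lambda>]) (auto intro: bdd_borel_indicator A simp: union)
      ultimately show ?case by (simp add: LIMSEQ_const_iff)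
    qed
  qed
  show ?thesis by (rule bdd_functional_eq_0_indicator[OF \<Lambda> ind f])
qed

lemma bdd_functional_eqI_indicator:
  assumes "bdd_functional S \<Lambda>" "bdd_functional S \<Lambda>'"
    "\<And>B. B \<in> sets borel \<Longrightarrow> \<Lambda> (indicator B) = \<Lambda>' (indicator B)" "f \<in> bdd_borel S"
  shows "\<Lambda> f = \<Lambda>' f"
  using bdd_functional_eq_0_indicator[OF bdd_functional_minus[OF assms(1,2)] _ assms(4)] assms(3) by simp

lemma bdd_functional_eqI:
  assumes "bdd_functional {a..b} \<Lambda>" "bdd_functional {a..b} \<Lambda>'"
    "\<And>n. \<Lambda> (\<lambda>u. u ^ n) = \<Lambda>' (\<lambda>u. u ^ n)" "f \<in> bdd_borel {a..b}"
  shows "\<Lambda> f = \<Lambda>' f"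
  using bdd_functional_eq_0[OF bdd_functional_minus[OF assms(1,2)] _ assms(4)] assms(3) by simp


section \<open>The Hausdorff moment problem\<close>

text \<open>Pascal's rule in summed form. It is the induction step for iterating the recursion of a
  Hausdorff array.\<close>

lemma sum_choose_Suc:
  fixes f :: "nat \<Rightarrow> real"
  shows "(\<Sum>i\<le>Suc N. real (Suc N choose i) * f i)
    = (\<Sum>i\<le>N. real (N choose i) * f i) + (\<Sum>i\<le>N. real (N choose i) * f (Suc i))"
proof -
  have "(\<Sum>i\<le>Suc N. real (Suc N choose i) * f i)
      = f 0 + (\<Sum>i\<le>N. real (N choose Suc i) * f (Suc i)) + (\<Sum>i\<le>N. real (N choose i) * f (Suc i))"
    by (subst sum.atMost_Suc_shift) (simp add: distrib_right sum.distrib)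
  also have "f 0 + (\<Sum>i\<le>N. real (N choose Suc i) * f (Suc i)) = (\<Sum>i\<le>Suc N. real (N choose i) * f i)"
    by (subst sum.atMost_Suc_shift) simp
  finally show ?thesis by simp
qed

lemma choose_ratio_eq_prod:
  assumes "j \<le> n"
  shows "real (k choose j) / real (n choose j) = (\<Prod>i<j. real (k - i) / real (n - i))"
proof (cases "j \<le> k")
  case True
  show ?thesis
    using assms True
    by (simp add: binomial_altdef_of_nat atLeast0LessThan flip: prod_dividef)
next
  case False
  \<comment> \<open>Since k < j, the factor with i = k is zero, matching the vanishing binomial
    coefficient.\<close>
  then have "(\<Prod>i<j. real (k - i) / real (n - i)) = 0"
    by (intro prod_zero) (auto intro!: bexI[of _ k])
  moreover have "k choose j = 0" using False by (simp add: binomial_eq_0)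
  ultimately show ?thesis by (simp only: of_nat_0 div_0)
qed

text \<open>A product of \<open>j\<close> factors of modulus at most 1 is compared with a j-th power
  factor by factor. Each factor is off by at most 2j/n, because the assumption 2j <= n keeps the
  denominators n - i above n/2.\<close>

lemma choose_ratio_approx:
  assumes "k \<le> n" "2 * j \<le> n" "0 < n"
  shows "\<bar>real (k choose j) / real (n choose j) - (real k / real n) ^ j\<bar> \<le> 2 * (real j)\<^sup>2 / real n"
proof -
  have b: "norm (real (k - i) / real (n - i)) \<le> 1" "norm (real k / real n) \<le> 1"
    "norm (real (k - i) / real (n - i) - real k / real n) \<le> 2 * real j / real n" if i: "i < j" for i
  proof -
    show "norm (real (k - i) / real (n - i)) \<le> 1" "norm (real k / real n) \<le> 1"
      using i assms by (auto simp: field_simps)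
    show "norm (real (k - i) / real (n - i) - real k / real n) \<le> 2 * real j / real n"
    proof (cases "i \<le> k")
      case True
      have "2 * i \<le> n" "i < n" using i assms by linarith+
      then have pos: "0 < real n - real i" "real n \<le> 2 * (real n - real i)"
        by (simp_all add: algebra_simps flip: of_nat_mult)
      have "real (k - i) / real (n - i) - real k / real n
          = - (real i * (real n - real k)) / (real n * (real n - real i))"
        using True i assms pos by (simp add: field_simps)
      then have "norm (real (k - i) / real (n - i) - real k / real n)
          = real i / (real n - real i) * ((real n - real k) / real n)"
        using pos assms by (simp add: abs_mult abs_of_nonneg del: of_nat_diff)
      also have "\<dots> \<le> (2 * real j / real n) * 1"
      proof (intro mult_mono)
        have "real i * real n \<le> real j * (2 * (real n - real i))"
          using pos i by (intro mult_mono) auto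
        then show "real i / (real n - real i) \<le> 2 * real j / real n"
          using pos assms by (simp add: field_simps)
      qed (use assms in \<open>auto simp: field_simps\<close>)
      finally show ?thesis by simp
    next
      case False
      then show ?thesis using i assms by (simp add: field_simps)
    qed
  qed
  have "\<bar>(\<Prod>i<j. real (k - i) / real (n - i)) - (\<Prod>i<j. real k / real n)\<bar>
      \<le> (\<Sum>i<j. norm (real (k - i) / real (n - i) - real k / real n))"
    using norm_prod_diff[of "{..<j}" "\<lambda>i. real (k - i) / real (n - i)" "\<lambda>i. real k / real n"] b
    by simp
  also have "\<dots> \<le> (\<Sum>i<j. 2 * real j / real n)"
    by (rule sum_mono) (use b in auto)
  finally show ?thesis
    using assms by (simp add: choose_ratio_eq_prod power2_eq_square mult.left_commute)
qed

text \<open>The approximating measures put mass \<open>(n choose k) a k (n - k)\<close> at \<open>k / n\<close>; their factorial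
  moments agree with those of the limit exactly.\<close>

theorem Hausdorff_moment_problem_prob:
  fixes a :: "nat \<Rightarrow> nat \<Rightarrow> real"
  assumes nonneg: "\<And>k j. 0 \<le> a k j" and rec: "\<And>k j. a k j = a (Suc k) j + a k (Suc j)"
    and one: "a 0 0 = 1"
  obtains M where "real_distribution M" "AE u in M. u \<in> {0..1}" "\<And>n. (\<integral>u. u ^ n \<partial>M) = a n 0"
proof -
  \<comment> \<open>The recursion applied \<open>N\<close> times: each step raises one of the two
    indices, and the binomial coefficient counts the paths.\<close>
  have binom: "(\<Sum>i\<le>N. real (N choose i) * a (j + i) (l + (N - i))) = a j l" for N j l
  proof (induction N arbitrary: j l)
    case (Suc N)
    have "(\<Sum>i\<le>N. real (N choose i) * a (j + i) (l + (Suc N - i)))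
        = (\<Sum>i\<le>N. real (N choose i) * a (j + i) (Suc l + (N - i)))"
      by (intro sum.cong) (auto simp: Suc_diff_le)
    moreover have "(\<Sum>i\<le>N. real (N choose i) * a (j + Suc i) (l + (Suc N - Suc i)))
        = (\<Sum>i\<le>N. real (N choose i) * a (Suc j + i) (l + (N - i)))"
      by simp
    ultimately show ?case
      using Suc.IH[of j "Suc l"] Suc.IH[of "Suc j" l] rec[of j l] by (simp only: sum_choose_Suc)
  qed simp
  define w where "w n k = real (n choose k) * a k (n - k)" for n k
  have w0: "0 \<le> w n k" for n k by (simp add: w_def nonneg)
  have w1: "(\<Sum>k\<le>n. w n k) = 1" for n
    using binom[of n 0 0] one by (simp add: w_def)
  have fact_moment: "(\<Sum>k\<le>n. w n k * (real (k choose j) / real (n choose j))) = a j 0"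
    if "j \<le> n" for n j
  proof -
    have "(\<Sum>k\<le>n. w n k * (real (k choose j) / real (n choose j)))
        = (\<Sum>k=j..n. w n k * (real (k choose j) / real (n choose j)))"
      by (rule sum.mono_neutral_right) auto
    also have "\<dots> = (\<Sum>i\<le>n - j. w n (j + i) * (real ((j + i) choose j) / real (n choose j)))"
      by (rule sum.reindex_bij_witness[of _ "\<lambda>i. j + i" "\<lambda>k. k - j"]) (use that in auto)
    also have "\<dots> = (\<Sum>i\<le>n - j. real ((n - j) choose i) * a (j + i) (0 + (n - j - i)))"
    proof (rule sum.cong[OF refl])
      fix i assume i: "i \<in> {..n - j}"
      \<comment> \<open>Trinomial revision reduces the factorial moment to the iterated recursion
        with N = n - j, started at (j, 0).\<close>
      have "(n choose (j + i)) * ((j + i) choose j) = (n choose j) * ((n - j) choose i)"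
        using choose_mult[of j "j + i" n] i that by simp
      then have "real (n choose (j + i)) * real ((j + i) choose j) = real (n choose j) * real ((n - j) choose i)"
        by (metis of_nat_mult)
      then show "w n (j + i) * (real ((j + i) choose j) / real (n choose j))
          = real ((n - j) choose i) * a (j + i) (0 + (n - j - i))"
        using that by (simp add: w_def field_simps)
    qed
    finally show ?thesis by (simp only: binom)
  qed
  define \<mu> where "\<mu> n = distr (point_measure {..n} (\<lambda>k. ennreal (w n k))) borel (\<lambda>k. real k / real n)" for n
  have int_\<mu>: "(\<integral>u. f u \<partial>\<mu> n) = (\<Sum>k\<le>n. w n k * f (real k / real n))"
    if "f \<in> borel_measurable borel" for f :: "real \<Rightarrow> real" and n
    unfolding \<mu>_def using that w0
    by (subst integral_distr) (auto simp: lebesgue_integral_point_measure_finite)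
  have rd: "real_distribution (\<mu> n)" for n
  proof -
    interpret prob_space "point_measure {..n} (\<lambda>k. ennreal (w n k))"
      by (rule prob_spaceI)
        (simp add: space_point_measure emeasure_point_measure_finite w0 w1)
    show ?thesis
      unfolding \<mu>_def by (rule real_distribution_distr) simp
  qed
  have frac: "real k / real n \<in> {0..1}" if "k \<le> n" for k n
    using that by (cases "n = 0") auto
  \<comment> \<open>Tightness is phrased with intervals open on the left, so the left end has to lie
    below the possible atom 0.\<close>
  have mass: "1 - e < measure (\<mu> n) {-1<..1}" if e: "0 < e" for e n
  proof -
    interpret real_distribution "\<mu> n" by (rule rd)
    have "measure (\<mu> n) {-1<..1} = (\<integral>u. indicator {-1<..1} u \<partial>\<mu> n)" by simp
    also have "\<dots> = (\<Sum>k\<le>n. w n k * indicator {-1<..1} (real k / real n))"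
      by (rule int_\<mu>) simp
    also have "\<dots> = (\<Sum>k\<le>n. w n k)"
    proof (intro sum.cong refl)
      fix k assume "k \<in> {..n}"
      then have "0 \<le> real k / real n" "real k / real n \<le> 1" using frac[of k n] by auto
      then have "- 1 < real k / real n" by linarith
      with \<open>real k / real n \<le> 1\<close> show "w n k * indicator {-1<..1} (real k / real n) = w n k"
        by simp
    qed
    finally show ?thesis using e w1 by simp
  qed
  have "tight \<mu>"
    unfolding tight_def
    by (intro conjI allI impI rd, rule exI[of _ "-1"], rule exI[of _ 1]) (simp add: mass)
  then obtain r M where r: "strict_mono r" and M: "real_distribution M"
    and conv: "weak_conv_m (\<mu> \<circ> id \<circ> r) M"
    using tight_imp_convergent_subsubsequence[of \<mu> id] by (auto simp: strict_mono_def)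
  interpret M: real_distribution M by fact
  have lim: "(\<lambda>n. \<integral>u. f u \<partial>\<mu> (r n)) \<longlonglongrightarrow> (\<integral>u. f u \<partial>M)"
    if "continuous_on UNIV f" "\<And>x. norm (f x) \<le> B" for f :: "real \<Rightarrow> real" and B
    using weak_conv_imp_integral_bdd_continuous_conv[of "\<mu> \<circ> id \<circ> r" M f B] rd M conv that
    by (auto simp: continuous_on_eq_continuous_at)
  \<comment> \<open>Clamping to the unit interval makes powers bounded and continuous on the whole
    line, as weak convergence demands, and changes nothing at the atoms.\<close>
  define c :: "real \<Rightarrow> real" where "c u = max 0 (min 1 u)" for u
  have c01: "0 \<le> c u" "c u \<le> 1" "u \<in> {0..1} \<Longrightarrow> c u = u" for u by (auto simp: c_def)
  have cont_c: "continuous_on UNIV c" unfolding c_def by (intro continuous_intros)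
  have AE: "AE u in M. u \<in> {0..1}"
  proof -
    \<comment> \<open>A bounded continuous function vanishing exactly on the unit interval: its
      integrals are 0 along the sequence, hence also for the weak limit.\<close>
    define g where "g u = min 1 \<bar>u - c u\<bar>" for u
    have g: "continuous_on UNIV g" "\<And>u. norm (g u) \<le> 1"
      unfolding g_def by (intro continuous_intros cont_c) auto
    have [measurable]: "g \<in> borel_measurable borel"
      by (rule borel_measurable_continuous_onI) fact
    have "(\<integral>u. g u \<partial>\<mu> n) = 0" for n
      by (subst int_\<mu>) (auto simp: g_def c01(3)[OF frac])
    then have "(\<integral>u. g u \<partial>M) = 0"
      using lim[OF g] by (simp add: LIMSEQ_const_iff)
    moreover have "integrable M g"
      by (rule M.integrable_const_bound[of _ 1]) (use g in auto)
    ultimately have "AE u in M. g u = 0"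
      by (subst (asm) integral_nonneg_eq_0_iff_AE) (auto simp: g_def)
    then show ?thesis
      by (rule eventually_mono) (auto simp: g_def c_def min_def max_def split: if_splits)
  qed
  have "(\<integral>u. u ^ j \<partial>M) = a j 0" for j
  proof -
    have cj: "continuous_on UNIV (\<lambda>u. c u ^ j)" "\<And>u. norm (c u ^ j) \<le> 1"
      using c01 by (auto intro!: continuous_intros cont_c power_le_one)
    have "(\<lambda>n. (\<integral>u. c u ^ j \<partial>\<mu> n) - a j 0) \<longlonglongrightarrow> 0"
    proof (rule Lim_null_comparison)
      show "(\<lambda>n. 2 * (real j)\<^sup>2 / real n) \<longlonglongrightarrow> 0"
        by (rule lim_const_over_n)
      show "\<forall>\<^sub>F n in sequentially. norm ((\<integral>u. c u ^ j \<partial>\<mu> n) - a j 0) \<le> 2 * (real j)\<^sup>2 / real n"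
      proof (rule eventually_sequentiallyI[of "2 * j + 1"])
        fix n assume n: "2 * j + 1 \<le> n"
        have "(\<integral>u. c u ^ j \<partial>\<mu> n) = (\<Sum>k\<le>n. w n k * (real k / real n) ^ j)"
          by (subst int_\<mu>) (auto intro!: borel_measurable_continuous_onI cj simp: c01(3)[OF frac])
        moreover have "a j 0 = (\<Sum>k\<le>n. w n k * (real (k choose j) / real (n choose j)))"
          using fact_moment[of j n] n by simp
        ultimately have "(\<integral>u. c u ^ j \<partial>\<mu> n) - a j 0
            = (\<Sum>k\<le>n. w n k * ((real k / real n) ^ j - real (k choose j) / real (n choose j)))"
          by (simp add: sum_subtractf right_diff_distrib)
        also have "norm \<dots> \<le> (\<Sum>k\<le>n. w n k * (2 * (real j)\<^sup>2 / real n))"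
        proof (intro sum_norm_le)
          fix k assume "k \<in> {..n}"
          then have "\<bar>(real k / real n) ^ j - real (k choose j) / real (n choose j)\<bar> \<le> 2 * (real j)\<^sup>2 / real n"
            using choose_ratio_approx[of k n j] n by (simp add: abs_minus_commute)
          then show "norm (w n k * ((real k / real n) ^ j - real (k choose j) / real (n choose j)))
              \<le> w n k * (2 * (real j)\<^sup>2 / real n)"
            unfolding real_norm_def abs_mult using w0[of n k] by (simp only: abs_of_nonneg mult_left_mono)
        qed
        also have "\<dots> = 2 * (real j)\<^sup>2 / real n" by (simp only: sum_distrib_right[symmetric] w1)
        finally show "norm ((\<integral>u. c u ^ j \<partial>\<mu> n) - a j 0) \<le> 2 * (real j)\<^sup>2 / real n" .
      qed
    qed
    then have "(\<lambda>n. \<integral>u. c u ^ j \<partial>\<mu> n) \<longlonglongrightarrow> a j 0" by (simp add: LIM_zero_iff)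
    then have "(\<lambda>n. \<integral>u. c u ^ j \<partial>\<mu> (r n)) \<longlonglongrightarrow> a j 0"
      using LIMSEQ_subseq_LIMSEQ[OF _ r] by (auto simp: comp_def)
    then have "a j 0 = (\<integral>u. c u ^ j \<partial>M)"
      using lim[OF cj] LIMSEQ_unique by blast
    also have "\<dots> = (\<integral>u. u ^ j \<partial>M)"
    proof (rule integral_cong_AE)
      show "AE u in M. c u ^ j = u ^ j" using AE by (rule eventually_mono) (simp add: c01(3))
      show "(\<lambda>u. c u ^ j) \<in> borel_measurable M"
        using borel_measurable_continuous_onI[OF cj(1)] by simp
    qed simp
    finally show ?thesis by simp
  qed
  with M AE show ?thesis by (rule that)
qed

text \<open>Normalisation by a 0 0. If that number is 0, nonnegativity and the recursion annihilate
  all a n 0, and the null measure serves.\<close>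

corollary Hausdorff_moment_problem:
  fixes a :: "nat \<Rightarrow> nat \<Rightarrow> real"
  assumes nonneg: "\<And>k j. 0 \<le> a k j" and rec: "\<And>k j. a k j = a (Suc k) j + a k (Suc j)"
  obtains M where "finite_measure M" "sets M = sets borel" "AE u in M. u \<in> {0..1}"
    "\<And>n. (\<integral>u. u ^ n \<partial>M) = a n 0"
proof (cases "a 0 0 = 0")
  case True
  have "a n 0 = 0" for n
  proof (induction n)
    case (Suc n)
    then show ?case using rec[of n 0] nonneg[of "Suc n" 0] nonneg[of n 1] by simp
  qed (rule True)
  then show ?thesis
    by (intro that[of "null_measure borel"]) (auto intro!: finite_measureI AE_I'[of UNIV] null_setsI)
next
  case False
  define c where "c = a 0 0"
  have c: "0 < c" using False nonneg[of 0 0] by (simp add: c_def less_le)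
  obtain M where M: "real_distribution M" "AE u in M. u \<in> {0..1}" "\<And>n. (\<integral>u. u ^ n \<partial>M) = a n 0 / c"
  proof (rule Hausdorff_moment_problem_prob[of "\<lambda>k j. a k j / c"])
    show "0 \<le> a k j / c" for k j using nonneg c by simp
    show "a k j / c = a (Suc k) j / c + a k (Suc j) / c" for k j
      unfolding rec[of k j] by (rule add_divide_distrib)
    show "a 0 0 / c = 1" using c by (simp add: c_def)
  qed blast
  interpret M: real_distribution M by fact
  show ?thesis
  proof (rule that[of "density M (\<lambda>_. ennreal c)"])
    show "finite_measure (density M (\<lambda>_. ennreal c))"
      by (rule finite_measureI) (simp add: emeasure_density_const ennreal_mult_eq_top_iff)
    show "AE u in density M (\<lambda>_. ennreal c). u \<in> {0..1}"
      by (subst AE_density) (use M in auto)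
    show "(\<integral>u. u ^ n \<partial>density M (\<lambda>_. ennreal c)) = a n 0" for n
      by (subst integral_density) (use c M in auto)
  qed simp
qed

section \<open>Moment measures of a positive operator\<close>

lemma funpow_commute_point:
  assumes "\<And>v. f (g v) = g (f v)" shows "(f ^^ n) (g v) = g ((f ^^ n) v)"
  by (induction n) (auto simp: assms)

text \<open>With D = 1 - A, the numbers <A^k D^j x, x> form a Hausdorff array, the recursion being A
  + D = 1. By symmetry a square of A or D can be absorbed into the vector, so nonnegativity has to
  be checked for k, j <= 1 only.\<close>

lemma moment_measure_contraction:
  fixes A :: "'h::complex_hilbert_space \<Rightarrow>\<^sub>L 'h"
  assumes sym: "\<And>x y. rinner (blinfun_apply A x) y = rinner x (blinfun_apply A y)"
    and pos: "\<And>x. 0 \<le> rinner (blinfun_apply A x) x"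
    and le: "\<And>x. rinner (blinfun_apply A x) x \<le> (norm x)\<^sup>2"
  obtains M where "finite_measure M" "sets M = sets borel" "AE u in M. u \<in> {0..1}"
    "\<And>n. (\<integral>u. u ^ n \<partial>M) = rinner ((blinfun_apply A ^^ n) x) x"
proof -
  define D where "D v = v - blinfun_apply A v" for v
  have DA: "D (blinfun_apply A v) = blinfun_apply A (D v)" for v by (simp add: D_def blinfun.diff_right)
  have symD: "rinner (D v) y = rinner v (D y)" for v y
    by (simp add: D_def rinner.diff_left rinner.diff_right sym)
  have posD: "0 \<le> rinner (D v) v" for v
    using le[of v] by (simp add: D_def rinner.diff_left rinner_self)
  define a where "a k j x = rinner ((blinfun_apply A ^^ k) ((D ^^ j) x)) x" for k j x
  have shiftA: "a (Suc (Suc k)) j x = a k j (blinfun_apply A x)" for k j x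
    unfolding a_def
    by (simp add: sym funpow_commute_point[of D "blinfun_apply A", OF DA]
        funpow_commute_point[of "blinfun_apply A" "blinfun_apply A"])
  have AnD: "(blinfun_apply A ^^ n) (D v) = D ((blinfun_apply A ^^ n) v)" for n v
    by (rule funpow_commute_point) (simp add: DA)
  have shiftD: "a k (Suc (Suc j)) x = a k j (D x)" for k j x
    unfolding a_def by (simp add: symD AnD funpow_commute_point[of D D])
  have a_nonneg: "0 \<le> a k j x" for k j x
  proof (induction "k + j" arbitrary: k j x rule: less_induct)
    case less
    consider k' where "k = Suc (Suc k')" | j' where "j = Suc (Suc j')" | "k \<le> 1" "j \<le> 1"
      by (metis One_nat_def Suc_le_mono le_zero_eq not0_implies_Suc not_less_eq_eq zero_le)
    then show ?case
    proof cases
      case 1 then show ?thesis using less[of k' j] by (simp add: shiftA)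
    next
      case 2 then show ?thesis using less[of k j'] by (simp add: shiftD)
    next
      case 3
      \<comment> \<open>The mixed case rests on A D = D A D + A D A, obtained by inserting 1 = D +
        A; both terms are positive by the positivity of A and of D.\<close>
      have "a 1 1 x = rinner (blinfun_apply A (D x)) (D x + blinfun_apply A x)"
        by (simp add: a_def D_def)
      also have "\<dots> = rinner (blinfun_apply A (D x)) (D x) + rinner (D (blinfun_apply A x)) (blinfun_apply A x)"
        by (simp add: rinner.add_right DA)
      finally have "0 \<le> a 1 1 x" using pos posD by simp
      moreover have "0 \<le> a 0 0 x" "0 \<le> a 1 0 x" "0 \<le> a 0 1 x"
        using pos posD by (simp_all add: a_def rinner_self)
      moreover have "k = 0 \<or> k = 1" "j = 0 \<or> j = 1" using 3 by auto
      ultimately show ?thesis by auto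
    qed
  qed
  have "a k j x = a (Suc k) j x + a k (Suc j) x" for k j
  proof -
    have "a k (Suc j) x = rinner (D ((blinfun_apply A ^^ k) ((D ^^ j) x))) x"
      by (simp add: a_def AnD)
    then show ?thesis by (simp add: a_def D_def rinner.diff_left)
  qed
  then obtain M where "finite_measure M" "sets M = sets borel" "AE u in M. u \<in> {0..1}"
    "\<And>n. (\<integral>u. u ^ n \<partial>M) = a n 0 x"
    using Hausdorff_moment_problem[of "\<lambda>k j. a k j x"] a_nonneg by blast
  then show ?thesis using that by (simp add: a_def)
qed

text \<open>The measures \<open>m x\<close> will turn out to be the scalar spectral measures of
  \<open>T\<close>. Their moments are what is known of them, which suffices because identities
  between signed measures on {0..K} can be tested on powers.\<close>

locale moment_family =
  fixes T :: "'h::complex_hilbert_space \<Rightarrow>\<^sub>L 'h" and K :: real and m :: "'h \<Rightarrow> real measure"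
  assumes T: "positive_op T" and K: "0 \<le> K"
    and finite_m: "finite_measure (m x)" and sets_m: "sets (m x) = sets borel"
    and AE_m: "AE u in m x. u \<in> {0..K}"
    and moment_m: "(\<integral>u. u ^ n \<partial>m x) = rinner ((blinfun_apply T ^^ n) x) x"

theorem moment_family_exists:
  assumes T: "positive_op T"
  obtains K m where "moment_family T K m"
proof -
  \<comment> \<open>Dividing by \<open>K\<close> gives a contraction, and the measures are scaled
    back by u -> K u. The summand 1 keeps \<open>K\<close> positive when T = 0.\<close>
  define K where "K = norm T + 1"
  have K: "0 < K" by (simp add: K_def add_nonneg_pos)
  define A where "A = (1 / K) *\<^sub>R T"
  have A: "blinfun_apply A x = (1 / K) *\<^sub>R blinfun_apply T x" for x
    by (simp add: A_def blinfun.scaleR_left)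
  have Tn: "(blinfun_apply T ^^ n) x = K ^ n *\<^sub>R (blinfun_apply A ^^ n) x" for n x
    using K by (induction n) (simp_all add: A blinfun.scaleR_right)
  have "\<exists>M. finite_measure M \<and> sets M = sets borel \<and> (AE u in M. u \<in> {0..1}) \<and>
    (\<forall>n. (\<integral>u. u ^ n \<partial>M) = rinner ((blinfun_apply A ^^ n) x) x)" for x
  proof (rule moment_measure_contraction[of A x])
    show "rinner (blinfun_apply A x) y = rinner x (blinfun_apply A y)" for x y
      by (simp add: A rinner.scaleR_left rinner.scaleR_right positive_op_symmetric[OF T])
    show "0 \<le> rinner (blinfun_apply A x) x" for x
      using K positive_op_nonneg[OF T] by (simp add: A rinner.scaleR_left)
    show "rinner (blinfun_apply A x) x \<le> (norm x)\<^sup>2" for x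
    proof -
      have "rinner (blinfun_apply T x) x \<le> norm (blinfun_apply T x) * norm x" by (rule rinner_le)
      also have "\<dots> \<le> (norm T * norm x) * norm x" by (intro mult_right_mono norm_blinfun) simp
      also have "\<dots> \<le> K * (norm x)\<^sup>2" by (simp add: K_def power2_eq_square algebra_simps)
      finally show ?thesis using K by (simp add: A rinner.scaleR_left field_simps)
    qed
  qed blast
  then obtain M where M: "\<And>x. finite_measure (M x)" "\<And>x. sets (M x) = sets borel"
    "\<And>x. AE u in M x. u \<in> {0..1}"
    "\<And>x n. (\<integral>u. u ^ n \<partial>M x) = rinner ((blinfun_apply A ^^ n) x) x" by metis
  have [measurable]: "(\<lambda>u. K * u) \<in> borel_measurable (M x)" for x
    by (subst measurable_cong_sets[OF M(2) refl]) simp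
  show ?thesis
  proof (rule that[of K "\<lambda>x. distr (M x) borel (\<lambda>u. K * u)"], rule moment_family.intro)
    fix x :: 'a and n
    show "AE u in distr (M x) borel (\<lambda>u. K * u). u \<in> {0..K}"
      using M(3)[of x] K by (subst AE_distr_iff) (auto elim!: eventually_mono simp: mult_le_cancel_left)
    show "(\<integral>u. u ^ n \<partial>distr (M x) borel (\<lambda>u. K * u)) = rinner ((blinfun_apply T ^^ n) x) x"
    proof -
      have "(\<integral>u. u ^ n \<partial>distr (M x) borel (\<lambda>u. K * u)) = (\<integral>u. (K * u) ^ n \<partial>M x)"
        by (rule integral_distr) simp_all
      also have "\<dots> = K ^ n * rinner ((blinfun_apply A ^^ n) x) x"
        unfolding power_mult_distrib by (simp add: M(4))
      also have "\<dots> = rinner ((blinfun_apply T ^^ n) x) x"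
        unfolding Tn rinner.scaleR_left by simp
      finally show ?thesis .
    qed
    show "finite_measure (distr (M x) borel (\<lambda>u. K * u))"
      by (rule finite_measure.finite_measure_distr[OF M(1)]) measurable
  qed (use K T in simp_all)
qed


section \<open>Borel functional calculus of a positive operator\<close>

lemma funpow_blinfun_add:
  fixes A :: "'a::real_normed_vector \<Rightarrow>\<^sub>L 'a"
  shows "(blinfun_apply A ^^ n) (x + y) = (blinfun_apply A ^^ n) x + (blinfun_apply A ^^ n) y"
  by (induction n) (simp_all add: blinfun.add_right)

lemma funpow_blinfun_diff:
  fixes A :: "'a::real_normed_vector \<Rightarrow>\<^sub>L 'a"
  shows "(blinfun_apply A ^^ n) (x - y) = (blinfun_apply A ^^ n) x - (blinfun_apply A ^^ n) y"
  by (induction n) (simp_all add: blinfun.diff_right)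

lemma funpow_blinfun_scaleR:
  fixes A :: "'a::real_normed_vector \<Rightarrow>\<^sub>L 'a"
  shows "(blinfun_apply A ^^ n) (r *\<^sub>R x) = r *\<^sub>R (blinfun_apply A ^^ n) x"
  by (induction n) (simp_all add: blinfun.scaleR_right)

lemma funpow_symmetric:
  assumes "\<And>x y. rinner (f x) y = rinner x (f y)"
  shows "rinner ((f ^^ n) x) y = rinner x ((f ^^ n) y)"
  by (induction n arbitrary: x y) (auto simp: assms funpow_swap1)

context moment_family
begin

lemma power_T_symmetric: "rinner ((blinfun_apply T ^^ n) x) y = rinner x ((blinfun_apply T ^^ n) y)"
  by (rule funpow_symmetric) (rule positive_op_symmetric[OF T])

lemma integral_functional: "bdd_functional {0..K} (\<lambda>f. \<integral>u. f u \<partial>m x)"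
  by (intro bdd_functional_integral finite_m sets_m AE_m)

lemma measure_m_total: "measure (m x) (space (m x)) = (norm x)\<^sup>2"
  using moment_m[of x 0] by (simp add: rinner_self)

text \<open>Polarisation of the diagonal integrals. Bilinearity in the vectors is not visible here;
  it follows by comparing moments.\<close>

definition form :: "(real \<Rightarrow> real) \<Rightarrow> 'h \<Rightarrow> 'h \<Rightarrow> real" where
  "form f x y = ((\<integral>u. f u \<partial>m (x + y)) - (\<integral>u. f u \<partial>m (x - y))) / 4"

lemma functional_form: "bdd_functional {0..K} (\<lambda>f. form f x y)"
  using bdd_functional_scale[OF bdd_functional_minus[OF integral_functional integral_functional],
      of "1/4" "x + y" "x - y"] by (simp add: form_def)

lemma form_power: "form (\<lambda>u. u ^ n) x y = rinner ((blinfun_apply T ^^ n) x) y"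
proof -
  have "rinner ((blinfun_apply T ^^ n) y) x = rinner ((blinfun_apply T ^^ n) x) y"
    by (metis power_T_symmetric rinner_commute)
  then show ?thesis
    by (simp add: form_def moment_m funpow_blinfun_add funpow_blinfun_diff rinner.add_left
        rinner.add_right rinner.diff_left rinner.diff_right)
qed

lemma form_diag:
  assumes "f \<in> bdd_borel {0..K}" shows "form f x x = (\<integral>u. f u \<partial>m x)"
  by (rule bdd_functional_eqI[OF functional_form integral_functional _ assms])
    (simp add: form_power moment_m)

text \<open>For fixed vectors both sides are signed-measure functionals of \<open>f\<close>, and on
  powers the identity is the linearity of T^n. The neighbouring laws of \<open>form\<close> hold for
  the same reason.\<close>

lemma form_add_left:
  assumes "f \<in> bdd_borel {0..K}" shows "form f (x + x') y = form f x y + form f x' y"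
  by (rule bdd_functional_eqI[OF functional_form
        bdd_functional_plus[OF functional_form functional_form] _ assms])
    (simp add: form_power funpow_blinfun_add rinner.add_left)

lemma form_scaleR_left:
  assumes "f \<in> bdd_borel {0..K}" shows "form f (r *\<^sub>R x) y = r * form f x y"
  by (rule bdd_functional_eqI[OF functional_form bdd_functional_scale[OF functional_form] _ assms])
    (simp add: form_power funpow_blinfun_scaleR rinner.scaleR_left)

lemma form_commute:
  assumes "f \<in> bdd_borel {0..K}" shows "form f x y = form f y x"
  by (rule bdd_functional_eqI[OF functional_form functional_form _ assms])
    (metis form_power power_T_symmetric rinner_commute)

text \<open>Again a comparison on powers, where \<open>A\<close> commutes with T^n. Taken with an
  arbitrary operator commuting with \<open>T\<close> it puts the calculus into the bicommutant;
  taken with multiplication by i it gives complex linearity.\<close>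

lemma form_intertwine:
  assumes f: "f \<in> bdd_borel {0..K}"
    and AT: "\<And>v. A (blinfun_apply T v) = blinfun_apply T (A v)"
    and AB: "\<And>x y. rinner (A x) y = rinner x (B y)"
  shows "form f (A x) y = form f x (B y)"
  by (rule bdd_functional_eqI[OF functional_form functional_form _ f])
    (simp add: form_power funpow_commute_point[of "blinfun_apply T" A, OF AT[symmetric]] AB)

lemma integral_m_bound:
  assumes "f \<in> borel_measurable borel" "\<And>u. u \<in> {0..K} \<Longrightarrow> \<bar>f u\<bar> \<le> C"
  shows "\<bar>\<integral>u. f u \<partial>m x\<bar> \<le> C * (norm x)\<^sup>2"
proof -
  interpret finite_measure "m x" by (rule finite_m)
  have "integrable (m x) f"
    by (rule bdd_borel_integrable[OF finite_m sets_m AE_m bdd_borelI[OF assms]])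
  moreover have "AE u in m x. \<bar>f u\<bar> \<le> C"
    using AE_m by (rule eventually_mono) (rule assms(2))
  ultimately have "(\<integral>u. \<bar>f u\<bar> \<partial>m x) \<le> (\<integral>u. C \<partial>m x)"
    by (intro integral_mono_AE) auto
  then have "\<bar>\<integral>u. f u \<partial>m x\<bar> \<le> (\<integral>u. C \<partial>m x)"
    using integral_abs_bound[of "m x" f] by linarith
  then show ?thesis by (simp add: measure_m_total mult.commute)
qed

text \<open>On unit vectors polarisation and the parallelogram law give C (2 + 2) / 4 = C;
  homogeneity extends this to all vectors.\<close>

lemma form_bound:
  assumes f: "f \<in> borel_measurable borel" "\<And>u. u \<in> {0..K} \<Longrightarrow> \<bar>f u\<bar> \<le> C"
  shows "\<bar>form f x y\<bar> \<le> C * (norm x * norm y)"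
proof -
  have f': "f \<in> bdd_borel {0..K}" by (rule bdd_borelI[OF f])
  note lin = form_scaleR_left[OF f']
  have lin': "form f x (r *\<^sub>R y) = r * form f x y" for r x y
    by (metis lin form_commute[OF f'])
  have unit: "\<bar>form f x y\<bar> \<le> C" if "norm x = 1" "norm y = 1" for x y
  proof -
    have "\<bar>form f x y\<bar> \<le> (C * (norm (x + y))\<^sup>2 + C * (norm (x - y))\<^sup>2) / 4"
      unfolding form_def
      using integral_m_bound[OF f, of "x + y"] integral_m_bound[OF f, of "x - y"] by simp
    also have "\<dots> = C * ((norm (x + y))\<^sup>2 + (norm (x - y))\<^sup>2) / 4" by (simp add: distrib_left)
    also have "\<dots> = C" using that by (simp add: parallelogram)
    finally show ?thesis .
  qed
  show ?thesis
  proof (cases "x = 0 \<or> y = 0")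
    case True
    then have "form f x y = 0" using lin[of 0 x y] lin'[of x 0 y] by auto
    then show ?thesis using True by auto
  next
    case False
    have "form f x y = norm x * norm y * form f (x /\<^sub>R norm x) (y /\<^sub>R norm y)"
      using False by (simp add: lin lin' field_simps)
    then have "\<bar>form f x y\<bar> = norm x * norm y * \<bar>form f (x /\<^sub>R norm x) (y /\<^sub>R norm y)\<bar>"
      by (simp add: abs_mult)
    also have "\<dots> \<le> norm x * norm y * C"
      using False by (intro mult_left_mono unit) auto
    finally show ?thesis by (simp add: ac_simps)
  qed
qed

lemma form_bilinear:
  assumes f: "f \<in> bdd_borel {0..K}"
  shows "bounded_bilinear (form f)"
proof -
  obtain C where C: "0 \<le> C" "\<And>u. u \<in> {0..K} \<Longrightarrow> \<bar>f u\<bar> \<le> C" using f bdd_borel_bound by blast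
  show ?thesis
  proof
    show "form f (a + a') b = form f a b + form f a' b" for a a' b
      by (rule form_add_left[OF f])
    then show "form f a (b + b') = form f a b + form f a b'" for a b b'
      by (metis form_commute[OF f])
    show "form f (r *\<^sub>R a) b = r *\<^sub>R form f a b" for r a b
      by (simp add: form_scaleR_left[OF f])
    then show "form f a (r *\<^sub>R b) = r *\<^sub>R form f a b" for r a b
      by (metis form_commute[OF f])
    show "\<exists>K. \<forall>a b. norm (form f a b) \<le> norm a * norm b * K"
      using form_bound[OF bdd_borel_measurable[OF f] C(2)] by (auto simp: mult.commute)
  qed
qed

text \<open>The calculus is built straight from the moment measures. Agreement with
  \<open>fun_calc\<close>, whose definition presupposes the spectral measure, is proved once
  uniqueness of the latter is available.\<close>

definition calc :: "(real \<Rightarrow> real) \<Rightarrow> 'h \<Rightarrow>\<^sub>L 'h" where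
  "calc f = (SOME A. \<forall>x y. rinner (blinfun_apply A x) y = form f x y)"

lemma rinner_calc:
  assumes "f \<in> bdd_borel {0..K}" shows "rinner (blinfun_apply (calc f) x) y = form f x y"
proof -
  have "\<exists>A. \<forall>x y. rinner (blinfun_apply A x) y = form f x y"
    using bounded_form_representation[OF form_bilinear[OF assms]] by metis
  from someI_ex[OF this] show ?thesis by (simp add: calc_def)
qed

lemma rinner_calc_diag:
  "f \<in> bdd_borel {0..K} \<Longrightarrow> rinner (blinfun_apply (calc f) x) x = (\<integral>u. f u \<partial>m x)"
  by (simp add: rinner_calc form_diag)

lemma calc_symmetric:
  "f \<in> bdd_borel {0..K} \<Longrightarrow>
   rinner (blinfun_apply (calc f) x) y = rinner x (blinfun_apply (calc f) y)"
  by (metis rinner_calc form_commute rinner_commute)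

lemma calc_eqI:
  assumes "f \<in> bdd_borel {0..K}" "\<And>x y. rinner (blinfun_apply A x) y = rinner x (blinfun_apply A y)"
    "\<And>x. rinner (blinfun_apply A x) x = (\<integral>u. f u \<partial>m x)"
  shows "calc f = A"
  by (rule symmetric_op_eqI[OF calc_symmetric[OF assms(1)] assms(2)])
    (simp only: rinner_calc_diag[OF assms(1)] assms(3))

lemma calc_cong:
  assumes "f \<in> bdd_borel {0..K}" "g \<in> bdd_borel {0..K}" "\<And>u. u \<in> {0..K} \<Longrightarrow> f u = g u"
  shows "calc f = calc g"
proof (rule calc_eqI)
  fix x
  have "(\<integral>u. f u \<partial>m x) = (\<integral>u. g u \<partial>m x)"
    using assms(1,2)[THEN bdd_borel_measurable] eventually_mono[OF AE_m assms(3)]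
    by (intro integral_cong_AE) (simp_all add: measurable_cong_sets[OF sets_m refl])
  then show "rinner (blinfun_apply (calc g) x) x = (\<integral>u. f u \<partial>m x)"
    by (simp add: rinner_calc_diag assms)
qed (use assms calc_symmetric in auto)

lemma calc_commute:
  assumes f: "f \<in> bdd_borel {0..K}" and AT: "A o\<^sub>L T = T o\<^sub>L A"
  shows "A o\<^sub>L calc f = calc f o\<^sub>L A"
proof (intro blinfun_eqI rinner_eqI)
  fix x y
  obtain B where B: "\<And>x y. rinner (blinfun_apply A x) y = rinner x (blinfun_apply B y)"
    using exists_real_adjoint by blast
  have "blinfun_apply A (blinfun_apply T v) = blinfun_apply T (blinfun_apply A v)" for v
    using AT by (metis blinfun_apply_blinfun_compose)
  from form_intertwine[OF f this B, of x y]
  show "rinner (blinfun_apply (A o\<^sub>L calc f) x) y = rinner (blinfun_apply (calc f o\<^sub>L A) x) y"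
    by (simp add: rinner_calc[OF f] B)
qed

lemma T_bounded_ops: "T \<in> bounded_ops"
  using T by (simp add: positive_op_def)

lemma calc_bounded_ops:
  assumes f: "f \<in> bdd_borel {0..K}" shows "calc f \<in> bounded_ops"
proof (intro bounded_opsI rinner_eqI)
  fix x y
  have "form f (\<i> *\<^sub>C x) y = form f x (- (\<i> *\<^sub>C y))"
    by (rule form_intertwine[OF f])
      (simp_all add: bounded_ops_ii[OF T_bounded_ops] rinner_ii rinner.minus_right)
  then show "rinner (blinfun_apply (calc f) (\<i> *\<^sub>C x)) y = rinner (\<i> *\<^sub>C blinfun_apply (calc f) x) y"
    by (simp add: rinner_calc[OF f] rinner_ii bounded_bilinear.minus_right[OF form_bilinear[OF f]])
qed

lemma cinner_calc_diag:
  "f \<in> bdd_borel {0..K} \<Longrightarrow>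
   cinner (blinfun_apply (calc f) x) x = complex_of_real (\<integral>u. f u \<partial>m x)"
  by (simp add: symmetric_op_cinner calc_bounded_ops calc_symmetric flip: rinner_calc_diag)

text \<open>Two passes of moment uniqueness: one with a power as first factor and \<open>g\<close>
  varying, one with \<open>g\<close> fixed and \<open>f\<close> varying. The passage uses that
  \<open>calc g\<close> is symmetric.\<close>

lemma calc_mult:
  assumes f: "f \<in> bdd_borel {0..K}" and g: "g \<in> bdd_borel {0..K}"
  shows "calc (\<lambda>u. g u * f u) = calc g o\<^sub>L calc f"
proof -
  have 1: "form (\<lambda>u. u ^ n * g u) x y = form g ((blinfun_apply T ^^ n) x) y" for n x y
    by (rule bdd_functional_eqI[OF bdd_functional_density[OF functional_form bdd_borel_power]
          functional_form _ g])
       (simp add: form_power funpow_add flip: power_add, metis add.commute comp_apply funpow_add)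
  have 2: "form (\<lambda>u. g u * f u) x y = form f x (blinfun_apply (calc g) y)" for x y
  proof (rule bdd_functional_eqI[OF bdd_functional_density[OF functional_form g] functional_form _ f])
    fix n
    have "form (\<lambda>u. g u * u ^ n) x y = rinner (blinfun_apply (calc g) ((blinfun_apply T ^^ n) x)) y"
      using 1[of n x y] by (simp add: rinner_calc[OF g] mult.commute)
    also have "\<dots> = form (\<lambda>u. u ^ n) x (blinfun_apply (calc g) y)"
      by (simp add: calc_symmetric[OF g] form_power)
    finally show "form (\<lambda>u. g u * u ^ n) x y = form (\<lambda>u. u ^ n) x (blinfun_apply (calc g) y)" .
  qed
  show ?thesis
    by (intro blinfun_eqI rinner_eqI)
      (simp add: rinner_calc[OF bdd_borel_mult[OF g f]] 2 calc_symmetric[OF g],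
       simp add: rinner_calc[OF f])
qed

lemma calc_add:
  assumes "f \<in> bdd_borel {0..K}" "g \<in> bdd_borel {0..K}"
  shows "calc (\<lambda>u. f u + g u) = calc f + calc g"
  by (intro blinfun_eqI rinner_eqI)
    (simp add: rinner_calc assms bdd_borel_add blinfun.add_left rinner.add_left
      bdd_functional_add[OF functional_form])

lemma calc_cmult:
  assumes "f \<in> bdd_borel {0..K}"
  shows "calc (\<lambda>u. c * f u) = c *\<^sub>R calc f"
  by (intro blinfun_eqI rinner_eqI)
    (simp add: rinner_calc assms bdd_borel_mult[OF bdd_borel_const] blinfun.scaleR_left rinner.scaleR_left
      bdd_functional_cmult[OF functional_form])

lemma calc_diff:
  assumes "f \<in> bdd_borel {0..K}" "g \<in> bdd_borel {0..K}"
  shows "calc (\<lambda>u. f u - g u) = calc f - calc g"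
  using calc_add[OF assms(1) bdd_borel_mult[OF bdd_borel_const assms(2), of "-1"]]
    calc_cmult[OF assms(2), of "-1"] by simp

lemma calc_id: "calc (\<lambda>u. u) = T"
  by (rule calc_eqI[OF bdd_borel_id])
    (use positive_op_symmetric[OF T] moment_m[of _ 1] in auto)

lemma calc_one: "calc (\<lambda>u. 1) = id_blinfun"
  by (rule calc_eqI[OF bdd_borel_const]) (use moment_m[of _ 0] in auto)

lemma calc_zero: "calc (\<lambda>u. 0) = 0"
  by (rule calc_eqI[OF bdd_borel_const]) (simp_all add: rinner.zero_left rinner.zero_right)

lemma calc_positive:
  assumes "f \<in> bdd_borel {0..K}" "\<And>u. u \<in> {0..K} \<Longrightarrow> 0 \<le> f u"
  shows "positive_op (calc f)"
proof (rule positive_opI)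
  show "0 \<le> rinner (blinfun_apply (calc f) x) x" for x
    unfolding rinner_calc_diag[OF assms(1)]
    by (intro integral_nonneg_AE eventually_mono[OF AE_m]) (rule assms(2))
qed (use assms calc_symmetric calc_bounded_ops in auto)

text \<open>By symmetry and multiplicativity |calc g x|^2 is the integral of g^2 against
  \<open>m x\<close>, so bounded convergence of the integrals is already strong convergence of the
  operators.\<close>

lemma calc_strong_LIMSEQ:
  assumes F: "\<And>n. F n \<in> borel_measurable borel" "f \<in> borel_measurable borel"
    and bd: "\<And>n u. u \<in> {0..K} \<Longrightarrow> \<bar>F n u\<bar> \<le> C"
    and lim: "\<And>u. u \<in> {0..K} \<Longrightarrow> (\<lambda>n. F n u) \<longlonglongrightarrow> f u"
  shows "(\<lambda>n. blinfun_apply (calc (F n)) x) \<longlonglongrightarrow> blinfun_apply (calc f) x"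
proof -
  note [measurable] = F
  have F': "F n \<in> bdd_borel {0..K}" for n by (rule bdd_borelI[OF F(1) bd])
  have fb: "\<bar>f u\<bar> \<le> C" if "u \<in> {0..K}" for u
    using tendsto_rabs[OF lim[OF that]] bd[OF that]
    by (intro Lim_bounded[where M=0]) auto
  have f': "f \<in> bdd_borel {0..K}" by (rule bdd_borelI[OF F(2) fb])
  define g where "g n u = F n u - f u" for n u
  have gb: "\<bar>g n u\<bar> \<le> 2 * C" if "u \<in> {0..K}" for n u
    using fb[OF that] bd[OF that, of n] unfolding g_def by linarith
  have g': "g n \<in> bdd_borel {0..K}" for n
    by (rule bdd_borelI[OF _ gb]) (auto simp: g_def)
  have norm2: "(norm (blinfun_apply (calc (F n)) x - blinfun_apply (calc f) x))\<^sup>2 = (\<integral>u. g n u * g n u \<partial>m x)" for n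
  proof -
    have "(norm (blinfun_apply (calc (g n)) x))\<^sup>2 = rinner (blinfun_apply (calc (g n) o\<^sub>L calc (g n)) x) x"
      by (simp add: calc_symmetric[OF g'] flip: rinner_self)
    also have "\<dots> = (\<integral>u. g n u * g n u \<partial>m x)"
      by (simp add: rinner_calc_diag[OF bdd_borel_mult[OF g' g']] flip: calc_mult[OF g' g'])
    also have "calc (g n) = calc (F n) - calc f"
      unfolding g_def by (rule calc_diff[OF F' f'])
    finally show ?thesis by (simp add: blinfun.diff_left)
  qed
  have "(\<lambda>n. \<integral>u. g n u * g n u \<partial>m x) \<longlonglongrightarrow> (\<integral>u. 0 \<partial>m x)"
  proof (rule bdd_functional_LIMSEQ[OF integral_functional, where C="(2 * C) * (2 * C)"])
    show "\<bar>g n u * g n u\<bar> \<le> (2 * C) * (2 * C)" if "u \<in> {0..K}" for n u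
      unfolding abs_mult using gb[OF that, of n] by (intro mult_mono) auto
    show "(\<lambda>n. g n u * g n u) \<longlonglongrightarrow> 0" if "u \<in> {0..K}" for u
    proof -
      have "(\<lambda>n. g n u) \<longlonglongrightarrow> 0" unfolding g_def using lim[OF that] by (simp add: LIM_zero)
      from tendsto_mult[OF this this] show ?thesis by simp
    qed
  qed (auto simp: g_def)
  then have "(\<lambda>n. (norm (blinfun_apply (calc (F n)) x - blinfun_apply (calc f) x))\<^sup>2) \<longlonglongrightarrow> 0"
    by (simp add: norm2)
  then have "(\<lambda>n. sqrt ((norm (blinfun_apply (calc (F n)) x - blinfun_apply (calc f) x))\<^sup>2)) \<longlonglongrightarrow> sqrt 0"
    by (rule tendsto_real_sqrt)
  then have "(\<lambda>n. blinfun_apply (calc (F n)) x - blinfun_apply (calc f) x) \<longlonglongrightarrow> 0"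
    by (simp add: tendsto_norm_zero_iff)
  then show ?thesis by (simp add: LIM_zero_iff)
qed

section \<open>Image measures: spectral measures of functions of the operator\<close>

lemma measurable_m: "borel_measurable (m x) = borel_measurable borel"
  by (rule measurable_cong_sets[OF sets_m refl])

text \<open>The image of the spectral measure of \<open>T\<close> under \<open>h\<close>, hence the
  candidate for the spectral measure of \<open>calc h\<close>. The value 0 off the Borel sets
  matches the convention in \<open>proj_valued_measure\<close>.\<close>

definition push :: "(real \<Rightarrow> real) \<Rightarrow> real set \<Rightarrow> 'h \<Rightarrow>\<^sub>L 'h" where
  "push h B = (if B \<in> sets borel then calc (indicator (h -` B)) else 0)"

lemma vimage_borel: "h \<in> borel_measurable borel \<Longrightarrow> B \<in> sets borel \<Longrightarrow> h -` B \<in> sets borel"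
  using measurable_sets[of h borel borel B] by simp

lemma indicator_mult_fun:
  "(\<lambda>u. indicator A u * indicator B u :: real) = indicator (A \<inter> B)"
  by (auto simp: fun_eq_iff indicator_def)

text \<open>Products of indicators are indicators of intersections, which gives idempotence and
  multiplicativity; countable additivity is strong convergence along the partial unions.\<close>

lemma push_proj_valued:
  assumes h: "h \<in> borel_measurable borel"
  shows "proj_valued_measure (push h)"
proof -
  note ind = bdd_borel_indicator[OF vimage_borel[OF h]]
  have "projection_op (push h B)" if B: "B \<in> sets borel" for B
  proof -
    have "calc (indicator (h -` B)) o\<^sub>L calc (indicator (h -` B)) = calc (indicator (h -` B))"
      using calc_mult[OF ind[OF B] ind[OF B]] unfolding indicator_mult_fun by simp
    then show ?thesis
      unfolding projection_op_def push_def
      using B calc_bounded_ops[OF ind[OF B]] calc_symmetric[OF ind[OF B]]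
      by (auto intro!: adj_op_eqI)
  qed
  moreover have "push h UNIV = id_blinfun"
    using calc_one by (simp add: push_def)
  moreover have "push h (B \<inter> C) = push h B o\<^sub>L push h C" if "B \<in> sets borel" "C \<in> sets borel" for B C
    using that calc_mult[OF ind[OF that(2)] ind[OF that(1)]] unfolding indicator_mult_fun
    by (simp add: push_def)
  moreover have "(\<lambda>n. blinfun_apply (push h (F n)) x) sums blinfun_apply (push h (\<Union>n. F n)) x"
    if F: "range F \<subseteq> sets borel" "disjoint_family F" for F :: "nat \<Rightarrow> real set" and x
  proof -
    have Fn: "F n \<in> sets borel" "h -` F n \<in> sets borel" for n using F(1) vimage_borel[OF h] by auto
    have UF: "(\<Union>n. F n) \<in> sets borel" using Fn by auto
    have dis: "(\<Sum>i<n. indicator (h -` F i) u) = (indicator (\<Union>i<n. h -` F i) u :: real)" for n u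
      using F(2) by (intro indicator_UN_disjoint[symmetric]) (auto simp: disjoint_family_on_def)
    have "calc (\<lambda>u. \<Sum>i<n. indicator (h -` F i) u) = (\<Sum>i<n. push h (F i))" for n
      by (induction n)
        (auto simp: push_def calc_zero Fn calc_add bdd_borel_sum bdd_borel_indicator)
    then have part: "calc (indicator (\<Union>i<n. h -` F i)) = (\<Sum>i<n. push h (F i))" for n
      by (simp add: dis)
    have "(\<lambda>n. blinfun_apply (calc (indicator (\<Union>i<n. h -` F i))) x)
        \<longlonglongrightarrow> blinfun_apply (calc (indicator (\<Union>i. h -` F i))) x"
    proof (rule calc_strong_LIMSEQ[where C=1])
      show "(\<lambda>n. indicator (\<Union>i<n. h -` F i) u :: real) \<longlonglongrightarrow> indicator (\<Union>i. h -` F i) u" for u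
        by (rule LIMSEQ_indicator_UN)
      show "\<bar>indicator (\<Union>i<n. h -` F i) u\<bar> \<le> (1 :: real)" for n u by (simp add: indicator_def)
    qed (use Fn in \<open>auto intro!: borel_measurable_indicator\<close>)
    then show ?thesis
      using UF by (simp add: sums_def part blinfun.sum_left push_def vimage_UN)
  qed
  ultimately show ?thesis unfolding proj_valued_measure_def by (auto simp: push_def)
qed

lemma scalar_measure_push:
  assumes h: "h \<in> borel_measurable borel"
  shows "scalar_measure (push h) x = distr (m x) borel h"
proof -
  interpret finite_measure "m x" by (rule finite_m)
  have "ennreal (Re (cinner (blinfun_apply (push h B) x) x)) = emeasure (distr (m x) borel h) B"
    if B: "B \<in> sets borel" for B
  proof -
    note hB = vimage_borel[OF h B]
    have "Re (cinner (blinfun_apply (push h B) x) x) = measure (m x) (h -` B)"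
      using rinner_calc_diag[OF bdd_borel_indicator[OF hB], of x] B hB
      by (simp add: push_def rinner_def sets_m sets_eq_imp_space_eq[OF sets_m])
    then show ?thesis
      using h B by (subst emeasure_distr)
        (auto simp: measurable_m emeasure_eq_measure sets_eq_imp_space_eq[OF sets_m])
  qed
  then have "scalar_measure (push h) x
      = measure_of UNIV (sets borel) (emeasure (distr (m x) borel h))"
    unfolding scalar_measure_def
    by (intro measure_of_eq) (auto simp: sets.sigma_sets_eq[of borel, simplified])
  also have "\<dots> = distr (m x) borel h"
    using measure_of_of_measure[of "distr (m x) borel h"] by simp
  finally show ?thesis .
qed

end


section \<open>Uniqueness of the spectral measure\<close>

lemma projection_op_symmetric:
  "projection_op P \<Longrightarrow> rinner (blinfun_apply P x) y = rinner x (blinfun_apply P y)"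
  unfolding projection_op_def by (metis rinner_adj_op)

text \<open>Stands for an arbitrary competitor in the description of
  \<open>spectral_measure\<close>; two of them are compared later.\<close>

locale spectral_resolution =
  fixes E :: "real set \<Rightarrow> 'h::complex_hilbert_space \<Rightarrow>\<^sub>L 'h" and L :: real
  assumes pvm: "proj_valued_measure E" and supp: "E {- L..L} = id_blinfun"
begin

lemma E_sym: "rinner (blinfun_apply (E B) x) y = rinner x (blinfun_apply (E B) y)"
proof (cases "B \<in> sets borel")
  case True
  then show ?thesis using pvm projection_op_symmetric unfolding proj_valued_measure_def by blast
next
  case False
  then have "E B = 0" using pvm unfolding proj_valued_measure_def by blast
  then show ?thesis by (simp add: rinner.zero_left rinner.zero_right)
qed

lemma E_Int:
  "B \<in> sets borel \<Longrightarrow> C \<in> sets borel \<Longrightarrow> blinfun_apply (E B) (blinfun_apply (E C) x) = blinfun_apply (E (B \<inter> C)) x"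
  using pvm unfolding proj_valued_measure_def by (metis blinfun_apply_blinfun_compose)

lemma E_sums:
  "range F \<subseteq> sets borel \<Longrightarrow> disjoint_family F \<Longrightarrow>
   (\<lambda>n. blinfun_apply (E (F n)) x) sums blinfun_apply (E (\<Union>n. F n)) x"
  using pvm unfolding proj_valued_measure_def by blast

text \<open>The empty set is the disjoint union of infinitely many copies of itself, and a
  convergent series with constant terms is zero.\<close>

lemma E_empty: "E {} = 0"
proof (rule blinfun_eqI)
  fix x
  have "(\<lambda>n::nat. blinfun_apply (E {}) x) sums blinfun_apply (E {}) x"
    using E_sums[of "\<lambda>_. {}" x] by (simp add: disjoint_family_on_def)
  then show "blinfun_apply (E {}) x = blinfun_apply 0 x"
    using summable_LIMSEQ_zero[OF sums_summable] LIMSEQ_const_iff by fastforce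
qed

lemma E_diag:
  "B \<in> sets borel \<Longrightarrow> rinner (blinfun_apply (E B) x) x = (norm (blinfun_apply (E B) x))\<^sup>2"
  using E_Int[of B B x] E_sym[of B x "blinfun_apply (E B) x"] E_sym[of B "blinfun_apply (E B) x" x]
  by (simp flip: rinner_self)

lemma E_Compl:
  assumes "B \<in> sets borel"
  shows "blinfun_apply (E B) x + blinfun_apply (E (- B)) x = x"
proof -
  have d: "range (binaryset B (- B)) \<subseteq> sets borel" "disjoint_family (binaryset B (- B))"
    using assms by (auto simp: range_binaryset_eq disjoint_family_on_def binaryset_def)
  have "(\<lambda>n. blinfun_apply (E (binaryset B (- B) n)) x) sums blinfun_apply (E UNIV) x"
    using E_sums[OF d, of x] by (simp add: UN_binaryset_eq)
  moreover have "(\<lambda>n. blinfun_apply (E (binaryset B (- B) n)) x) sums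
      (\<Sum>n\<in>{0,1}. blinfun_apply (E (binaryset B (- B) n)) x)"
    by (rule sums_finite) (auto simp: binaryset_def E_empty)
  ultimately have "blinfun_apply (E UNIV) x = blinfun_apply (E B) x + blinfun_apply (E (- B)) x"
    using sums_unique2 by (fastforce simp: binaryset_def)
  then show ?thesis using pvm by (simp add: proj_valued_measure_def)
qed

lemma sets_scalar: "sets (scalar_measure E x) = sets borel"
  using sets.sigma_sets_eq[of "borel :: real measure"]
  by (simp add: scalar_measure_def sets_measure_of_conv)

lemma emeasure_scalar:
  assumes "B \<in> sets borel"
  shows "emeasure (scalar_measure E x) B = ennreal (rinner (blinfun_apply (E B) x) x)"
  unfolding rinner_def[symmetric] scalar_measure_def
proof (rule emeasure_measure_of_sigma)
  show "sigma_algebra UNIV (sets (borel :: real measure))"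
    using sets.sigma_algebra_axioms[of "borel :: real measure"] by simp
  show "positive (sets borel) (\<lambda>B. ennreal (rinner (blinfun_apply (E B) x) x))"
    by (simp add: positive_def E_empty rinner.zero_left)
  show "countably_additive (sets borel) (\<lambda>B. ennreal (rinner (blinfun_apply (E B) x) x))"
    unfolding countably_additive_def
  proof (intro allI impI)
    fix F :: "nat \<Rightarrow> real set" assume F: "range F \<subseteq> sets borel" "disjoint_family F"
    have "(\<lambda>n. rinner (blinfun_apply (E (F n)) x) x) sums rinner (blinfun_apply (E (\<Union>n. F n)) x) x"
      by (rule bounded_linear.sums[OF rinner.bounded_linear_left E_sums[OF F]])
    then show "(\<Sum>i. ennreal (rinner (blinfun_apply (E (F i)) x) x))
        = ennreal (rinner (blinfun_apply (E (\<Union> (range F))) x) x)"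
      using F E_diag by (intro suminf_ennreal_eq) auto
  qed
qed (use assms in auto)

lemma space_scalar: "space (scalar_measure E x) = UNIV"
  using sets_eq_imp_space_eq[OF sets_scalar] by simp

lemma finite_scalar: "finite_measure (scalar_measure E x)"
  by (rule finite_measureI) (simp add: space_scalar emeasure_scalar)

lemma measure_scalar:
  "B \<in> sets borel \<Longrightarrow> measure (scalar_measure E x) B = rinner (blinfun_apply (E B) x) x"
  by (simp add: measure_def emeasure_scalar E_diag)

text \<open>The room between \<open>L\<close> and \<open>L'\<close> allows two resolutions with
  different supports to be compared on a common interval.\<close>

lemma AE_scalar: "L \<le> L' \<Longrightarrow> AE u in scalar_measure E x. u \<in> {- L'..L'}"
proof -
  assume L': "L \<le> L'"
  have "E (- {- L..L}) = 0"
  proof (rule blinfun_eqI)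
    fix x
    have "blinfun_apply (E (- {- L..L})) (blinfun_apply (E {- L..L}) x) = blinfun_apply 0 x"
      by (subst E_Int) (simp_all add: E_empty)
    then show "blinfun_apply (E (- {- L..L})) x = blinfun_apply 0 x" by (simp add: supp)
  qed
  then have "- {- L..L} \<in> null_sets (scalar_measure E x)"
    by (intro null_setsI) (simp_all add: sets_scalar emeasure_scalar rinner.zero_left)
  then show ?thesis
    by (rule AE_I') (use L' in auto)
qed

lemma scalar_functional:
  "L \<le> L' \<Longrightarrow> bdd_functional {- L'..L'} (\<lambda>f. \<integral>u. f u \<partial>scalar_measure E x)"
  by (intro bdd_functional_integral finite_scalar sets_scalar AE_scalar)

lemma integral_scalar_indicator:
  "B \<in> sets borel \<Longrightarrow> (\<integral>u. indicator B u \<partial>scalar_measure E x) = rinner (blinfun_apply (E B) x) x"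
  by (simp add: measure_scalar space_scalar)

lemma polar_scalar:
  assumes "B \<in> sets borel"
  shows "((\<integral>u. indicator B u \<partial>scalar_measure E (x + y)) - (\<integral>u. indicator B u \<partial>scalar_measure E (x - y))) / 4
    = rinner (blinfun_apply (E B) x) y"
proof -
  have "rinner (blinfun_apply (E B) y) x = rinner (blinfun_apply (E B) x) y"
    by (metis E_sym rinner_commute)
  then show ?thesis
    unfolding integral_scalar_indicator[OF assms]
    by (simp add: blinfun.add_right blinfun.diff_right rinner.add_left rinner.add_right
        rinner.diff_left rinner.diff_right)
qed

context
  fixes A :: "'h \<Rightarrow>\<^sub>L 'h"
  assumes A: "\<And>x y. rinner (blinfun_apply A x) y = rinner x (blinfun_apply A y)"
    and weak: "\<And>x. rinner (blinfun_apply A x) x = (\<integral>u. u \<partial>scalar_measure E x)"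
begin

text \<open>The scalar measures of \<open>E C x + E (- C) x\<close> and \<open>E C x - E (- C) x\<close> agree, so \<open>A\<close> has no
  cross term between the two components.\<close>

lemma rinner_A_E:
  assumes C: "C \<in> sets borel"
  shows "rinner (blinfun_apply A (blinfun_apply (E C) x)) x = (\<integral>u. u * indicator C u \<partial>scalar_measure E x)"
proof -
  define a b where "a = blinfun_apply (E C) x" and "b = blinfun_apply (E (- C)) x"
  have x: "x = a + b" using E_Compl[OF C, of x] by (simp add: a_def b_def)
  have Bab: "rinner (blinfun_apply (E B) a) b = 0" if B: "B \<in> sets borel" for B
  proof -
    have "rinner (blinfun_apply (E B) a) b = rinner (blinfun_apply (E (- C)) (blinfun_apply (E (B \<inter> C)) x)) x"
      unfolding a_def b_def using B C by (simp add: E_sym E_Int)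
    also have "\<dots> = 0"
      using B C by (simp add: E_Int E_empty rinner.zero_left rinner.zero_right inf_left_commute)
    finally show ?thesis .
  qed
  have "(\<integral>u. u \<partial>scalar_measure E (a + b)) - (\<integral>u. u \<partial>scalar_measure E (a - b)) = 0"
    by (rule bdd_functional_eq_0_indicator[OF bdd_functional_minus[OF
            scalar_functional[OF order_refl] scalar_functional[OF order_refl]] _ bdd_borel_id])
       (use polar_scalar[of _ a b] Bab in force)
  then have "rinner (blinfun_apply A (a + b)) (a + b) = rinner (blinfun_apply A (a - b)) (a - b)"
    by (simp add: weak)
  then have "rinner (blinfun_apply A a) b + rinner (blinfun_apply A b) a = 0"
    by (simp add: blinfun.add_right blinfun.diff_right rinner.add_left rinner.add_right
        rinner.diff_left rinner.diff_right)
  then have "rinner (blinfun_apply A a) b = 0"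
    by (simp add: A[of b a] rinner_commute[of b])
  then have "rinner (blinfun_apply A a) x = rinner (blinfun_apply A a) a"
    by (simp add: x rinner.add_right)
  also have "\<dots> = (\<integral>u. u \<partial>scalar_measure E a)" by (rule weak)
  \<comment> \<open>The scalar measure of \<open>E C x\<close> is that of \<open>x\<close>
    restricted to \<open>C\<close>, as is seen on indicators.\<close>
  also have "\<dots> = (\<integral>u. indicator C u * u \<partial>scalar_measure E x)"
  proof (rule bdd_functional_eqI_indicator[OF scalar_functional[OF order_refl] bdd_functional_density[OF
          scalar_functional[OF order_refl] bdd_borel_indicator[OF C]] _ bdd_borel_id])
    fix B :: "real set" assume B: "B \<in> sets borel"
    have "(\<integral>u. indicator B u \<partial>scalar_measure E a) = rinner (blinfun_apply (E B) a) a"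
      by (rule integral_scalar_indicator[OF B])
    also have "\<dots> = rinner (blinfun_apply (E (C \<inter> B)) x) x"
      unfolding a_def by (subst E_sym[symmetric]) (use B C in \<open>simp add: E_Int inf_left_commute Int_commute\<close>)
    also have "\<dots> = (\<integral>u. indicator C u * indicator B u \<partial>scalar_measure E x)"
      using integral_scalar_indicator[of "C \<inter> B" x] B C by (simp add: indicator_inter_arith)
    finally show "(\<integral>u. indicator B u \<partial>scalar_measure E a)
        = (\<integral>u. indicator C u * indicator B u \<partial>scalar_measure E x :: real)" .
  qed
  finally show ?thesis by (simp add: a_def mult.commute)
qed

text \<open>The measure u dE_x equals the polarised scalar measure of the pair x, A x, by the
  preceding lemma. Integrating u^n against it raises the exponent by one, with the induction
  hypothesis used at x + A x and x - A x.\<close>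

lemma scalar_moment:
  "(\<integral>u. u ^ n \<partial>scalar_measure E x) = rinner ((blinfun_apply A ^^ n) x) x"
proof (induction n arbitrary: x)
  case 0
  have "E UNIV = id_blinfun" using pvm by (simp add: proj_valued_measure_def)
  then show ?case using integral_scalar_indicator[of UNIV x] by simp
next
  case (Suc n)
  let ?y = "blinfun_apply A x"
  have sym: "rinner ((blinfun_apply A ^^ n) v) w = rinner v ((blinfun_apply A ^^ n) w)" for v w
    by (rule funpow_symmetric) (rule A)
  have "(\<integral>u. u * u ^ n \<partial>scalar_measure E x)
      = 1 / 4 * ((\<integral>u. u ^ n \<partial>scalar_measure E (x + ?y)) - (\<integral>u. u ^ n \<partial>scalar_measure E (x - ?y)))"
  proof (rule bdd_functional_eqI_indicator[OF bdd_functional_density[OF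
          scalar_functional[OF order_refl] bdd_borel_id] bdd_functional_scale[OF bdd_functional_minus[OF
            scalar_functional[OF order_refl] scalar_functional[OF order_refl]]] _ bdd_borel_power])
    fix C :: "real set" assume C: "C \<in> sets borel"
    show "(\<integral>u. u * indicator C u \<partial>scalar_measure E x) = 1 / 4 *
       ((\<integral>u. indicator C u \<partial>scalar_measure E (x + ?y)) - (\<integral>u. indicator C u \<partial>scalar_measure E (x - ?y)))"
      using polar_scalar[OF C, of x ?y] rinner_A_E[OF C, of x] by (simp add: A)
  qed
  also have "\<dots> = rinner ((blinfun_apply A ^^ n) x) ?y"
    using sym[of x ?y] rinner_commute[of x "(blinfun_apply A ^^ n) ?y"]
    by (simp add: Suc.IH funpow_blinfun_add funpow_blinfun_diff rinner.add_left rinner.add_right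
        rinner.diff_left rinner.diff_right)
  also have "\<dots> = rinner ((blinfun_apply A ^^ Suc n) x) x" by (simp add: A)
  finally show ?case by simp
qed

end

end

text \<open>All moments of the scalar measures are those of \<open>A\<close>, so these measures
  agree on the larger of the two support intervals; the diagonal then determines the symmetric
  operators \<open>E B\<close>.\<close>

lemma spectral_resolution_unique:
  assumes E: "spectral_resolution E L" and E': "spectral_resolution E' L'"
    and sym: "\<And>x y. rinner (blinfun_apply A x) y = rinner x (blinfun_apply A y)"
    and weak: "\<And>x. rinner (blinfun_apply A x) x = (\<integral>u. u \<partial>scalar_measure E x)"
      "\<And>x. rinner (blinfun_apply A x) x = (\<integral>u. u \<partial>scalar_measure E' x)"
  shows "E = E'"
proof (rule ext)
  fix B
  interpret E: spectral_resolution E L by fact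
  interpret E': spectral_resolution E' L' by fact
  show "E B = E' B"
  proof (cases "B \<in> sets borel")
    case True
    show ?thesis
    proof (rule symmetric_op_eqI[OF E.E_sym E'.E_sym])
      fix x
      have "(\<integral>u. indicator B u \<partial>scalar_measure E x) = (\<integral>u. indicator B u \<partial>scalar_measure E' x :: real)"
        by (rule bdd_functional_eqI[OF E.scalar_functional[of "max L L'"] E'.scalar_functional[of "max L L'"]])
          (use True in \<open>simp_all add: E.scalar_moment[OF sym weak(1)] E'.scalar_moment[OF sym weak(2)] bdd_borel_indicator\<close>)
      then show "rinner (blinfun_apply (E B) x) x = rinner (blinfun_apply (E' B) x) x"
        by (simp only: E.integral_scalar_indicator[OF True] E'.integral_scalar_indicator[OF True])
    qed
  next
    case False
    then show ?thesis using E.pvm E'.pvm by (simp add: proj_valued_measure_def)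
  qed
qed

lemma spectral_measure_eqI:
  assumes A: "positive_op A" and E: "proj_valued_measure E" "E {- L..L} = id_blinfun"
    and weak: "\<And>x. rinner (blinfun_apply A x) x = (\<integral>u. u \<partial>scalar_measure E x)"
  shows "spectral_measure A = E"
  unfolding spectral_measure_def
proof (rule the_equality)
  have cA: "cinner (blinfun_apply A x) x = complex_of_real (rinner (blinfun_apply A x) x)" for x
    using A positive_op_symmetric[OF A] by (intro symmetric_op_cinner) (auto simp: positive_op_def)
  show "proj_valued_measure E \<and> (\<exists>K. E {- K..K} = id_blinfun) \<and>
    (\<forall>x. cinner (blinfun_apply A x) x = complex_of_real (\<integral>u. u \<partial>scalar_measure E x))"
    using E weak by (auto simp: cA)
  fix E'
  assume E': "proj_valued_measure E' \<and> (\<exists>K. E' {- K..K} = id_blinfun) \<and>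
    (\<forall>x. cinner (blinfun_apply A x) x = complex_of_real (\<integral>u. u \<partial>scalar_measure E' x))"
  then obtain L' where "E' {- L'..L'} = id_blinfun" by blast
  with E' have "spectral_resolution E' L'" by (simp add: spectral_resolution_def)
  moreover have "spectral_resolution E L" using E by (simp add: spectral_resolution_def)
  moreover have "rinner (blinfun_apply A x) x = (\<integral>u. u \<partial>scalar_measure E' x)" for x
    using E' by (simp add: cA of_real_eq_iff)
  ultimately show "E' = E"
    using spectral_resolution_unique[of E' L' E L A] positive_op_symmetric[OF A] weak by blast
qed

section \<open>Agreement of the constructed calculus with the defined one\<close>

context moment_family
begin

text \<open>Change of variables shows that \<open>push h\<close> represents \<open>calc h\<close>,
  and a bound for \<open>h\<close> on {0..K} provides the compact support.\<close>

lemma spectral_measure_calc: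
  assumes h: "h \<in> bdd_borel {0..K}" and pos: "\<And>u. u \<in> {0..K} \<Longrightarrow> 0 \<le> h u"
  shows "spectral_measure (calc h) = push h"
proof -
  note [measurable] = bdd_borel_measurable[OF h]
  obtain C where C: "\<And>u. u \<in> {0..K} \<Longrightarrow> \<bar>h u\<bar> \<le> C" using h bdd_borel_bound by blast
  have "calc (indicator (h -` {- C..C})) = calc (\<lambda>u. 1)"
  proof (rule calc_cong)
    show "indicator (h -` {- C..C}) \<in> bdd_borel {0..K}"
      by (intro bdd_borel_indicator vimage_borel) auto
    show "indicator (h -` {- C..C}) u = (1::real)" if "u \<in> {0..K}" for u
      using C[OF that] by (auto simp: indicator_def)
  qed (rule bdd_borel_const)
  then have "push h {- C..C} = id_blinfun" by (simp add: push_def calc_one)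
  moreover have "rinner (blinfun_apply (calc h) x) x = (\<integral>u. u \<partial>scalar_measure (push h) x)" for x
    by (simp add: scalar_measure_push integral_distr measurable_m rinner_calc_diag[OF h])
  moreover have "positive_op (calc h)" using h pos by (rule calc_positive)
  moreover have "proj_valued_measure (push h)" by (rule push_proj_valued) measurable
  ultimately show ?thesis by (intro spectral_measure_eqI)
qed

text \<open>The composition rule f(h(T)) by change of variables. With h the identity it yields the
  powers of \<open>T\<close>, and with h a square it yields absolute values.\<close>

lemma fun_calc_calc:
  assumes h: "h \<in> bdd_borel {0..K}" and pos: "\<And>u. u \<in> {0..K} \<Longrightarrow> 0 \<le> h u"
    and f: "f \<in> borel_measurable borel" "(\<lambda>u. f (h u)) \<in> bdd_borel {0..K}"
  shows "fun_calc f (calc h) = calc (\<lambda>u. f (h u))"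
proof -
  have sm: "spectral_measure (calc h) = push h" using h pos by (rule spectral_measure_calc)
  note [measurable] = bdd_borel_measurable[OF h] f(1)
  have *: "(\<integral>u. f u \<partial>scalar_measure (push h) x) = (\<integral>u. f (h u) \<partial>m x)" for x
    by (simp add: scalar_measure_push integral_distr measurable_m)
  have 1: "calc (\<lambda>u. f (h u)) \<in> bounded_ops \<and>
    (\<forall>x. cinner (blinfun_apply (calc (\<lambda>u. f (h u))) x) x
       = complex_of_real (\<integral>u. f u \<partial>scalar_measure (push h) x))"
    by (simp add: * calc_bounded_ops f(2) cinner_calc_diag)
  have 2: "B = calc (\<lambda>u. f (h u))" if "B \<in> bounded_ops \<and>
    (\<forall>x. cinner (blinfun_apply B x) x = complex_of_real (\<integral>u. f u \<partial>scalar_measure (push h) x))" for B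
    using that by (intro bounded_ops_eqI) (auto simp: * calc_bounded_ops f(2) cinner_calc_diag)
  show ?thesis unfolding fun_calc_def sm by (rule the_equality) (use 1 2 in blast)+
qed

lemma bdd_borel_powr:
  assumes "0 < s" shows "(\<lambda>u. u powr s) \<in> bdd_borel {0..K}"
proof (rule bdd_borelI)
  show "\<bar>u powr s\<bar> \<le> K powr s" if "u \<in> {0..K}" for u
    using that assms by (auto intro: powr_mono2)
qed simp

lemma powr_op_T: "0 < s \<Longrightarrow> powr_op T s = calc (\<lambda>u. u powr s)"
  unfolding powr_op_def
  using fun_calc_calc[OF bdd_borel_id, of "\<lambda>u. u powr s"] by (simp add: calc_id bdd_borel_powr)

text \<open>The root of h^2 returns \<open>h\<close> where \<open>h\<close> is nonnegative, that is
  on {0..K}, and values elsewhere do not affect the operator.\<close>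

lemma abs_op_calc:
  assumes h: "h \<in> bdd_borel {0..K}" and pos: "\<And>u. u \<in> {0..K} \<Longrightarrow> 0 \<le> h u"
  shows "abs_op (calc h) = calc h"
proof -
  note hh = bdd_borel_mult[OF h h]
  have adj: "adj_op (calc h) = calc h"
    by (rule adj_op_eqI[OF calc_bounded_ops[OF h] calc_symmetric[OF h]])
  have *: "sqrt (h u * h u) = h u" if "u \<in> {0..K}" for u
    using pos[OF that] by (simp add: real_sqrt_mult_self abs_of_nonneg)
  have sq: "(\<lambda>u. sqrt (h u * h u)) \<in> bdd_borel {0..K}"
  proof -
    note [measurable] = bdd_borel_measurable[OF h]
    obtain C where C: "\<And>u. u \<in> {0..K} \<Longrightarrow> \<bar>h u\<bar> \<le> C" using bdd_borel_bound[OF h] by blast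
    show ?thesis
    proof (rule bdd_borelI)
      show "\<bar>sqrt (h u * h u)\<bar> \<le> C" if "u \<in> {0..K}" for u
        unfolding *[OF that] by (rule C[OF that])
    qed measurable
  qed
  have "abs_op (calc h) = fun_calc sqrt (calc (\<lambda>u. h u * h u))"
    by (simp add: abs_op_def adj calc_mult[OF h h])
  also have "\<dots> = calc (\<lambda>u. sqrt (h u * h u))"
    by (rule fun_calc_calc[OF hh _ _ sq]) auto
  also have "\<dots> = calc h" by (rule calc_cong[OF sq h *])
  finally show ?thesis .
qed

lemma sing_val_calc:
  assumes h: "h \<in> bdd_borel {0..K}" and pos: "\<And>u. u \<in> {0..K} \<Longrightarrow> 0 \<le> h u"
  shows "sing_val \<tau> t (calc h) = Inf {s. 0 \<le> s \<and> \<tau> (calc (indicator {u. s < h u})) \<le> ennreal t}"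
proof -
  have "abs_op (calc h) = calc h" using h pos by (rule abs_op_calc)
  moreover have "spectral_measure (calc h) = push h" using h pos by (rule spectral_measure_calc)
  ultimately show ?thesis by (simp add: sing_val_def push_def vimage_def)
qed

end


section \<open>The trace as a measure on the spectrum\<close>

lemma bounded_ops_diff: "A \<in> bounded_ops \<Longrightarrow> B \<in> bounded_ops \<Longrightarrow> A - B \<in> bounded_ops"
  by (rule bounded_opsI) (simp add: blinfun.diff_left bounded_ops_ii,
      metis diff_conv_add_uminus ii_ii scaleC_add_right)

locale traced_family = moment_family T K m for T :: "'h::complex_hilbert_space \<Rightarrow>\<^sub>L 'h" and K m +
  fixes N :: "('h \<Rightarrow>\<^sub>L 'h) set" and \<tau> :: "('h \<Rightarrow>\<^sub>L 'h) \<Rightarrow> ennreal"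
  assumes vna: "von_neumann_algebra N" and trace: "trace_on N \<tau>" and normal: "normal_trace N \<tau>"
    and T_in: "T \<in> N"
begin

text \<open>What commutes with \<open>T\<close> commutes with \<open>calc f\<close>, so
  \<open>calc f\<close> lies in the bicommutant of \<open>N\<close>.\<close>

lemma calc_in: "f \<in> bdd_borel {0..K} \<Longrightarrow> calc f \<in> N"
proof -
  assume f: "f \<in> bdd_borel {0..K}"
  have "calc f \<in> commutant (commutant N)"
    unfolding commutant_def[of "commutant N"]
    using calc_bounded_ops[OF f] calc_commute[OF f] T_in by (auto simp: commutant_def)
  then show ?thesis using vna by (simp add: von_neumann_algebra_def)
qed

lemma calc_pos_part:
  assumes "f \<in> bdd_borel {0..K}" "\<And>u. 0 \<le> f u"
  shows "calc f \<in> pos_part N"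
  using calc_in[OF assms(1)] calc_positive[OF assms(1)] assms(2) by (simp add: pos_part_def)

lemma trace_calc_add:
  assumes "f \<in> bdd_borel {0..K}" "\<And>u. 0 \<le> f u" "g \<in> bdd_borel {0..K}" "\<And>u. 0 \<le> g u"
  shows "\<tau> (calc (\<lambda>u. f u + g u)) = \<tau> (calc f) + \<tau> (calc g)"
  using trace calc_pos_part[OF assms(1,2)] calc_pos_part[OF assms(3,4)]
  by (simp add: trace_on_def calc_add[OF assms(1,3)])

lemma trace_calc_cmult:
  assumes "f \<in> bdd_borel {0..K}" "\<And>u. 0 \<le> f u" "0 \<le> c"
  shows "\<tau> (calc (\<lambda>u. c * f u)) = ennreal c * \<tau> (calc f)"
  using trace calc_pos_part[OF assms(1,2)] assms(3)
  by (simp add: trace_on_def calc_cmult[OF assms(1)])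

lemma trace_zero: "\<tau> 0 = 0"
  using trace_calc_cmult[OF bdd_borel_const[of 0], of 0] by (simp add: calc_zero)

lemma calc_mono:
  assumes "f \<in> bdd_borel {0..K}" "g \<in> bdd_borel {0..K}" "\<And>u. f u \<le> g u"
  shows "calc f \<le>\<^sub>o\<^sub>p calc g"
proof -
  have "(\<lambda>u. g u - f u) \<in> bdd_borel {0..K}"
    using bdd_borel_add[OF assms(2) bdd_borel_mult[OF bdd_borel_const assms(1), of "-1"]] by simp
  then have "positive_op (calc (\<lambda>u. g u - f u))"
    using assms(3) by (intro calc_positive) auto
  then show ?thesis by (simp add: le_op_def calc_diff[OF assms(2,1)])
qed

text \<open>Normality speaks of least upper bounds among all positive elements of \<open>N\<close>,
  so an upper bound may lie outside the calculus of \<open>T\<close>. The order is therefore tested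
  on diagonals, where convergence of the integrals against \<open>m x\<close> is available.\<close>

lemma trace_calc_SUP:
  assumes F: "\<And>n. F n \<in> borel_measurable borel" "\<And>n u. 0 \<le> F n u" "incseq F"
    and f: "f \<in> bdd_borel {0..K}" and lim: "\<And>u. (\<lambda>n. F n u) \<longlonglongrightarrow> f u"
  shows "\<tau> (calc f) = (SUP n. \<tau> (calc (F n)))"
proof -
  obtain C where C: "\<And>u. u \<in> {0..K} \<Longrightarrow> \<bar>f u\<bar> \<le> C" using f bdd_borel_bound by blast
  have Ff: "F n u \<le> f u" for n u
    using F(3) lim by (intro incseq_le) (auto simp: incseq_def le_fun_def)
  have f0: "0 \<le> f u" for u using F(2)[of 0 u] Ff[of 0 u] by linarith
  have Fb: "\<bar>F n u\<bar> \<le> C" if "u \<in> {0..K}" for n u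
    using C[OF that] Ff[of n u] F(2)[of n u] by linarith
  have F': "F n \<in> bdd_borel {0..K}" for n by (rule bdd_borelI[OF F(1) Fb])
  let ?D = "range (\<lambda>n. calc (F n))"
  have lub: "is_lub_op N ?D (calc f)"
    unfolding is_lub_op_def
  proof (intro conjI ballI impI)
    show "calc f \<in> pos_part N" by (rule calc_pos_part[OF f f0])
    show "B \<le>\<^sub>o\<^sub>p calc f" if "B \<in> ?D" for B
      using that calc_mono[OF F' f Ff] by auto
    fix C' assume C': "C' \<in> pos_part N" "\<forall>B\<in>?D. B \<le>\<^sub>o\<^sub>p C'"
    then have posC: "positive_op C'" by (simp add: pos_part_def)
    show "calc f \<le>\<^sub>o\<^sub>p C'"
      unfolding le_op_def
    proof (rule positive_opI)
      show "C' - calc f \<in> bounded_ops"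
        using posC calc_bounded_ops[OF f] by (intro bounded_ops_diff) (auto simp: positive_op_def)
      show "rinner (blinfun_apply (C' - calc f) x) y = rinner x (blinfun_apply (C' - calc f) y)" for x y
        by (simp add: blinfun.diff_left rinner.diff_left rinner.diff_right
            positive_op_symmetric[OF posC] calc_symmetric[OF f])
      fix x
      have "(\<integral>u. F n u \<partial>m x) \<le> rinner (blinfun_apply C' x) x" for n
      proof -
        have "positive_op (C' - calc (F n))" using C'(2) by (auto simp: le_op_def)
        from positive_op_nonneg[OF this, of x] show ?thesis
          by (simp add: blinfun.diff_left rinner.diff_left rinner_calc_diag[OF F'])
      qed
      moreover have "(\<lambda>n. \<integral>u. F n u \<partial>m x) \<longlonglongrightarrow> (\<integral>u. f u \<partial>m x)"
        by (rule bdd_functional_LIMSEQ[OF integral_functional F(1) bdd_borel_measurable[OF f] Fb lim])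
      ultimately have "(\<integral>u. f u \<partial>m x) \<le> rinner (blinfun_apply C' x) x"
        by (meson LIMSEQ_le_const2)
      then show "0 \<le> rinner (blinfun_apply (C' - calc f) x) x"
        by (simp add: blinfun.diff_left rinner.diff_left rinner_calc_diag[OF f])
    qed
  qed
  have sub: "?D \<subseteq> pos_part N" using calc_pos_part[OF F' F(2)] by auto
  have "\<exists>G\<in>?D. B \<le>\<^sub>o\<^sub>p G \<and> C \<le>\<^sub>o\<^sub>p G" if BC: "B \<in> ?D" "C \<in> ?D" for B C
  proof -
    obtain i j where ij: "B = calc (F i)" "C = calc (F j)" using BC by blast
    have "calc (F i) \<le>\<^sub>o\<^sub>p calc (F (max i j))" "calc (F j) \<le>\<^sub>o\<^sub>p calc (F (max i j))"
      using F(3) by (auto intro!: calc_mono[OF F' F'] simp: incseq_def le_fun_def)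
    then show ?thesis using ij by blast
  qed
  then have dir: "\<forall>B\<in>?D. \<forall>C\<in>?D. \<exists>G\<in>?D. B \<le>\<^sub>o\<^sub>p G \<and> C \<le>\<^sub>o\<^sub>p G" by (intro ballI)
  have "?D \<noteq> {} \<longrightarrow> ?D \<subseteq> pos_part N \<longrightarrow>
      (\<forall>B\<in>?D. \<forall>C\<in>?D. \<exists>G\<in>?D. B \<le>\<^sub>o\<^sub>p G \<and> C \<le>\<^sub>o\<^sub>p G) \<longrightarrow>
      is_lub_op N ?D (calc f) \<longrightarrow> \<tau> (calc f) = (SUP B\<in>?D. \<tau> B)"
    using normal unfolding normal_trace_def by (elim allE)
  from mp[OF mp[OF mp[OF mp[OF this] sub] dir] lub]
  have "\<tau> (calc f) = (SUP B\<in>?D. \<tau> B)" by simp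
  then show ?thesis by (simp add: image_image)
qed

definition trace_measure :: "real measure" where
  "trace_measure = measure_of UNIV (sets borel) (\<lambda>B. \<tau> (calc (indicator B)))"

lemma sets_trace_measure [simp, measurable_cong]: "sets trace_measure = sets borel"
  using sets.sigma_sets_eq[of "borel :: real measure"]
  by (simp add: trace_measure_def sets_measure_of_conv)

lemma space_trace_measure [simp]: "space trace_measure = UNIV"
  using sets_eq_imp_space_eq[OF sets_trace_measure] by simp

text \<open>Additivity of the trace handles finite disjoint unions, and normality handles the
  increasing limit of the partial unions.\<close>

lemma emeasure_trace_measure:
  assumes "B \<in> sets borel"
  shows "emeasure trace_measure B = \<tau> (calc (indicator B))"
  unfolding trace_measure_def
proof (rule emeasure_measure_of_sigma)
  show "sigma_algebra UNIV (sets (borel :: real measure))"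
    using sets.sigma_algebra_axioms[of "borel :: real measure"] by simp
  have "(indicator {} :: real \<Rightarrow> real) = (\<lambda>u. 0)" by (simp add: fun_eq_iff)
  then have "calc (indicator {}) = 0" using calc_zero by simp
  then show "positive (sets borel) (\<lambda>B. \<tau> (calc (indicator B)))"
    by (simp add: positive_def trace_zero)
  show "countably_additive (sets borel) (\<lambda>B. \<tau> (calc (indicator B)))"
    unfolding countably_additive_def
  proof (intro allI impI)
    fix F :: "nat \<Rightarrow> real set" assume F: "range F \<subseteq> sets borel" "disjoint_family F"
    then have Fn: "F n \<in> sets borel" for n by auto
    have dis: "(\<Sum>i<n. indicator (F i) u) = (indicator (\<Union>i<n. F i) u :: real)" for n u
      using F(2) by (intro indicator_UN_disjoint[symmetric]) (auto simp: disjoint_family_on_def)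
    have "(\<Sum>i<n. \<tau> (calc (indicator (F i)))) = \<tau> (calc (\<lambda>u. \<Sum>i<n. indicator (F i) u))" for n
    proof (induction n)
      case (Suc n)
      have "\<tau> (calc (\<lambda>u. (\<Sum>i<n. indicator (F i) u) + indicator (F n) u))
          = \<tau> (calc (\<lambda>u. \<Sum>i<n. indicator (F i) u)) + \<tau> (calc (indicator (F n)))"
        by (rule trace_calc_add) (auto intro!: bdd_borel_sum bdd_borel_indicator Fn sum_nonneg)
      then show ?case using Suc by simp
    qed (simp add: calc_zero trace_zero)
    then have "(\<Sum>i. \<tau> (calc (indicator (F i)))) = (SUP n. \<tau> (calc (indicator (\<Union>i<n. F i))))"
      by (simp add: suminf_eq_SUP dis)
    also have "\<dots> = \<tau> (calc (indicator (\<Union>i. F i)))"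
    proof (rule trace_calc_SUP[symmetric])
      show "indicator (\<Union>i<n. F i) \<in> borel_measurable borel" for n using Fn by measurable
      show "incseq (\<lambda>n. indicator (\<Union>i<n. F i) :: real \<Rightarrow> real)"
        by (force simp: incseq_def le_fun_def indicator_def)
      show "indicator (\<Union>i. F i) \<in> bdd_borel {0..K}" using Fn by (intro bdd_borel_indicator) auto
      show "(\<lambda>n. indicator (\<Union>i<n. F i) u) \<longlonglongrightarrow> (indicator (\<Union>i. F i) u :: real)" for u
        by (rule LIMSEQ_indicator_UN)
    qed simp
    finally show "(\<Sum>i. \<tau> (calc (indicator (F i)))) = \<tau> (calc (indicator (\<Union> (range F))))" .
  qed
qed (use assms in auto)

lemma trace_measure_support: "AE u in trace_measure. u \<in> {0..K}"
proof -
  have "calc (indicator (- {0..K})) = calc (\<lambda>u. 0)"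
    by (rule calc_cong) (auto intro!: bdd_borel_indicator bdd_borel_const)
  then have "emeasure trace_measure (- {0..K}) = 0"
    by (subst emeasure_trace_measure) (auto simp: calc_zero trace_zero)
  then have "- {0..K} \<in> null_sets trace_measure" by (intro null_setsI) auto
  then show ?thesis by (rule AE_I') auto
qed

text \<open>Monotone class induction, with boundedness on {0..K} carried along because
  \<open>calc\<close> is under control for such functions. Normality on one side matches monotone
  convergence on the other.\<close>

lemma trace_calc:
  assumes "f \<in> borel_measurable borel" "\<And>u. 0 \<le> f u" "f \<in> bdd_borel {0..K}"
  shows "\<tau> (calc f) = (\<integral>\<^sup>+u. ennreal (f u) \<partial>trace_measure)"
proof -
  have "f \<in> bdd_borel {0..K} \<longrightarrow> \<tau> (calc f) = (\<integral>\<^sup>+u. ennreal (f u) \<partial>trace_measure)"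
    using assms(1,2)
  proof (induction rule: borel_measurable_induct_real)
    case (set A)
    then show ?case by (simp add: emeasure_trace_measure ennreal_indicator)
  next
    case (mult u c)
    show ?case
    proof (cases "c = 0")
      case True
      then show ?thesis by (simp add: calc_zero trace_zero)
    next
      case False
      have "u \<in> bdd_borel {0..K}" if "(\<lambda>x. c * u x) \<in> bdd_borel {0..K}"
      proof -
        have "(\<lambda>x. inverse c * (c * u x)) = u" using False by (auto simp: fun_eq_iff)
        then show ?thesis using bdd_borel_mult[OF bdd_borel_const[of "inverse c"] that] by simp
      qed
      then show ?thesis
        using mult by (simp add: trace_calc_cmult ennreal_mult nn_integral_cmult)
    qed
  next
    case (add u v)
    show ?case
    proof
      assume uv: "(\<lambda>x. v x + u x) \<in> bdd_borel {0..K}"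
      obtain C where C: "\<And>x. x \<in> {0..K} \<Longrightarrow> \<bar>v x + u x\<bar> \<le> C" using bdd_borel_bound[OF uv] by blast
      have "\<bar>v x\<bar> \<le> C" "\<bar>u x\<bar> \<le> C" if "x \<in> {0..K}" for x
        using C[OF that] add.hyps(2)[of x] add.hyps(4)[of x] by linarith+
      then have "u \<in> bdd_borel {0..K}" "v \<in> bdd_borel {0..K}"
        using add.hyps by (auto intro!: bdd_borelI[where C=C])
      then show "\<tau> (calc (\<lambda>x. v x + u x)) = (\<integral>\<^sup>+x. ennreal (v x + u x) \<partial>trace_measure)"
        using add by (simp add: trace_calc_add nn_integral_add)
    qed
  next
    case (seq U)
    show ?case
    proof
      assume f: "f \<in> bdd_borel {0..K}"
      obtain C where C: "\<And>u. u \<in> {0..K} \<Longrightarrow> \<bar>f u\<bar> \<le> C" using f bdd_borel_bound by blast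
      have "U i x \<le> f x" for i x
        using seq.hyps by (intro incseq_le) (auto simp: incseq_def le_fun_def)
      then have "\<bar>U i x\<bar> \<le> C" if "x \<in> {0..K}" for i x
        using C[OF that] seq.hyps(2)[of i x] by (smt (verit))
      then have U': "U i \<in> bdd_borel {0..K}" for i using seq.hyps(1) by (intro bdd_borelI)
      have "(\<lambda>i. \<integral>\<^sup>+u. ennreal (U i u) \<partial>trace_measure) \<longlonglongrightarrow> (\<integral>\<^sup>+u. ennreal (f u) \<partial>trace_measure)"
        using seq.hyps by (intro nn_integral_LIMSEQ)
          (auto simp: incseq_def le_fun_def intro!: tendsto_ennrealI ennreal_leI)
      moreover have "(\<lambda>i. \<tau> (calc (U i))) \<longlonglongrightarrow> (SUP i. \<tau> (calc (U i)))"
      proof (rule LIMSEQ_SUP)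
        have "\<tau> (calc (U i)) = (\<integral>\<^sup>+u. ennreal (U i u) \<partial>trace_measure)" for i using seq.IH U' by blast
        moreover have "U i x \<le> U j x" if "i \<le> j" for i j x
          using incseqD[OF seq.hyps(3) that] by (rule le_funD)
        ultimately show "incseq (\<lambda>i. \<tau> (calc (U i)))"
          unfolding incseq_def by (simp add: nn_integral_mono ennreal_leI)
      qed
      moreover have "\<tau> (calc (U i)) = (\<integral>\<^sup>+u. ennreal (U i u) \<partial>trace_measure)" for i using seq.IH U' by blast
      moreover have "\<tau> (calc f) = (SUP n. \<tau> (calc (U n)))"
        by (rule trace_calc_SUP) (use seq.hyps f in auto)
      ultimately show "\<tau> (calc f) = (\<integral>\<^sup>+u. ennreal (f u) \<partial>trace_measure)"
        using LIMSEQ_unique by simp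
    qed
  qed
  then show ?thesis using assms(3) by blast
qed

lemma trace_powr_op:
  assumes "0 < s" shows "\<tau> (powr_op T s) = (\<integral>\<^sup>+u. ennreal (u powr s) \<partial>trace_measure)"
  unfolding powr_op_T[OF assms]
  by (rule trace_calc) (use bdd_borel_powr[OF assms] in auto)

lemma sing_val_calc_measure:
  assumes h: "h \<in> bdd_borel {0..K}" and pos: "\<And>u. u \<in> {0..K} \<Longrightarrow> 0 \<le> h u"
  shows "sing_val \<tau> t (calc h) = Inf {s. 0 \<le> s \<and> emeasure (distr trace_measure borel h) {s<..} \<le> ennreal t}"
proof -
  note [measurable] = bdd_borel_measurable[OF h]
  have "emeasure (distr trace_measure borel h) {s<..} = \<tau> (calc (indicator {u. s < h u}))" for s
    by (subst emeasure_distr) (auto simp: vimage_def emeasure_trace_measure)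
  moreover have "sing_val \<tau> t (calc h) = Inf {s. 0 \<le> s \<and> \<tau> (calc (indicator {u. s < h u})) \<le> ennreal t}"
    using h pos by (rule sing_val_calc)
  ultimately show ?thesis by simp
qed

end


section \<open>Decreasing rearrangements\<close>

text \<open>Fubini for the region 0 < x < f y under the graph.\<close>

lemma nn_integral_layer_cake:
  assumes "sigma_finite_measure M" and f[measurable]: "f \<in> borel_measurable M" and "\<And>y. 0 \<le> f y"
  shows "(\<integral>\<^sup>+y. ennreal (f y) \<partial>M)
    = (\<integral>\<^sup>+x. indicator {0<..} x * emeasure M {y\<in>space M. x < f y} \<partial>lborel)"
proof -
  interpret sigma_finite_measure M by fact
  interpret pair_sigma_finite lborel M by unfold_locales
  define e where "e x y = (if 0 < x \<and> x < f y then 1 else 0 :: ennreal)" for x y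
  have "ennreal (f y) = (\<integral>\<^sup>+x. e x y \<partial>lborel)" for y
  proof -
    have "(\<integral>\<^sup>+x. e x y \<partial>lborel) = (\<integral>\<^sup>+x. indicator {0<..<f y} x \<partial>lborel)"
      by (intro nn_integral_cong) (auto simp: indicator_def e_def)
    then show ?thesis using assms(3)[of y] by simp
  qed
  then have "(\<integral>\<^sup>+y. ennreal (f y) \<partial>M) = (\<integral>\<^sup>+y. \<integral>\<^sup>+x. e x y \<partial>lborel \<partial>M)"
    by simp
  also have "\<dots> = (\<integral>\<^sup>+x. \<integral>\<^sup>+y. e x y \<partial>M \<partial>lborel)"
    by (rule Fubini') (unfold e_def, measurable)
  also have "\<dots> = (\<integral>\<^sup>+x. indicator {0<..} x * emeasure M {y\<in>space M. x < f y} \<partial>lborel)"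
  proof (intro nn_integral_cong)
    fix x :: real
    have "(\<integral>\<^sup>+y. e x y \<partial>M) = (\<integral>\<^sup>+y. indicator {0<..} x * indicator {y\<in>space M. x < f y} y \<partial>M)"
      by (intro nn_integral_cong) (auto simp: indicator_def e_def)
    then show "(\<integral>\<^sup>+y. e x y \<partial>M) = indicator {0<..} x * emeasure M {y\<in>space M. x < f y}"
      by (simp add: nn_integral_cmult)
  qed
  finally show ?thesis .
qed

text \<open>Here \<open>\<rho>\<close> plays the distribution of a positive operator under the
  trace; \<open>dist_fun\<close> is then its distribution function, possibly infinite, and
  \<open>mu\<close> its singular value function.\<close>

locale rearrangement =
  fixes \<rho> :: "real measure" and K :: real
  assumes sets_rho [simp, measurable_cong]: "sets \<rho> = sets borel"
    and support: "AE u in \<rho>. u \<in> {0..K}" and K: "0 \<le> K"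
begin

lemma space_rho [simp]: "space \<rho> = UNIV"
  using sets_eq_imp_space_eq[OF sets_rho] by simp

definition dist_fun :: "real \<Rightarrow> ennreal" where
  "dist_fun x = emeasure \<rho> {x<..}"

definition mu :: "real \<Rightarrow> real" where
  "mu t = Inf {s. 0 \<le> s \<and> dist_fun s \<le> ennreal t}"

lemma dist_fun_antimono: "x \<le> y \<Longrightarrow> dist_fun y \<le> dist_fun x"
  unfolding dist_fun_def by (intro emeasure_mono) auto

lemma dist_fun_K: "dist_fun K = 0"
proof -
  have "AE u in \<rho>. u \<notin> {K<..}" using support by (rule eventually_mono) auto
  then show ?thesis unfolding dist_fun_def by (subst (asm) AE_iff_measurable[of "{K<..}"]) auto
qed

lemma K_in: "K \<in> {s. 0 \<le> s \<and> dist_fun s \<le> ennreal t}"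
  by (simp add: K dist_fun_K)

lemma mu_le: "0 \<le> s \<Longrightarrow> dist_fun s \<le> ennreal t \<Longrightarrow> mu t \<le> s"
  unfolding mu_def by (rule cInf_lower) (auto intro: bdd_belowI[of _ 0])

lemma mu_nonneg: "0 \<le> mu t"
  unfolding mu_def using K_in by (intro cInf_greatest) auto

lemma mu_le_K: "mu t \<le> K"
  using mu_le K_in by auto

text \<open>The distribution function is continuous from the right, so a strict inequality at
  \<open>x\<close> persists at x + 1/(n+1) for some n, which keeps the infimum away from
  \<open>x\<close>.\<close>

lemma less_mu_iff:
  assumes "0 \<le> x" shows "x < mu t \<longleftrightarrow> ennreal t < dist_fun x"
proof
  assume "x < mu t"
  then show "ennreal t < dist_fun x" using mu_le[OF assms, of t] by (meson not_le)
next
  assume t: "ennreal t < dist_fun x"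
  have "(\<lambda>n. dist_fun (x + 1 / Suc n)) \<longlonglongrightarrow> dist_fun x"
  proof -
    have "(\<Union>n. {x + 1 / Suc n<..}) = {x<..}"
    proof (intro equalityI subsetI)
      fix y assume "y \<in> {x<..}"
      then obtain n where "inverse (real (Suc n)) < y - x" using reals_Archimedean[of "y - x"] by auto
      then show "y \<in> (\<Union>n. {x + 1 / Suc n<..})" by (auto simp: field_simps intro!: exI[of _ n])
    next
      fix y assume "y \<in> (\<Union>n. {x + 1 / Suc n<..})"
      then obtain n where "x + 1 / Suc n < y" by auto
      moreover have "0 < 1 / real (Suc n)" by simp
      ultimately show "y \<in> {x<..}" unfolding greaterThan_iff by linarith
    qed
    moreover have "(\<lambda>n. emeasure \<rho> {x + 1 / Suc n<..}) \<longlonglongrightarrow> emeasure \<rho> (\<Union>n. {x + 1 / Suc n<..})"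
    proof (rule Lim_emeasure_incseq)
      show "incseq (\<lambda>n. {x + 1 / Suc n<..})"
      proof (rule incseq_SucI)
        fix n
        have "1 / real (Suc (Suc n)) \<le> 1 / real (Suc n)" by (intro divide_left_mono) auto
        then show "{x + 1 / Suc n<..} \<subseteq> {x + 1 / Suc (Suc n)<..}" by auto
      qed
    qed auto
    ultimately show ?thesis by (simp add: dist_fun_def)
  qed
  from order_tendstoD(1)[OF this t] obtain n where n: "ennreal t < dist_fun (x + 1 / Suc n)"
    by (auto simp: eventually_sequentially)
  have "x < x + 1 / Suc n" by simp
  also have "\<dots> \<le> mu t"
    unfolding mu_def
  proof (rule cInf_greatest)
    fix s assume s: "s \<in> {s. 0 \<le> s \<and> dist_fun s \<le> ennreal t}"
    show "x + 1 / Suc n \<le> s"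
    proof (rule ccontr)
      assume "\<not> x + 1 / Suc n \<le> s"
      then have "dist_fun (x + 1 / Suc n) \<le> dist_fun s" by (intro dist_fun_antimono) simp
      with n s show False by auto
    qed
  qed (use K_in in blast)
  finally show "x < mu t" .
qed

lemma mu_antimono: "s \<le> t \<Longrightarrow> mu t \<le> mu s"
proof -
  assume "s \<le> t"
  then have "\<not> mu s < mu t"
    using less_mu_iff[OF mu_nonneg, of s t] less_mu_iff[OF mu_nonneg, of s s] ennreal_leI[of s t]
    by (meson leD less_irrefl less_le_trans not_less order_le_less_trans)
  then show ?thesis by simp
qed

lemma mu_measurable [measurable]: "mu \<in> borel_measurable borel"
proof -
  have "(\<lambda>t. - mu t) \<in> borel_measurable borel"
    by (rule borel_measurable_mono) (auto simp: mono_def mu_antimono)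
  then show ?thesis using borel_measurable_uminus_eq by blast
qed

definition mu_int :: "real \<Rightarrow> real" where
  "mu_int t = (LINT s:{0..t}|lborel. mu s)"

lemma mu_set_integrable: "set_integrable lborel {0..t} mu"
proof -
  have "integrable lborel (\<lambda>s. indicator {0..t} s *\<^sub>R K)"
    by (simp add: integrable_indicator_iff emeasure_lborel_Icc_eq)
  then show ?thesis
    unfolding set_integrable_def
    by (rule Bochner_Integration.integrable_bound)
      (use mu_nonneg mu_le_K K in \<open>auto simp: indicator_def\<close>)
qed

lemma mu_int_nn: "ennreal (mu_int t) = (\<integral>\<^sup>+s. indicator {0..t} s * ennreal (mu s) \<partial>lborel)"
  unfolding mu_int_def set_lebesgue_integral_def
  using mu_set_integrable[of t, unfolded set_integrable_def] mu_nonneg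
  by (subst nn_integral_eq_integral[symmetric])
    (auto simp: ennreal_mult ennreal_indicator mu_nonneg intro!: nn_integral_cong split: split_indicator)

lemma mu_int_nonneg: "0 \<le> mu_int t"
  unfolding mu_int_def set_lebesgue_integral_def using mu_nonneg
  by (intro integral_nonneg_AE) auto

lemma mu_int_mono: "s \<le> t \<Longrightarrow> mu_int s \<le> mu_int t"
proof -
  assume "s \<le> t"
  then have "ennreal (mu_int s) \<le> ennreal (mu_int t)"
    unfolding mu_int_nn by (intro nn_integral_mono) (auto split: split_indicator)
  then show ?thesis by (simp add: mu_int_nonneg)
qed

lemma mu_int_ge: "0 \<le> t \<Longrightarrow> t * mu t \<le> mu_int t"
proof -
  assume t: "0 \<le> t"
  have "ennreal (t * mu t) = (\<integral>\<^sup>+s. indicator {0..t} s * ennreal (mu t) \<partial>lborel)"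
    using t mu_nonneg by (simp add: nn_integral_multc ennreal_mult)
  also have "\<dots> \<le> ennreal (mu_int t)"
    unfolding mu_int_nn by (intro nn_integral_mono) (auto split: split_indicator intro: ennreal_leI mu_antimono)
  finally show ?thesis by (simp add: mu_int_nonneg)
qed

text \<open>By \<open>less_mu_iff\<close> the set of s in {0..t} with x < mu s is an interval of
  length min(t, dist_fun x); layer cake integration then removes \<open>mu\<close> from the
  formula.\<close>

lemma mu_int_layer:
  assumes t: "0 \<le> t"
  shows "ennreal (mu_int t) = (\<integral>\<^sup>+x. indicator {0<..} x * min (ennreal t) (dist_fun x) \<partial>lborel)"
proof -
  let ?f = "\<lambda>s. indicator {0..t} s * mu s"
  have "ennreal (mu_int t) = (\<integral>\<^sup>+s. ennreal (?f s) \<partial>lborel)"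
    unfolding mu_int_nn by (intro nn_integral_cong) (auto split: split_indicator)
  also have "\<dots> = (\<integral>\<^sup>+x. indicator {0<..} x * emeasure lborel {s\<in>space lborel. x < ?f s} \<partial>lborel)"
    by (rule nn_integral_layer_cake) (auto simp: mu_nonneg intro: lborel.sigma_finite_measure_axioms)
  also have "\<dots> = (\<integral>\<^sup>+x. indicator {0<..} x * min (ennreal t) (dist_fun x) \<partial>lborel)"
  proof (intro nn_integral_cong)
    fix x :: real
    show "indicator {0<..} x * emeasure lborel {s\<in>space lborel. x < ?f s}
        = indicator {0<..} x * min (ennreal t) (dist_fun x)"
    proof (cases "0 < x")
      case True
      have set: "{s\<in>space lborel. x < ?f s} = {s. 0 \<le> s \<and> s \<le> t \<and> ennreal s < dist_fun x}"
        using True less_mu_iff[of x] by (auto simp: indicator_def)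
      have "emeasure lborel {s. 0 \<le> s \<and> s \<le> t \<and> ennreal s < dist_fun x} = min (ennreal t) (dist_fun x)"
      proof (cases "ennreal t < dist_fun x")
        case True
        have "ennreal s < dist_fun x" if "s \<le> t" for s
          using ennreal_leI[OF that] True by simp
        then have "{s. 0 \<le> s \<and> s \<le> t \<and> ennreal s < dist_fun x} = {0..t}"
          by auto
        then show ?thesis using True t by simp
      next
        case False
        then obtain a where a: "0 \<le> a" "dist_fun x = ennreal a"
          by (metis ennreal_cases ennreal_less_top not_le top.extremum_unique)
        have "a \<le> t" using False a t by (simp add: ennreal_less_iff)
        then have "{s. 0 \<le> s \<and> s \<le> t \<and> ennreal s < dist_fun x} = {0..<a}"
          using a by (auto simp: ennreal_less_iff)
        then show ?thesis using a False \<open>a \<le> t\<close> by (simp add: min_def)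
      qed
      then show ?thesis by (simp only: set)
    qed simp
  qed
  finally show ?thesis .
qed

text \<open>For the distribution of an operator S this is \<tau>(S E(c, \<infinity>)), the trace of
  the part of S above height \<open>c\<close>.\<close>

definition big_int :: "real \<Rightarrow> ennreal" where
  "big_int c = (\<integral>\<^sup>+u. indicator {c<..} u * ennreal u \<partial>\<rho>)"

text \<open>Restricting \<open>\<rho>\<close> to the values above \<open>c\<close> yields a finite
  measure, which makes Fubini applicable although \<open>\<rho>\<close> itself may have infinite
  mass near 0.\<close>

lemma big_int_layer:
  assumes c: "0 < c" and fin: "dist_fun c < \<infinity>"
  shows "big_int c = (\<integral>\<^sup>+x. indicator {0<..} x * min (dist_fun x) (dist_fun c) \<partial>lborel)"
proof -
  let ?M = "density \<rho> (indicator {c<..})"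
  have em: "emeasure ?M A = emeasure \<rho> ({c<..} \<inter> A)" if "A \<in> sets borel" for A
    using that by (subst emeasure_density) (auto simp: indicator_inter_arith[symmetric])
  have "finite_measure ?M"
    using fin by (intro finite_measureI) (simp add: em dist_fun_def)
  then have sf: "sigma_finite_measure ?M" by (rule finite_measure.axioms)
  have "big_int c = (\<integral>\<^sup>+u. ennreal (max 0 u) \<partial>?M)"
    unfolding big_int_def using c
    by (subst nn_integral_density) (auto intro!: nn_integral_cong split: split_indicator simp: max_def)
  also have "\<dots> = (\<integral>\<^sup>+x. indicator {0<..} x * emeasure ?M {y\<in>space ?M. x < max 0 y} \<partial>lborel)"
    by (rule nn_integral_layer_cake[OF sf]) auto
  also have "\<dots> = (\<integral>\<^sup>+x. indicator {0<..} x * min (dist_fun x) (dist_fun c) \<partial>lborel)"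
  proof (intro nn_integral_cong)
    fix x :: real
    show "indicator {0<..} x * emeasure ?M {y\<in>space ?M. x < max 0 y}
        = indicator {0<..} x * min (dist_fun x) (dist_fun c)"
    proof (cases "0 < x")
      case True
      then have "{y. x < max 0 y} = {x<..}" by auto
      then have "emeasure ?M {y\<in>space ?M. x < max 0 y} = emeasure \<rho> ({c<..} \<inter> {x<..})"
        by (simp add: em)
      also have "{c<..} \<inter> {x<..} = {max x c<..}" by auto
      also have "emeasure \<rho> {max x c<..} = min (dist_fun x) (dist_fun c)"
        using dist_fun_antimono[of x c] dist_fun_antimono[of c x]
        by (auto simp: max_def min_def dist_fun_def)
      finally show ?thesis by simp
    qed simp
  qed
  finally show ?thesis .
qed

lemma dist_fun_measurable [measurable]: "dist_fun \<in> borel_measurable borel"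
proof (rule borel_measurableI_greater)
  fix a
  have borel: "B \<in> sets borel" if "is_interval B" for B :: "real set"
    using is_real_interval[OF that] by auto
  have "is_interval {x. a < dist_fun x}"
    unfolding is_interval_1 using dist_fun_antimono by (auto intro: less_le_trans)
  then have "{x. a < dist_fun x} \<in> sets borel" by (rule borel)
  then show "{x \<in> space borel. a < dist_fun x} \<in> sets borel" by simp
qed

text \<open>Layers above height 1/t are dominated by those of the cut-off operator; those below have
  thickness at most \<open>t\<close> each and contribute at most t (1/t) = 1.\<close>

lemma mu_int_le_big_int:
  assumes "0 < t" "dist_fun (1 / t) < \<infinity>"
  shows "ennreal (mu_int t) \<le> big_int (1 / t) + 1"
proof -
  have "ennreal (mu_int t) = (\<integral>\<^sup>+x. indicator {0<..} x * min (ennreal t) (dist_fun x) \<partial>lborel)"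
    using assms by (intro mu_int_layer) auto
  also have "\<dots> \<le> (\<integral>\<^sup>+x. indicator {0<..} x * min (dist_fun x) (dist_fun (1 / t))
      + ennreal t * indicator {0..1 / t} x \<partial>lborel)"
  proof (intro nn_integral_mono)
    fix x :: real
    show "indicator {0<..} x * min (ennreal t) (dist_fun x)
      \<le> indicator {0<..} x * min (dist_fun x) (dist_fun (1 / t)) + ennreal t * indicator {0..1 / t} x"
    proof (cases "x \<le> 1 / t")
      case True
      then show ?thesis by (auto split: split_indicator simp: min.coboundedI1 add_increasing)
    next
      case False
      then have "dist_fun x \<le> dist_fun (1 / t)" by (intro dist_fun_antimono) simp
      then show ?thesis using False by (auto split: split_indicator simp: min_def)
    qed
  qed
  also have "\<dots> = big_int (1 / t) + ennreal t * ennreal (1 / t)"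
    using assms by (subst nn_integral_add) (auto simp: big_int_layer nn_integral_cmult)
  also have "ennreal t * ennreal (1 / t) = 1"
    using assms by (simp flip: ennreal_mult)
  finally show ?thesis .
qed

text \<open>The layers compare directly once \<open>t\<close> dominates the distribution function at
  \<open>c\<close>. This side condition replaces the relation c = 1/t of the opposite bound and is
  where an exponent \<alpha> > 1 will enter.\<close>

lemma big_int_le_mu_int:
  assumes "0 < c" "dist_fun c \<le> ennreal t" "0 \<le> t"
  shows "big_int c \<le> ennreal (mu_int t)"
proof -
  have "dist_fun c < \<infinity>" using assms(2) by (simp add: order_le_less_trans)
  then have "big_int c = (\<integral>\<^sup>+x. indicator {0<..} x * min (dist_fun x) (dist_fun c) \<partial>lborel)"
    using assms by (intro big_int_layer) auto
  also have "\<dots> \<le> (\<integral>\<^sup>+x. indicator {0<..} x * min (ennreal t) (dist_fun x) \<partial>lborel)"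
    using assms(2) by (intro nn_integral_mono mult_left_mono) (auto intro: min.coboundedI1 min.coboundedI2)
  finally show ?thesis using assms by (simp add: mu_int_layer)
qed

end


section \<open>Laplace transforms of measures\<close>

locale laplace_measure =
  fixes \<kappa> :: "real measure"
  assumes sets_kappa [simp, measurable_cong]: "sets \<kappa> = sets borel"
    and nonneg_support: "AE t in \<kappa>. 0 \<le> t"
    and locally_finite: "\<And>y. emeasure \<kappa> {..<y} < \<infinity>"
begin

lemma space_kappa [simp]: "space \<kappa> = UNIV"
  using sets_eq_imp_space_eq[OF sets_kappa] by simp

text \<open>Under t = -log u the open ray below \<open>y\<close> corresponds to u > exp(-y), the
  half-line used in \<open>big_int\<close>.\<close>

definition cumul :: "real \<Rightarrow> real" where "cumul y = measure \<kappa> {..<y}"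

definition laplace :: "real \<Rightarrow> ennreal" where
  "laplace r = (\<integral>\<^sup>+t. ennreal (exp (- t / r)) \<partial>\<kappa>)"

lemma cumul_nonneg: "0 \<le> cumul y" by (simp add: cumul_def)

lemma emeasure_cumul: "emeasure \<kappa> {..<y} = ennreal (cumul y)"
  unfolding cumul_def using locally_finite[of y] by (intro emeasure_eq_ennreal_measure) auto

lemma cumul_mono: "x \<le> y \<Longrightarrow> cumul x \<le> cumul y"
  unfolding cumul_def using locally_finite[of y]
  by (intro measure_mono_fmeasurable) (auto simp: fmeasurable_def)

lemma sigma_finite_kappa: "sigma_finite_measure \<kappa>"
proof
  have "(\<Union>n. {..<real n}) = UNIV" using reals_Archimedean2 by auto
  then show "\<exists>A. countable A \<and> A \<subseteq> sets \<kappa> \<and> \<Union> A = space \<kappa> \<and> (\<forall>a\<in>A. emeasure \<kappa> a \<noteq> \<infinity>)"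
    using locally_finite by (intro exI[of _ "range (\<lambda>n. {..<real n})"]) (auto simp: less_top)
qed

lemma cumul_measurable [measurable]: "cumul \<in> borel_measurable borel"
  by (rule borel_measurable_mono) (auto simp: mono_def cumul_mono)

lemma laplace_measurable [measurable]: "laplace \<in> borel_measurable borel"
proof -
  interpret sigma_finite_measure \<kappa> by (rule sigma_finite_kappa)
  show ?thesis unfolding laplace_def[abs_def] by measurable
qed

text \<open>For t < r the weight exp(1 - t/r) is at least 1.\<close>

lemma cumul_le_laplace:
  assumes "0 < r" shows "ennreal (cumul r) \<le> ennreal (exp 1) * laplace r"
proof -
  have "ennreal (cumul r) = (\<integral>\<^sup>+t. indicator {..<r} t \<partial>\<kappa>)"
    by (simp add: emeasure_cumul)
  also have "\<dots> \<le> (\<integral>\<^sup>+t. ennreal (exp 1) * ennreal (exp (- t / r)) \<partial>\<kappa>)"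
  proof (intro nn_integral_mono)
    fix t show "indicator {..<r} t \<le> ennreal (exp 1) * ennreal (exp (- t / r))"
      using assms by (auto simp: indicator_def field_simps simp flip: ennreal_mult exp_add)
  qed
  also have "\<dots> = ennreal (exp 1) * laplace r"
    unfolding laplace_def by (rule nn_integral_cmult) simp
  finally show ?thesis .
qed

text \<open>Integration by parts, done as Fubini: exp(-t/r) is the integral of exp(-y/r)/r over y >
  t.\<close>

lemma laplace_eq:
  assumes r: "0 < r"
  shows "laplace r = (\<integral>\<^sup>+y. indicator {0..} y * (ennreal (exp (- y / r) / r) * ennreal (cumul y)) \<partial>lborel)"
proof -
  interpret sigma_finite_measure \<kappa> by (rule sigma_finite_kappa)
  interpret pair_sigma_finite lborel \<kappa> by unfold_locales
  define e where "e y t = (if t < y \<and> 0 \<le> y then ennreal (exp (- y / r) / r) else 0)" for y t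
  have "ennreal (exp (- t / r)) = (\<integral>\<^sup>+y. e y t \<partial>lborel)" if "0 \<le> t" for t
  proof -
    have "(\<integral>\<^sup>+y. e y t \<partial>lborel) = (\<integral>\<^sup>+y. ennreal (exp (- y / r) / r) * indicator {t..} y \<partial>lborel)"
    proof (rule nn_integral_cong_AE)
      \<comment> \<open>The open ray of \<open>cumul\<close> yields t < y, whereas the integral
        below runs over t <= y; the two differ in one point.\<close>
      have "AE y in lborel. y \<noteq> t" by (rule AE_lborel_singleton)
      then show "AE y in lborel. e y t = ennreal (exp (- y / r) / r) * indicator {t..} y"
        by (rule eventually_mono) (use that in \<open>auto simp: e_def indicator_def\<close>)
    qed
    also have "\<dots> = ennreal (0 - (- exp (- t / r)))"
    proof (rule nn_integral_FTC_atLeast)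
      show "((\<lambda>y. - exp (- y / r)) \<longlongrightarrow> 0) at_top" using r by real_asymp
    qed (use r in \<open>auto intro!: derivative_eq_intros simp: field_simps\<close>)
    finally show ?thesis by simp
  qed
  then have "laplace r = (\<integral>\<^sup>+t. \<integral>\<^sup>+y. e y t \<partial>lborel \<partial>\<kappa>)"
    unfolding laplace_def by (intro nn_integral_cong_AE eventually_mono[OF nonneg_support])
  also have "\<dots> = (\<integral>\<^sup>+y. \<integral>\<^sup>+t. e y t \<partial>\<kappa> \<partial>lborel)"
    by (rule Fubini') (unfold e_def, measurable)
  also have "\<dots> = (\<integral>\<^sup>+y. indicator {0..} y * (ennreal (exp (- y / r) / r) * ennreal (cumul y)) \<partial>lborel)"
  proof (intro nn_integral_cong)
    fix y
    have "(\<integral>\<^sup>+t. e y t \<partial>\<kappa>) = (\<integral>\<^sup>+t. indicator {0..} y * ennreal (exp (- y / r) / r) * indicator {..<y} t \<partial>\<kappa>)"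
      by (intro nn_integral_cong) (auto simp: e_def indicator_def)
    then show "(\<integral>\<^sup>+t. e y t \<partial>\<kappa>) = indicator {0..} y * (ennreal (exp (- y / r) / r) * ennreal (cumul y))"
      by (simp add: nn_integral_cmult emeasure_cumul mult.assoc)
  qed
  finally show ?thesis .
qed

lemma nn_integral_exp_affine:
  assumes r: "0 < r" and "0 \<le> A" "0 \<le> C"
  shows "(\<integral>\<^sup>+y. indicator {0..} y * (ennreal (exp (- y / r) / r) * ennreal (A * y + C)) \<partial>lborel)
    = ennreal (A * r + C)"
proof -
  have "(\<integral>\<^sup>+y. indicator {0..} y * (ennreal (exp (- y / r) / r) * ennreal (A * y + C)) \<partial>lborel)
      = (\<integral>\<^sup>+y. ennreal (exp (- y / r) / r * (A * y + C)) * indicator {0..} y \<partial>lborel)"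
  proof (intro nn_integral_cong)
    fix y
    have "ennreal (exp (- y / r) / r) * ennreal (A * y + C) = ennreal (exp (- y / r) / r * (A * y + C))"
      if "0 \<le> y" using assms that by (intro ennreal_mult[symmetric]) auto
    then show "indicator {0..} y * (ennreal (exp (- y / r) / r) * ennreal (A * y + C))
        = ennreal (exp (- y / r) / r * (A * y + C)) * indicator {0..} y"
      by (auto simp only: split: split_indicator) auto
  qed
  also have "\<dots> = ennreal (0 - (- (A * 0 + A * r + C) * exp (- 0 / r)))"
  proof (rule nn_integral_FTC_atLeast)
    show "((\<lambda>y. - (A * y + A * r + C) * exp (- y / r)) \<longlongrightarrow> 0) at_top"
      using r by real_asymp
    show "((\<lambda>y. - (A * y + A * r + C) * exp (- y / r)) has_real_derivative
       exp (- y / r) / r * (A * y + C)) (at y)" for y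
      using r by (auto intro!: derivative_eq_intros simp: field_simps)
  qed (use assms in auto)
  finally show ?thesis by (simp add: add.commute)
qed

lemma laplace_le:
  assumes "0 < r" "0 \<le> A" "0 \<le> C" and le: "\<And>y. 0 \<le> y \<Longrightarrow> cumul y \<le> A * y + C"
  shows "laplace r \<le> ennreal (A * r + C)"
  unfolding laplace_eq[OF assms(1)] nn_integral_exp_affine[OF assms(1-3), symmetric]
  by (intro nn_integral_mono) (auto simp: indicator_def intro!: mult_left_mono ennreal_leI le)

text \<open>The error constant is added on the right because subtraction of extended nonnegative
  reals truncates at 0.\<close>

lemma laplace_ge:
  assumes r: "0 < r" "0 \<le> A" "0 \<le> C" and le: "\<And>y. 0 \<le> y \<Longrightarrow> A * y \<le> cumul y + C"
  shows "ennreal (A * r) \<le> laplace r + ennreal C"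
proof -
  let ?w = "\<lambda>y. ennreal (exp (- y / r) / r)"
  have "ennreal (A * r) = (\<integral>\<^sup>+y. indicator {0..} y * (?w y * ennreal (A * y + 0)) \<partial>lborel)"
    using nn_integral_exp_affine[of r A 0] assms by simp
  also have "\<dots> \<le> (\<integral>\<^sup>+y. indicator {0..} y * (?w y * ennreal (cumul y))
      + indicator {0..} y * (?w y * ennreal (0 * y + C)) \<partial>lborel)"
    using le assms(3) cumul_nonneg
    by (intro nn_integral_mono)
       (auto simp: indicator_def simp flip: distrib_left ennreal_plus intro!: mult_left_mono ennreal_leI)
  also have "\<dots> = laplace r + ennreal (0 * r + C)"
    using assms by (subst nn_integral_add) (auto simp: laplace_eq[OF r(1)] nn_integral_exp_affine[OF r(1), of 0, simplified])
  finally show ?thesis by simp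
qed

end

text \<open>Weierstrass approximation, from both sides, of the step function that is \<open>1 / s\<close> for
  \<open>s > 1 / e\<close> and \<open>0\<close> below; its integral over the unit interval is \<open>1\<close>.\<close>

lemma step_approximation:
  fixes \<epsilon> :: real
  assumes "0 < \<epsilon>"
  shows "\<exists>(c :: nat \<Rightarrow> real) n (c' :: nat \<Rightarrow> real) n'.
    (\<Sum>k\<le>n. c k / real (Suc k)) \<le> 1 + \<epsilon> \<and> 1 - \<epsilon> \<le> (\<Sum>k\<le>n'. c' k / real (Suc k)) \<and>
    (\<forall>s. 0 \<le> s \<longrightarrow> s \<le> 1 \<longrightarrow> (if exp (- 1) < s then 1 / s else 0) \<le> (\<Sum>k\<le>n. c k * s ^ k)) \<and>
    (\<forall>s. 0 \<le> s \<longrightarrow> s \<le> 1 \<longrightarrow> (\<Sum>k\<le>n'. c' k * s ^ k) \<le> (if exp (- 1) < s then 1 / s else 0))"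
proof -
  define a :: real where "a = exp (- 1)"
  have a: "0 < a" "a < 1" by (auto simp: a_def)
  \<comment> \<open>The width of the ramps: d/a <= \<epsilon>/4 bounds the integral over a ramp, and
    the other bounds keep both ramps inside the unit interval.\<close>
  define d where "d = min (\<epsilon> * a / 4) (min a (1 - a))"
  have d: "0 < d" "d \<le> a" "a + d \<le> 1" "d / a \<le> \<epsilon> / 4"
  proof -
    show "0 < d" using a assms by (simp add: d_def)
    show "d \<le> a" "a + d \<le> 1" by (auto simp: d_def)
    have "d \<le> \<epsilon> * a / 4" unfolding d_def by (rule min.cobounded1)
    from divide_right_mono[OF this, of a] show "d / a \<le> \<epsilon> / 4" using a by simp
  qed
  \<comment> \<open>A ramp from 0 at \<open>b\<close> to 1 at b + d times 1/s, with the denominator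
    kept above \<open>a\<close> for continuity. The step at \<open>a\<close> lies below
    \<open>G (a - d)\<close> and above \<open>G a\<close>.\<close>
  define G where "G b s = max 0 (min 1 ((s - b) / d)) / max a s" for b s :: real
  have cont: "continuous_on S (G b)" for b S
    unfolding G_def using a d by (intro continuous_intros) auto
  have G01: "0 \<le> G b s" "G b s \<le> 1 / a" for b s
    unfolding G_def using a
    by (auto intro!: divide_nonneg_pos frac_le)
  define g where "g s = (if a < s then 1 / s else 0)" for s
  have up: "g s \<le> G (a - d) s" for s
    using a d by (auto simp: g_def G_def field_simps max_def min_def)
  have low: "G a s \<le> g s" if "0 \<le> s" for s
    using a d that by (auto simp: g_def G_def max_def min_def divide_right_mono divide_le_0_iff)
  have int_ln: "((\<lambda>s. 1 / s) has_integral 1) {a..1}"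
  proof -
    have "((\<lambda>s. 1 / s) has_integral (ln 1 - ln a)) {a..1}"
      using a by (intro fundamental_theorem_of_calculus)
        (auto intro!: derivative_eq_intros simp: has_real_derivative_iff_has_vector_derivative[symmetric])
    then show ?thesis by (simp add: a_def)
  qed
  have intble: "G b integrable_on {x..y}" for b x y
    by (rule integrable_continuous_real[OF cont])
  have intG_up: "integral {0..1} (G (a - d)) \<le> 1 + \<epsilon> / 4"
  proof -
    have "integral {0..1} (G (a - d))
        = integral {0..a - d} (G (a - d)) + (integral {a - d..a} (G (a - d)) + integral {a..1} (G (a - d)))"
      using a d by (simp add: Henstock_Kurzweil_Integration.integral_combine intble)
    moreover have "integral {0..a - d} (G (a - d)) = 0"
    proof -
      have "integral {0..a - d} (G (a - d)) = integral {0..a - d} (\<lambda>_. 0)"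
        using d by (intro Henstock_Kurzweil_Integration.integral_cong)
          (auto simp: G_def divide_le_0_iff zero_le_divide_iff max_def min_def)
      then show ?thesis by simp
    qed
    moreover have "integral {a - d..a} (G (a - d)) \<le> integral {a - d..a} (\<lambda>_. 1 / a)"
      by (intro integral_le intble G01) auto
    moreover have "integral {a..1} (G (a - d)) = 1"
    proof -
      have "integral {a..1} (G (a - d)) = integral {a..1} (\<lambda>s. 1 / s)"
        using d by (intro integral_cong) (auto simp: G_def max_def min_def field_simps)
      then show ?thesis using int_ln by (simp add: integral_unique)
    qed
    moreover have "integral {a - d..a} (\<lambda>_. 1 / a) = d / a" using d by simp
    ultimately show ?thesis using d(4) by linarith
  qed
  have intG_low: "1 - \<epsilon> / 4 \<le> integral {0..1} (G a)"
  proof -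
    have "integral {0..1} (G a) = integral {0..a} (G a) + (integral {a..a + d} (G a) + integral {a + d..1} (G a))"
      using a d by (simp add: Henstock_Kurzweil_Integration.integral_combine intble)
    moreover have "0 \<le> integral {0..a} (G a)" "0 \<le> integral {a..a + d} (G a)"
      by (intro integral_nonneg intble G01)+
    moreover have "integral {a + d..1} (G a) = integral {a + d..1} (\<lambda>s. 1 / s)"
      using a d by (intro integral_cong) (auto simp: G_def max_def min_def field_simps)
    moreover have "integral {a..a + d} (\<lambda>s. 1 / s) \<le> integral {a..a + d} (\<lambda>_. 1 / a)"
      using a d int_ln by (intro integral_le) (auto simp: frac_le intro: integrable_on_subinterval[of _ "{a..1}"])
    moreover have "integral {a..1} (\<lambda>s. 1 / s) = integral {a..a + d} (\<lambda>s. 1 / s) + integral {a + d..1} (\<lambda>s. 1 / s)"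
      using a d int_ln by (subst Henstock_Kurzweil_Integration.integral_combine) auto
    moreover have "integral {a..1} (\<lambda>s. 1 / s) = 1" using int_ln by (rule integral_unique)
    moreover have "integral {a..a + d} (\<lambda>_. 1 / a) = d / a" using d by simp
    ultimately show ?thesis using d(4) by linarith
  qed
  have poly_int: "integral {0..1} (\<lambda>s. \<Sum>k\<le>n. c k * s ^ k) = (\<Sum>k\<le>n. c k / real (Suc k))" for c :: "nat \<Rightarrow> real" and n
  proof (rule integral_unique, rule has_integral_sum)
    fix k assume "k \<in> {..n}"
    have "((\<lambda>s. c k / real (Suc k) * s ^ Suc k) has_real_derivative
        c k / real (Suc k) * (real (Suc k) * s ^ (Suc k - Suc 0))) (at s within {0..1})" for s
      by (intro DERIV_cmult DERIV_pow)
    then have "((\<lambda>s. c k / real (Suc k) * s ^ Suc k) has_vector_derivative c k * s ^ k) (at s within {0..1})" for s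
      by (simp add: has_real_derivative_iff_has_vector_derivative del: of_nat_Suc power_Suc)
    then have "((\<lambda>s. c k * s ^ k) has_integral
        (c k / real (Suc k) * 1 ^ Suc k - c k / real (Suc k) * 0 ^ Suc k)) {0..1}"
      by (intro fundamental_theorem_of_calculus) auto
    then show "((\<lambda>s. c k * s ^ k) has_integral c k / real (Suc k)) {0..1}" by simp
  qed simp
  have approx: "\<exists>c n. \<forall>s\<in>{0..1}. \<bar>G b s - (\<Sum>k\<le>n. c k * s ^ k)\<bar> < \<epsilon> / 4" for b
  proof -
    obtain q where "real_polynomial_function q" "\<And>x. x \<in> {0..1} \<Longrightarrow> \<bar>G b x - q x\<bar> < \<epsilon> / 4"
      by (rule Stone_Weierstrass_real_polynomial_function[of "{0..1}" "G b" "\<epsilon> / 4"])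
         (use assms cont in auto)
    moreover from this(1) obtain c n where "q = (\<lambda>x. \<Sum>k\<le>n. c k * x ^ k)"
      unfolding real_polynomial_function_iff_sum by blast
    ultimately show ?thesis by blast
  qed
  have shift: "(\<Sum>k\<le>n. (c k + (if k = 0 then e else 0)) * s ^ k) = (\<Sum>k\<le>n. c k * s ^ k) + e"
    for c :: "nat \<Rightarrow> real" and n e s
    by (simp add: distrib_right sum.distrib if_distrib[of "\<lambda>x. x * _"] sum.delta cong: if_cong)
  obtain c n where c: "\<And>s. s \<in> {0..1} \<Longrightarrow> \<bar>G (a - d) s - (\<Sum>k\<le>n. c k * s ^ k)\<bar> < \<epsilon> / 4"
    using approx by metis
  obtain c' n' where c': "\<And>s. s \<in> {0..1} \<Longrightarrow> \<bar>G a s - (\<Sum>k\<le>n'. c' k * s ^ k)\<bar> < \<epsilon> / 4"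
    using approx by metis
  \<comment> \<open>Shifting the approximating polynomials up or down by \<epsilon>/4 makes the
    bounds one-sided. The total error of the integral is then at most \<epsilon>/4 +
    \<epsilon>/2.\<close>
  define C where "C k = c k + (if k = 0 then \<epsilon> / 4 else 0)" for k
  define C' where "C' k = c' k + (if k = 0 then - \<epsilon> / 4 else 0)" for k
  have C: "(\<Sum>k\<le>n. C k * s ^ k) = (\<Sum>k\<le>n. c k * s ^ k) + \<epsilon> / 4" for s
    unfolding C_def by (rule shift)
  have C': "(\<Sum>k\<le>n'. C' k * s ^ k) = (\<Sum>k\<le>n'. c' k * s ^ k) - \<epsilon> / 4" for s
    unfolding C'_def using shift[where e="- \<epsilon> / 4"] by simp
  have ub: "(\<Sum>k\<le>n. C k * s ^ k) \<le> G (a - d) s + \<epsilon> / 2" if "s \<in> {0..1}" for s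
    using c[OF that] unfolding C abs_less_iff by linarith
  have lb: "G a s - \<epsilon> / 2 \<le> (\<Sum>k\<le>n'. C' k * s ^ k)" if "s \<in> {0..1}" for s
    using c'[OF that] unfolding C' abs_less_iff by linarith
  show ?thesis
  proof (rule exI[of _ C], rule exI[of _ n], rule exI[of _ C'], rule exI[of _ n'], intro conjI allI impI)
    have "(\<Sum>k\<le>n. C k / real (Suc k)) \<le> integral {0..1} (\<lambda>s. G (a - d) s + \<epsilon> / 2)"
      unfolding poly_int[symmetric]
      by (intro integral_le integrable_continuous_real continuous_intros cont ub)
    also have "\<dots> = integral {0..1} (G (a - d)) + \<epsilon> / 2"
      by (subst Henstock_Kurzweil_Integration.integral_add) (auto simp: intble)
    finally show "(\<Sum>k\<le>n. C k / real (Suc k)) \<le> 1 + \<epsilon>" using intG_up assms by linarith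
    have "integral {0..1} (G a) - \<epsilon> / 2 = integral {0..1} (\<lambda>s. G a s - \<epsilon> / 2)"
      by (subst Henstock_Kurzweil_Integration.integral_diff) (auto simp: intble)
    also have "\<dots> \<le> (\<Sum>k\<le>n'. C' k / real (Suc k))"
      unfolding poly_int[symmetric]
      by (intro integral_le integrable_continuous_real continuous_intros cont lb)
    finally show "1 - \<epsilon> \<le> (\<Sum>k\<le>n'. C' k / real (Suc k))" using intG_low assms by linarith
    show "(if exp (- 1) < s then 1 / s else 0) \<le> (\<Sum>k\<le>n. C k * s ^ k)" if "0 \<le> s" "s \<le> 1" for s
    proof -
      have "G (a - d) s \<le> (\<Sum>k\<le>n. C k * s ^ k)"
        using c[of s] that unfolding C abs_less_iff by simp
      from order_trans[OF up this] show ?thesis by (simp only: g_def a_def)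
    qed
    show "(\<Sum>k\<le>n'. C' k * s ^ k) \<le> (if exp (- 1) < s then 1 / s else 0)" if "0 \<le> s" "s \<le> 1" for s
    proof -
      have "(\<Sum>k\<le>n'. C' k * s ^ k) \<le> G a s"
        using c'[of s] that unfolding C' abs_less_iff by simp
      from order_trans[OF this low[OF that(1)]] show ?thesis by (simp only: g_def a_def)
    qed
  qed
qed

section \<open>Polynomials in exp(-t/r) as combinations of dilated Laplace transforms\<close>

locale finite_laplace = laplace_measure +
  assumes laplace_finite: "\<And>r. 0 < r \<Longrightarrow> laplace r < \<infinity>"
begin

definition lap :: "real \<Rightarrow> real" where "lap r = (\<integral>t. exp (- t / r) \<partial>\<kappa>)"

lemma integrable_exp: "0 < r \<Longrightarrow> integrable \<kappa> (\<lambda>t. exp (- t / r))"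
  using laplace_finite[of r] unfolding laplace_def by (intro integrableI_nonneg) auto

lemma laplace_lap: "0 < r \<Longrightarrow> laplace r = ennreal (lap r)"
  unfolding laplace_def lap_def using integrable_exp by (intro nn_integral_eq_integral) auto

lemma lap_nonneg: "0 \<le> lap r"
  unfolding lap_def by (intro integral_nonneg_AE) auto

text \<open>The power k + 1 of exp(-t/r) is the exponential with r replaced by r/(k + 1), so a
  polynomial weight amounts to a combination of dilations.\<close>

lemma lap_powers:
  fixes c :: "nat \<Rightarrow> real"
  assumes "0 < r"
  shows "(\<Sum>k\<le>n. c k * lap (r / real (Suc k))) = (\<integral>t. exp (- t / r) * (\<Sum>k\<le>n. c k * exp (- t / r) ^ k) \<partial>\<kappa>)"
    and "integrable \<kappa> (\<lambda>t. exp (- t / r) * (\<Sum>k\<le>n. c k * exp (- t / r) ^ k))"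
proof -
  have *: "exp (- t / r) * (\<Sum>k\<le>n. c k * exp (- t / r) ^ k) = (\<Sum>k\<le>n. c k * exp (- t / (r / real (Suc k))))" for t
  proof (unfold sum_distrib_left, intro sum.cong refl)
    fix k
    have "exp (- t / r) * exp (- t / r) ^ k = exp (real (Suc k) * (- t / r))"
      by (subst exp_of_nat_mult) simp
    also have "real (Suc k) * (- t / r) = - t / (r / real (Suc k))" by simp
    finally show "exp (- t / r) * (c k * exp (- t / r) ^ k) = c k * exp (- t / (r / real (Suc k)))"
      by (metis mult.left_commute)
  qed
  have int: "integrable \<kappa> (\<lambda>t. c k * exp (- t / (r / real (Suc k))))" for k
    using assms by (intro integrable_mult_right integrable_exp) auto
  show "(\<Sum>k\<le>n. c k * lap (r / real (Suc k))) = (\<integral>t. exp (- t / r) * (\<Sum>k\<le>n. c k * exp (- t / r) ^ k) \<partial>\<kappa>)"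
    unfolding * using int by (subst Bochner_Integration.integral_sum) (auto simp: lap_def)
  show "integrable \<kappa> (\<lambda>t. exp (- t / r) * (\<Sum>k\<le>n. c k * exp (- t / r) ^ k))"
    unfolding * using int by (intro Bochner_Integration.integrable_sum)
qed

text \<open>With s = exp(-t/r), the product of s and the step function 1/s for s > 1/e is the
  indicator of t < r.\<close>

lemma cumul_integral:
  assumes "0 < r"
  shows "cumul r = (\<integral>t. exp (- t / r) * (if exp (- 1) < exp (- t / r) then 1 / exp (- t / r) else 0) \<partial>\<kappa>)"
    and "integrable \<kappa> (\<lambda>t. exp (- t / r) * (if exp (- 1) < exp (- t / r) then 1 / exp (- t / r) else 0))"
proof -
  have *: "exp (- t / r) * (if exp (- 1) < exp (- t / r) then 1 / exp (- t / r) else 0) = indicator {..<r} t" for t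
    using assms by (auto simp: indicator_def field_simps)
  show "cumul r = (\<integral>t. exp (- t / r) * (if exp (- 1) < exp (- t / r) then 1 / exp (- t / r) else 0) \<partial>\<kappa>)"
    unfolding * by (simp add: cumul_def)
  show "integrable \<kappa> (\<lambda>t. exp (- t / r) * (if exp (- 1) < exp (- t / r) then 1 / exp (- t / r) else 0))"
    unfolding * using locally_finite[of r] by (simp add: integrable_indicator_iff)
qed

lemma karamata_upper:
  fixes c :: "nat \<Rightarrow> real"
  assumes "0 < r"
    and "\<And>s. 0 \<le> s \<Longrightarrow> s \<le> 1 \<Longrightarrow> (if exp (- 1) < s then 1 / s else 0) \<le> (\<Sum>k\<le>n. c k * s ^ k)"
  shows "cumul r \<le> (\<Sum>k\<le>n. c k * lap (r / real (Suc k)))"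
  unfolding lap_powers(1)[OF assms(1)] cumul_integral(1)[OF assms(1)]
proof (intro integral_mono_AE lap_powers(2) cumul_integral(2) eventually_mono[OF nonneg_support]
    mult_left_mono assms)
  show "exp (- t / r) \<le> 1" if "0 \<le> t" for t using that assms(1) by simp
qed auto

lemma karamata_lower:
  fixes c :: "nat \<Rightarrow> real"
  assumes "0 < r"
    and "\<And>s. 0 \<le> s \<Longrightarrow> s \<le> 1 \<Longrightarrow> (\<Sum>k\<le>n. c k * s ^ k) \<le> (if exp (- 1) < s then 1 / s else 0)"
  shows "(\<Sum>k\<le>n. c k * lap (r / real (Suc k))) \<le> cumul r"
  unfolding lap_powers(1)[OF assms(1)] cumul_integral(1)[OF assms(1)]
proof (intro integral_mono_AE lap_powers(2) cumul_integral(2) eventually_mono[OF nonneg_support]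
    mult_left_mono assms)
  show "exp (- t / r) \<le> 1" if "0 \<le> t" for t using that assms(1) by simp
qed auto

end


section \<open>Karamata and Abelian theorems for general notions of limit\<close>

text \<open>Abstracts true limits at infinity and dilation invariant generalised limits, so that every
  Tauberian comparison below covers both.\<close>

locale limit_notion =
  fixes R :: "(real \<Rightarrow> real) \<Rightarrow> real \<Rightarrow> bool"
  assumes add: "R f a \<Longrightarrow> R g b \<Longrightarrow> R (\<lambda>x. f x + g x) (a + b)"
    and cmult: "R f a \<Longrightarrow> R (\<lambda>x. c * f x) (c * a)"
    and dilate: "R f a \<Longrightarrow> 0 < c \<Longrightarrow> R (\<lambda>x. f (c * x)) a"
    and conv: "f \<in> borel_measurable borel \<Longrightarrow> (f \<longlongrightarrow> a) at_top \<Longrightarrow> R f a"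
    and nonneg: "R f a \<Longrightarrow> \<forall>\<^sub>F x in at_top. 0 \<le> f x \<Longrightarrow> 0 \<le> a"
    and squeeze: "f \<in> borel_measurable borel \<Longrightarrow>
      (\<And>e. 0 < e \<Longrightarrow> \<exists>g h a b. R g a \<and> R h b \<and> (\<forall>\<^sub>F x in at_top. g x \<le> f x) \<and>
          (\<forall>\<^sub>F x in at_top. f x \<le> h x) \<and> l - e \<le> a \<and> b \<le> l + e) \<Longrightarrow> R f l"
begin

lemma sum:
  assumes "\<And>k. k \<in> I \<Longrightarrow> R (f k) (a k)" "finite I"
  shows "R (\<lambda>x. \<Sum>k\<in>I. f k x) (\<Sum>k\<in>I. a k)"
  using assms(2,1)
proof (induction I)
  case empty
  then show ?case by (simp add: conv)
next
  case (insert i I)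
  have "R (\<lambda>x. f i x + (\<Sum>k\<in>I. f k x)) (a i + sum a I)" using insert by (intro add) auto
  then show ?case using insert.hyps by simp
qed

lemma times_convergent:
  assumes f: "R f a" "f \<in> borel_measurable borel" "\<forall>\<^sub>F x in at_top. \<bar>f x\<bar> \<le> C"
    and g: "g \<in> borel_measurable borel" "(g \<longlongrightarrow> c) at_top"
  shows "R (\<lambda>x. f x * g x) (c * a)"
proof -
  have "((\<lambda>x. f x * (g x - c)) \<longlongrightarrow> 0) at_top"
  proof (rule Lim_null_comparison)
    show "\<forall>\<^sub>F x in at_top. norm (f x * (g x - c)) \<le> C * \<bar>g x - c\<bar>"
      using f(3) by (rule eventually_mono) (auto simp: abs_mult intro: mult_right_mono)
    show "((\<lambda>x. C * \<bar>g x - c\<bar>) \<longlongrightarrow> 0) at_top"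
      using tendsto_mult_right_zero[OF tendsto_rabs_zero[OF LIM_zero[OF g(2)]]] by simp
  qed
  then have "R (\<lambda>x. f x * (g x - c)) 0" using f g by (intro conv) auto
  from add[OF cmult[OF f(1), of c] this] show ?thesis by (simp add: algebra_simps)
qed

end

lemma limit_notion_tendsto: "limit_notion (\<lambda>f l. (f \<longlongrightarrow> l) at_top)"
proof
  show "((\<lambda>x. f (c * x)) \<longlongrightarrow> a) at_top" if "(f \<longlongrightarrow> a) at_top" "0 < c" for f :: "real \<Rightarrow> real" and a c
    using that by (intro filterlim_compose[OF that(1)] filterlim_tendsto_pos_mult_at_top[OF tendsto_const])
      (auto intro: filterlim_ident)
  show "0 \<le> a" if "(f \<longlongrightarrow> a) at_top" "\<forall>\<^sub>F x in at_top. 0 \<le> f x" for f :: "real \<Rightarrow> real" and a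
    using that by (intro tendsto_lowerbound) auto
  fix f :: "real \<Rightarrow> real" and l
  assume sq: "\<And>e. 0 < e \<Longrightarrow> \<exists>g h a b. (g \<longlongrightarrow> a) at_top \<and> (h \<longlongrightarrow> b) at_top \<and>
      (\<forall>\<^sub>F x in at_top. g x \<le> f x) \<and> (\<forall>\<^sub>F x in at_top. f x \<le> h x) \<and> l - e \<le> a \<and> b \<le> l + e"
  show "(f \<longlongrightarrow> l) at_top"
  proof (rule order_tendstoI)
    fix z assume z: "z < l"
    obtain g a where g: "(g \<longlongrightarrow> a) at_top" "\<forall>\<^sub>F x in at_top. g x \<le> f x" "l - (l - z) / 2 \<le> a"
      using sq[of "(l - z) / 2"] z by auto
    have "z < a" using g(3) z by (simp add: field_simps)
    from order_tendstoD(1)[OF g(1) this] g(2) show "\<forall>\<^sub>F x in at_top. z < f x"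
      by eventually_elim simp
  next
    fix z assume z: "l < z"
    obtain h b where h: "(h \<longlongrightarrow> b) at_top" "\<forall>\<^sub>F x in at_top. f x \<le> h x" "b \<le> l + (z - l) / 2"
      using sq[of "(z - l) / 2"] z by auto
    have "b < z" using h(3) z by (simp add: field_simps)
    from order_tendstoD(2)[OF h(1) this] h(2) show "\<forall>\<^sub>F x in at_top. f x < z"
      by eventually_elim simp
  qed
qed (auto intro: tendsto_intros)

interpretation lim: limit_notion "\<lambda>f l. (f \<longlongrightarrow> l) at_top"
  by (rule limit_notion_tendsto)

lemma (in finite_laplace) lap_measurable [measurable]: "lap \<in> borel_measurable borel"
proof -
  interpret sigma_finite_measure \<kappa> by (rule sigma_finite_kappa)
  show ?thesis unfolding lap_def[abs_def] by measurable
qed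

text \<open>A dilation does not change the limit of lap r / r, so a polynomial weight with
  coefficients c_k has limit l times the sum of c_k/(k + 1), which is l times the integral of the
  polynomial over the unit interval. The two step approximations push this within \<epsilon> l of l
  on either side.\<close>

lemma (in finite_laplace) karamata:
  assumes "limit_notion R" and l: "R (\<lambda>r. lap r / r) l"
  shows "R (\<lambda>r. cumul r / r) l"
proof -
  interpret limit_notion R by fact
  let ?\<phi> = "\<lambda>r. lap r / r"
  have "0 \<le> l"
    by (rule nonneg[OF l]) (auto intro!: eventually_mono[OF eventually_gt_at_top[of 0]] divide_nonneg_pos lap_nonneg)
  have comb: "R (\<lambda>r. \<Sum>k\<le>n. c k / real (Suc k) * ?\<phi> (1 / real (Suc k) * r)) (\<Sum>k\<le>n. c k / real (Suc k) * l)"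
    for c :: "nat \<Rightarrow> real" and n
    by (intro sum cmult dilate l) auto
  have comb_eq: "(\<Sum>k\<le>n. c k * lap (r / real (Suc k))) / r
      = (\<Sum>k\<le>n. c k / real (Suc k) * ?\<phi> (1 / real (Suc k) * r))" for c :: "nat \<Rightarrow> real" and n r
    unfolding sum_divide_distrib by (intro sum.cong) (auto simp del: of_nat_Suc)
  show ?thesis
  proof (rule squeeze)
    fix e :: real assume e: "0 < e"
    \<comment> \<open>The denominator l + 1 makes \<epsilon> l at most e and remains positive for l
      = 0.\<close>
    define \<epsilon> where "\<epsilon> = e / (l + 1)"
    have \<epsilon>: "0 < \<epsilon>" "\<epsilon> * l \<le> e"
      using e \<open>0 \<le> l\<close> by (auto simp: \<epsilon>_def field_simps)
    obtain c :: "nat \<Rightarrow> real" and n and c' :: "nat \<Rightarrow> real" and n'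
      where c: "(\<Sum>k\<le>n. c k / real (Suc k)) \<le> 1 + \<epsilon>" "1 - \<epsilon> \<le> (\<Sum>k\<le>n'. c' k / real (Suc k))"
        "\<forall>s. 0 \<le> s \<longrightarrow> s \<le> 1 \<longrightarrow> (if exp (- 1) < s then 1 / s else 0) \<le> (\<Sum>k\<le>n. c k * s ^ k)"
        "\<forall>s. 0 \<le> s \<longrightarrow> s \<le> 1 \<longrightarrow> (\<Sum>k\<le>n'. c' k * s ^ k) \<le> (if exp (- 1) < s then 1 / s else 0)"
      using step_approximation[OF \<epsilon>(1)] by (elim exE conjE) (rule that)
    have "l - e \<le> (1 - \<epsilon>) * l" using \<epsilon>(2) by (simp add: algebra_simps)
    also have "\<dots> \<le> (\<Sum>k\<le>n'. c' k / real (Suc k) * l)"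
      unfolding sum_distrib_right[symmetric] by (rule mult_right_mono[OF c(2) \<open>0 \<le> l\<close>])
    finally have low: "l - e \<le> (\<Sum>k\<le>n'. c' k / real (Suc k) * l)" .
    have "(\<Sum>k\<le>n. c k / real (Suc k) * l) \<le> (1 + \<epsilon>) * l"
      unfolding sum_distrib_right[symmetric] by (rule mult_right_mono[OF c(1) \<open>0 \<le> l\<close>])
    also have "\<dots> \<le> l + e" using \<epsilon>(2) by (simp add: algebra_simps)
    finally have up: "(\<Sum>k\<le>n. c k / real (Suc k) * l) \<le> l + e" .
    have ev_low: "\<forall>\<^sub>F r in at_top. (\<Sum>k\<le>n'. c' k / real (Suc k) * ?\<phi> (1 / real (Suc k) * r)) \<le> cumul r / r"
      using eventually_gt_at_top[of 0]
    proof eventually_elim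
      case (elim r)
      show ?case unfolding comb_eq[symmetric]
        using elim by (intro divide_right_mono karamata_lower c(4)[rule_format]) auto
    qed
    have ev_up: "\<forall>\<^sub>F r in at_top. cumul r / r \<le> (\<Sum>k\<le>n. c k / real (Suc k) * ?\<phi> (1 / real (Suc k) * r))"
      using eventually_gt_at_top[of 0]
    proof eventually_elim
      case (elim r)
      show ?case unfolding comb_eq[symmetric]
        using elim by (intro divide_right_mono karamata_upper c(3)[rule_format]) auto
    qed
    show "\<exists>g h a b. R g a \<and> R h b \<and> (\<forall>\<^sub>F x in at_top. g x \<le> cumul x / x) \<and>
          (\<forall>\<^sub>F x in at_top. cumul x / x \<le> h x) \<and> l - e \<le> a \<and> b \<le> l + e"
      by (intro exI conjI) (rule comb comb ev_low ev_up low up)+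
  qed simp
qed

lemma (in laplace_measure) laplace_bounded:
  assumes "\<forall>\<^sub>F y in at_top. cumul y \<le> C * y" "0 \<le> C"
  obtains D where "0 \<le> D" "\<And>r. 0 < r \<Longrightarrow> laplace r \<le> ennreal (C * r + D)"
proof -
  obtain Y where Y: "\<And>y. Y \<le> y \<Longrightarrow> cumul y \<le> C * y"
    using assms(1) by (auto simp: eventually_at_top_linorder)
  have "cumul y \<le> C * y + cumul Y" if "0 \<le> y" for y
  proof (cases "Y \<le> y")
    case True then show ?thesis using Y[OF True] cumul_nonneg[of Y] by linarith
  next
    case False
    then have "cumul y \<le> cumul Y" by (intro cumul_mono) auto
    then show ?thesis using that assms(2) by (simp add: add_increasing)
  qed
  then show ?thesis
    by (intro that[of "cumul Y"] laplace_le) (auto simp: cumul_nonneg assms(2))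
qed

text \<open>Convergence gives eventual linear bounds on \<open>cumul\<close>; monotonicity extends
  them to affine bounds on the half-line, and the kernel exp(-y/r)/r maps affine functions to affine
  functions of r.\<close>

lemma (in finite_laplace) abel:
  assumes b: "((\<lambda>r. cumul r / r) \<longlongrightarrow> l) at_top"
  shows "((\<lambda>r. lap r / r) \<longlongrightarrow> l) at_top"
proof (rule lim.squeeze)
  fix e :: real assume e: "0 < e"
  have l: "0 \<le> l"
    by (rule lim.nonneg[OF b]) (auto intro!: eventually_mono[OF eventually_gt_at_top[of 0]] divide_nonneg_pos cumul_nonneg)
  have "\<forall>\<^sub>F y in at_top. cumul y / y < l + e" "\<forall>\<^sub>F y in at_top. l - e < cumul y / y"
    using order_tendstoD[OF b] e by auto
  then have ev: "\<forall>\<^sub>F y in at_top. cumul y \<le> (l + e) * y" "\<forall>\<^sub>F y in at_top. (l - e) * y \<le> cumul y"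
    using eventually_gt_at_top[of 0] by (eventually_elim, simp add: field_simps)+
  obtain D where D: "0 \<le> D" "\<And>r. 0 < r \<Longrightarrow> laplace r \<le> ennreal ((l + e) * r + D)"
    using laplace_bounded[OF ev(1)] l e by (metis add_nonneg_nonneg less_imp_le)
  \<comment> \<open>The lower slope is cut at 0, since \<open>laplace_ge\<close> asks for a
    nonnegative one and \<open>cumul\<close> is nonnegative anyway.\<close>
  define A where "A = max 0 (l - e)"
  obtain Y where Y: "\<And>y. Y \<le> y \<Longrightarrow> (l - e) * y \<le> cumul y" "0 \<le> Y"
    using ev(2) by (auto simp: eventually_at_top_linorder) (metis max.bounded_iff max.cobounded2 order_trans)
  have "A * y \<le> cumul y + A * Y" if "0 \<le> y" for y
  proof (cases "Y \<le> y")
    case True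
    then have "A * y \<le> cumul y"
      using Y(1)[OF True] cumul_nonneg[of y] by (auto simp: A_def max_def)
    then show ?thesis using Y(2) by (simp add: A_def add_increasing2)
  next
    case False
    then have "A * y \<le> A * Y" by (intro mult_left_mono) (auto simp: A_def)
    then show ?thesis using cumul_nonneg[of y] by linarith
  qed
  then have low: "ennreal (A * r) \<le> laplace r + ennreal (A * Y)" if "0 < r" for r
    using that Y(2) by (intro laplace_ge) (auto simp: A_def)
  have "\<forall>\<^sub>F r in at_top. A - A * Y / r \<le> lap r / r"
    using eventually_gt_at_top[of 0]
  proof eventually_elim
    case (elim r)
    have "A * r \<le> lap r + A * Y"
      using low[OF elim] lap_nonneg[of r] Y(2)
      by (simp add: laplace_lap[OF elim] A_def flip: ennreal_plus)
    then have "(A * r - A * Y) / r \<le> lap r / r" using elim by (intro divide_right_mono) auto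
    then show ?case using elim by (simp add: diff_divide_distrib)
  qed
  moreover have "\<forall>\<^sub>F r in at_top. lap r / r \<le> (l + e) + D / r"
    using eventually_gt_at_top[of 0]
  proof eventually_elim
    case (elim r)
    have "lap r \<le> (l + e) * r + D"
      using D(2)[OF elim] D(1) l e elim unfolding laplace_lap[OF elim]
      by (subst (asm) ennreal_le_iff) auto
    then show ?case using elim by (simp add: field_simps)
  qed
  moreover have "((\<lambda>r. A - A * Y / r) \<longlongrightarrow> A) at_top" by real_asymp
  moreover have "((\<lambda>r. (l + e) + D / r) \<longlongrightarrow> l + e) at_top" by real_asymp
  moreover have "l - e \<le> A" by (simp add: A_def)
  ultimately show "\<exists>g h a b. (g \<longlongrightarrow> a) at_top \<and> (h \<longlongrightarrow> b) at_top \<and> (\<forall>\<^sub>F x in at_top. g x \<le> lap x / x) \<and>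
      (\<forall>\<^sub>F x in at_top. lap x / x \<le> h x) \<and> l - e \<le> a \<and> b \<le> l + e" by blast
qed simp


section \<open>Singular values on the logarithmic scale\<close>

locale fin_rearrangement = rearrangement +
  assumes dist_fun_finite: "\<And>x. 0 < x \<Longrightarrow> dist_fun x < \<infinity>"
begin

text \<open>The measure u d\<rho> on (0, 1] in the variable t = -log u, which is nonnegative there.
  Values above 1 are kept apart: they contribute \<open>top_mass\<close> to the cut-off trace and
  \<open>tail\<close> to the traces of powers.\<close>

definition log_measure :: "real measure" where
  "log_measure = distr (density \<rho> (\<lambda>u. indicator {0<..1} u * ennreal u)) borel (\<lambda>u. - ln u)"

lemma sets_log_measure [simp, measurable_cong]: "sets log_measure = sets borel"
  by (simp add: log_measure_def)

lemma nn_integral_log_measure: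
  assumes [measurable]: "f \<in> borel_measurable borel"
  shows "(\<integral>\<^sup>+t. f t \<partial>log_measure) = (\<integral>\<^sup>+u. indicator {0<..1} u * ennreal u * f (- ln u) \<partial>\<rho>)"
  unfolding log_measure_def by (subst nn_integral_distr) (auto simp: nn_integral_density)

lemma emeasure_log_measure:
  "emeasure log_measure {..<y} = (\<integral>\<^sup>+u. indicator {exp (- y)<..1} u * ennreal u \<partial>\<rho>)"
proof -
  have "emeasure log_measure {..<y} = (\<integral>\<^sup>+t. indicator {..<y} t \<partial>log_measure)" by simp
  also have "\<dots> = (\<integral>\<^sup>+u. indicator {0<..1} u * ennreal u * indicator {..<y} (- ln u) \<partial>\<rho>)"
    by (rule nn_integral_log_measure) simp
  also have "\<dots> = (\<integral>\<^sup>+u. indicator {exp (- y)<..1} u * ennreal u \<partial>\<rho>)"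
  proof (intro nn_integral_cong)
    fix u :: real
    have "- ln u < y \<longleftrightarrow> exp (- y) < u" if "0 < u"
      using exp_less_cancel_iff[of "- y" "ln u"] that by auto
    moreover have "0 < u" if "exp (- y) < u" using that exp_gt_zero[of "- y"] by linarith
    ultimately show "indicator {0<..1} u * ennreal u * indicator {..<y} (- ln u)
        = indicator {exp (- y)<..1} u * ennreal u"
      by (auto simp: indicator_def)
  qed
  finally show ?thesis .
qed

sublocale log: laplace_measure log_measure
proof
  show "AE t in log_measure. 0 \<le> t"
    unfolding log_measure_def
    by (subst AE_distr_iff, simp, simp, subst AE_density) (auto simp: indicator_def)
  fix y
  have "emeasure log_measure {..<y} \<le> (\<integral>\<^sup>+u. indicator {exp (- y)<..} u \<partial>\<rho>)"
    unfolding emeasure_log_measure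
    by (intro nn_integral_mono) (auto simp: indicator_def ennreal_le_1)
  also have "\<dots> = dist_fun (exp (- y))" by (simp add: dist_fun_def)
  finally show "emeasure log_measure {..<y} < \<infinity>"
    using dist_fun_finite[of "exp (- y)"] by (simp add: order_le_less_trans)
qed simp

lemma big_int_1_finite: "big_int 1 < \<infinity>"
proof -
  have "big_int 1 \<le> (\<integral>\<^sup>+u. ennreal K * indicator {1<..} u \<partial>\<rho>)"
    unfolding big_int_def
    by (intro nn_integral_mono_AE eventually_mono[OF support]) (auto simp: indicator_def ennreal_leI)
  also have "\<dots> = ennreal K * dist_fun 1" by (simp add: nn_integral_cmult dist_fun_def)
  also have "\<dots> < \<infinity>" using dist_fun_finite[of 1] by (simp add: ennreal_mult_less_top)
  finally show ?thesis .
qed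

definition top_mass :: real where "top_mass = enn2real (big_int 1)"

lemma big_int_exp:
  assumes "0 \<le> y" shows "big_int (exp (- y)) = ennreal (log.cumul y + top_mass)"
proof -
  have "big_int (exp (- y)) = (\<integral>\<^sup>+u. indicator {exp (- y)<..1} u * ennreal u + indicator {1<..} u * ennreal u \<partial>\<rho>)"
    unfolding big_int_def
  proof (intro nn_integral_cong)
    fix u :: real
    have "exp (- y) \<le> 1" using assms by simp
    then have "exp (- y) < u" if "1 < u" using that by linarith
    then show "indicator {exp (- y)<..} u * ennreal u
        = indicator {exp (- y)<..1} u * ennreal u + indicator {1<..} u * ennreal u"
      by (auto simp: indicator_def)
  qed
  also have "\<dots> = emeasure log_measure {..<y} + big_int 1"
    unfolding emeasure_log_measure big_int_def by (rule nn_integral_add) auto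
  also have "big_int 1 = ennreal top_mass"
    using big_int_1_finite by (simp add: top_mass_def)
  finally show ?thesis by (simp add: log.emeasure_cumul log.cumul_nonneg top_mass_def)
qed

section \<open>Traces of powers as Laplace transforms with a bounded remainder\<close>

definition power_int :: "real \<Rightarrow> ennreal" where
  "power_int q = (\<integral>\<^sup>+u. ennreal (u powr q) \<partial>\<rho>)"

text \<open>The integral is taken against the restricted measure, which is finite, so that
  measurability in r follows from the theory of sigma-finite measures.\<close>

definition tail :: "real \<Rightarrow> real" where
  "tail r = enn2real (\<integral>\<^sup>+u. ennreal (u powr (1 + 1 / r)) \<partial>density \<rho> (indicator {1<..}))"

lemma tail_measurable [measurable]: "tail \<in> borel_measurable borel"
proof -
  have "finite_measure (density \<rho> (indicator {1<..}))"
    using dist_fun_finite[of 1]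
    by (intro finite_measureI) (simp add: emeasure_density dist_fun_def)
  then interpret sigma_finite_measure "density \<rho> (indicator {1<..})" by (rule finite_measure.axioms)
  show ?thesis unfolding tail_def[abs_def] by measurable
qed

text \<open>For r >= 1 the exponent is at most 2, and the integrand is bounded on the
  support.\<close>

lemma tail_bound:
  assumes "1 \<le> r"
  shows "(\<integral>\<^sup>+u. ennreal (u powr (1 + 1 / r)) \<partial>density \<rho> (indicator {1<..}))
    \<le> ennreal (max 1 K powr 2) * dist_fun 1"
proof -
  have "(\<integral>\<^sup>+u. ennreal (u powr (1 + 1 / r)) \<partial>density \<rho> (indicator {1<..}))
      = (\<integral>\<^sup>+u. indicator {1<..} u * ennreal (u powr (1 + 1 / r)) \<partial>\<rho>)"
    by (subst nn_integral_density) auto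
  also have "\<dots> \<le> (\<integral>\<^sup>+u. ennreal (max 1 K powr 2) * indicator {1<..} u \<partial>\<rho>)"
  proof (intro nn_integral_mono_AE eventually_mono[OF support])
    fix u assume u: "u \<in> {0..K}"
    have "u powr (1 + 1 / r) \<le> max 1 K powr 2" if "1 < u"
    proof -
      have "u powr (1 + 1 / r) \<le> u powr 2"
        using that assms by (intro powr_mono) (auto simp: field_simps)
      also have "\<dots> \<le> max 1 K powr 2" using that u by (intro powr_mono2) auto
      finally show ?thesis .
    qed
    then show "indicator {1<..} u * ennreal (u powr (1 + 1 / r)) \<le> ennreal (max 1 K powr 2) * indicator {1<..} u"
      by (auto simp: indicator_def intro: ennreal_leI)
  qed
  also have "\<dots> = ennreal (max 1 K powr 2) * dist_fun 1"
    by (simp add: nn_integral_cmult dist_fun_def)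
  finally show ?thesis .
qed

definition tail_max :: real where "tail_max = enn2real (ennreal (max 1 K powr 2) * dist_fun 1)"

lemma tail_max_finite: "ennreal (max 1 K powr 2) * dist_fun 1 < \<infinity>"
  using dist_fun_finite[of 1] by (simp add: ennreal_mult_less_top)

lemma tail_le: "1 \<le> r \<Longrightarrow> tail r \<le> tail_max"
  unfolding tail_def tail_max_def using tail_bound tail_max_finite by (intro enn2real_mono) auto

lemma tail_nonneg: "0 \<le> tail r" by (simp add: tail_def)

lemma power_int_split:
  assumes "1 \<le> r" shows "power_int (1 + 1 / r) = log.laplace r + ennreal (tail r)"
proof -
  have "power_int (1 + 1 / r) = (\<integral>\<^sup>+u. indicator {0<..1} u * ennreal u * ennreal (exp (- (- ln u) / r))
      + indicator {1<..} u * ennreal (u powr (1 + 1 / r)) \<partial>\<rho>)"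
    unfolding power_int_def
  proof (intro nn_integral_cong_AE eventually_mono[OF support])
    fix u assume u: "u \<in> {0..K}"
    have "u powr (1 + 1 / r) = u * exp (- (- ln u) / r)" if "0 < u"
      using that by (simp add: powr_add) (simp add: powr_def)
    moreover have "ennreal (u * exp (- (- ln u) / r)) = ennreal u * ennreal (exp (- (- ln u) / r))"
      using u by (intro ennreal_mult) auto
    ultimately show "ennreal (u powr (1 + 1 / r)) = indicator {0<..1} u * ennreal u * ennreal (exp (- (- ln u) / r))
        + indicator {1<..} u * ennreal (u powr (1 + 1 / r))"
      using u by (cases "u = 0") (auto simp: indicator_def)
  qed
  also have "\<dots> = (\<integral>\<^sup>+u. indicator {0<..1} u * ennreal u * ennreal (exp (- (- ln u) / r)) \<partial>\<rho>)
      + (\<integral>\<^sup>+u. indicator {1<..} u * ennreal (u powr (1 + 1 / r)) \<partial>\<rho>)"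
    by (rule nn_integral_add) auto
  also have "(\<integral>\<^sup>+u. indicator {0<..1} u * ennreal u * ennreal (exp (- (- ln u) / r)) \<partial>\<rho>) = log.laplace r"
    unfolding log.laplace_def by (subst nn_integral_log_measure) auto
  also have "(\<integral>\<^sup>+u. indicator {1<..} u * ennreal (u powr (1 + 1 / r)) \<partial>\<rho>)
      = (\<integral>\<^sup>+u. ennreal (u powr (1 + 1 / r)) \<partial>density \<rho> (indicator {1<..}))"
    by (subst nn_integral_density) auto
  also have "\<dots> = ennreal (tail r)"
    using tail_bound[OF assms] tail_max_finite unfolding tail_def
    by (simp add: order_le_less_trans)
  finally show ?thesis .
qed

text \<open>The logarithmic mean of the singular values after the substitution t = exp y, which
  turns powers of t into dilations of y.\<close>

definition log_mu :: "real \<Rightarrow> real" where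
  "log_mu y = mu_int (exp y) / ln (1 + exp y)"

lemma ln_exp_ge: "(y :: real) \<le> ln (1 + exp y)"
proof -
  have "ln (exp y) \<le> ln (1 + exp y)" by (intro ln_mono) (auto simp: add_pos_pos)
  then show ?thesis by simp
qed

lemma ln_exp_pos: "(0 :: real) < ln (1 + exp y)"
  by (rule ln_gt_zero) simp

lemma log_mu_nonneg: "0 \<le> log_mu y"
  unfolding log_mu_def using mu_int_nonneg ln_exp_pos by (intro divide_nonneg_pos)

lemma log_mu_measurable [measurable]: "log_mu \<in> borel_measurable borel"
proof -
  have [measurable]: "mu_int \<in> borel_measurable borel"
    by (rule borel_measurable_mono) (auto simp: mono_def mu_int_mono)
  show ?thesis unfolding log_mu_def[abs_def] by measurable
qed

lemma mu_int_le_cumul: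
  assumes "0 \<le> y" shows "mu_int (exp y) \<le> log.cumul y + top_mass + 1"
proof -
  have e: "1 / exp y = exp (- y)" by (simp add: exp_minus field_simps)
  have "ennreal (mu_int (exp y)) \<le> big_int (exp (- y)) + 1"
    using mu_int_le_big_int[of "exp y"] dist_fun_finite[of "exp (- y)"] unfolding e by simp
  also have "\<dots> = ennreal (log.cumul y + top_mass + 1)"
    using assms log.cumul_nonneg[of y] by (simp add: big_int_exp top_mass_def flip: ennreal_1)
  finally show ?thesis
    using log.cumul_nonneg[of y] by (subst (asm) ennreal_le_iff) (auto simp: top_mass_def)
qed

lemma cumul_le_mu_int:
  assumes "0 \<le> y" "0 \<le> t" "dist_fun (exp (- y)) \<le> ennreal t"
  shows "log.cumul y \<le> mu_int t"
proof -
  have "ennreal (log.cumul y) \<le> big_int (exp (- y))"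
    unfolding big_int_exp[OF assms(1)] by (intro ennreal_leI) (simp add: top_mass_def)
  also have "\<dots> \<le> ennreal (mu_int t)" using assms by (intro big_int_le_mu_int) auto
  finally show ?thesis by (simp add: mu_int_nonneg)
qed

text \<open>Since t mu(t) is at most the integral of \<open>mu\<close>, a bound on the means gives
  mu(t) <= C ln(1 + t) / t. At t = exp(\<alpha> y) this eventually drops below exp(-y), because
  exp((\<alpha> - 1) y) outgrows the logarithm; \<open>less_mu_iff\<close> translates back to the
  distribution function.\<close>

lemma dist_fun_le_of_bounded:
  assumes bd: "\<forall>\<^sub>F y in at_top. log_mu y \<le> C" and \<alpha>: "1 < \<alpha>"
  shows "\<forall>\<^sub>F y in at_top. dist_fun (exp (- y)) \<le> ennreal (exp (\<alpha> * y))"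
proof -
  have "filterlim (\<lambda>y. \<alpha> * y) at_top at_top"
    using \<alpha> by (intro filterlim_tendsto_pos_mult_at_top[OF tendsto_const _ filterlim_ident]) auto
  from eventually_compose_filterlim[OF bd this]
  have 1: "\<forall>\<^sub>F y in at_top. log_mu (\<alpha> * y) \<le> C" .
  define \<delta> where "\<delta> = \<alpha> - 1"
  have \<delta>: "0 < \<delta>" "\<alpha> = 1 + \<delta>" using \<alpha> by (auto simp: \<delta>_def)
  have "((\<lambda>y. ln (1 + exp ((1 + \<delta>) * y)) * exp (- \<delta> * y)) \<longlongrightarrow> 0) at_top"
    using \<delta>(1) by real_asymp
  from tendsto_mult_right_zero[OF this, of C]
  have "((\<lambda>y. C * ln (1 + exp (\<alpha> * y)) * exp (y - \<alpha> * y)) \<longlongrightarrow> 0) at_top"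
    by (simp add: \<delta>(2) algebra_simps)
  from order_tendstoD(2)[OF this, of 1]
  have 2: "\<forall>\<^sub>F y in at_top. C * ln (1 + exp (\<alpha> * y)) * exp (y - \<alpha> * y) < 1" by simp
  from 1 2 show ?thesis
  proof eventually_elim
    case (elim y)
    let ?t = "exp (\<alpha> * y)"
    have "?t * mu ?t \<le> mu_int ?t" by (rule mu_int_ge) simp
    also have "\<dots> \<le> C * ln (1 + ?t)"
      using elim(1) ln_exp_pos[of "\<alpha> * y"] by (simp add: log_mu_def field_simps)
    finally have "?t * mu ?t * exp (y - \<alpha> * y) \<le> C * ln (1 + ?t) * exp (y - \<alpha> * y)"
      by (intro mult_right_mono) auto
    also have "\<dots> < 1" by (rule elim(2))
    also have "?t * mu ?t * exp (y - \<alpha> * y) = mu ?t * exp y"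
      by (simp add: exp_diff)
    finally have "mu ?t \<le> exp (- y)" by (simp add: exp_minus field_simps)
    then show ?case using less_mu_iff[of "exp (- y)" ?t] by (simp add: not_less)
  qed
qed

lemma cumul_le_log_mu:
  assumes bd: "\<forall>\<^sub>F y in at_top. log_mu y \<le> C" and \<alpha>: "1 < \<alpha>"
  shows "\<forall>\<^sub>F y in at_top. log.cumul y \<le> log_mu (\<alpha> * y) * ln (1 + exp (\<alpha> * y))"
  using dist_fun_le_of_bounded[OF assms] eventually_ge_at_top[of 0]
proof eventually_elim
  case (elim y)
  then have "log.cumul y \<le> mu_int (exp (\<alpha> * y))" by (intro cumul_le_mu_int) auto
  then show ?case using ln_exp_pos[of "\<alpha> * y"] by (simp add: log_mu_def)
qed

text \<open>A crude case \<alpha> = 2 of the preceding comparison; the factor 3 comes from ln(1 +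
  exp(2 y)) <= 3 y for large y.\<close>

lemma cumul_bounded:
  assumes bd: "\<forall>\<^sub>F y in at_top. log_mu y \<le> C"
  obtains D where "0 \<le> D" "\<forall>\<^sub>F y in at_top. log.cumul y \<le> D * y"
proof -
  have 0: "0 \<le> C"
  proof -
    obtain y where "log_mu y \<le> C" using eventually_happens[OF bd] by auto
    then show ?thesis using log_mu_nonneg[of y] by linarith
  qed
  have "filterlim (\<lambda>y::real. 2 * y) at_top at_top"
    by (intro filterlim_tendsto_pos_mult_at_top[OF tendsto_const _ filterlim_ident]) auto
  from eventually_compose_filterlim[OF bd this]
  have 1: "\<forall>\<^sub>F y in at_top. log_mu (2 * y) \<le> C" .
  have 2: "\<forall>\<^sub>F y in at_top. ln (1 + exp (2 * y)) \<le> 3 * (y :: real)" by real_asymp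
  have 3: "\<forall>\<^sub>F y in at_top. log.cumul y \<le> log_mu (2 * y) * ln (1 + exp (2 * y))"
    by (rule cumul_le_log_mu[OF bd]) simp
  from 3 1 2 have "\<forall>\<^sub>F y in at_top. log.cumul y \<le> (3 * C) * y"
  proof eventually_elim
    case (elim y)
    have "log_mu (2 * y) * ln (1 + exp (2 * y)) \<le> C * (3 * y)"
      using elim 0 ln_exp_pos[of "2 * y"] by (intro mult_mono) auto
    then show ?case using elim(1) by simp
  qed
  then show ?thesis using 0 by (intro that[of "3 * C"]) auto
qed

lemma log_mu_le:
  assumes "1 \<le> y"
  shows "log_mu y \<le> log.cumul y / y + (top_mass + 1) / y"
proof -
  have "log_mu y \<le> (log.cumul y + top_mass + 1) / ln (1 + exp y)"
    unfolding log_mu_def using assms ln_exp_pos[of y]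
    by (intro divide_right_mono mu_int_le_cumul) auto
  also have "\<dots> \<le> (log.cumul y + top_mass + 1) / y"
    using assms ln_exp_ge[of y] log.cumul_nonneg[of y]
    by (intro divide_left_mono) (auto simp: top_mass_def add_nonneg_nonneg)
  finally show ?thesis by (simp add: add_divide_distrib)
qed

lemma log_mu_bounded:
  assumes "\<forall>\<^sub>F y in at_top. log.cumul y \<le> C * y"
  shows "\<forall>\<^sub>F y in at_top. log_mu y \<le> C + (top_mass + 1)"
  using assms eventually_ge_at_top[of 1]
proof eventually_elim
  case (elim y)
  have "log.cumul y / y \<le> C" using elim by (simp add: field_simps)
  moreover have "(top_mass + 1) / y \<le> top_mass + 1"
    using elim divide_left_mono[of 1 y "top_mass + 1"] by (simp add: top_mass_def)
  ultimately show ?case using log_mu_le[OF elim(2)] by linarith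
qed

text \<open>The mean at y is squeezed between cumul(y/\<alpha>)/ln(1 + exp y), whose limit is
  l/\<alpha>, and cumul(y)/y plus a null term.\<close>

lemma log_mu_of_cumul:
  assumes "limit_notion R" and l: "R (\<lambda>y. log.cumul y / y) l" and bd: "\<forall>\<^sub>F y in at_top. log_mu y \<le> C"
  shows "R log_mu l"
proof -
  interpret limit_notion R by fact
  have l0: "0 \<le> l"
    by (rule nonneg[OF l]) (auto intro!: eventually_mono[OF eventually_gt_at_top[of 0]] divide_nonneg_pos log.cumul_nonneg)
  obtain D where D: "0 \<le> D" "\<forall>\<^sub>F y in at_top. log.cumul y \<le> D * y" using cumul_bounded[OF bd] .
  have b_bd: "\<forall>\<^sub>F y in at_top. \<bar>log.cumul y / y\<bar> \<le> D"
    using D(2) eventually_gt_at_top[of 0]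
    by eventually_elim (simp add: field_simps log.cumul_nonneg)
  show ?thesis
  proof (rule squeeze)
    fix e :: real assume e: "0 < e"
    \<comment> \<open>Chosen so that l/\<alpha> >= l - e, also when l = 0.\<close>
    define \<alpha> where "\<alpha> = 1 + e / (l + 1)"
    have \<alpha>: "1 < \<alpha>" "l - e \<le> 1 / \<alpha> * l"
    proof -
      show a: "1 < \<alpha>" using e l0 by (simp add: \<alpha>_def)
      have "(l - e) * \<alpha> = l - e * ((e + 1) / (l + 1))"
        using l0 by (simp add: \<alpha>_def field_simps)
      also have "\<dots> \<le> l" using e l0 by simp
      finally show "l - e \<le> 1 / \<alpha> * l" using a by (simp add: field_simps)
    qed
    have "R (\<lambda>y. log.cumul y / y * (y / ln (1 + exp (\<alpha> * y)))) (1 / \<alpha> * l)"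
    proof (rule times_convergent[OF l _ b_bd])
      have "0 < \<alpha>" using \<alpha> by simp
      then have "((\<lambda>y. y / ln (1 + exp (\<alpha> * y))) \<longlongrightarrow> inverse \<alpha>) at_top" by real_asymp
      then show "((\<lambda>y. y / ln (1 + exp (\<alpha> * y))) \<longlongrightarrow> 1 / \<alpha>) at_top"
        by (simp add: inverse_eq_divide)
    qed measurable
    then have R1: "R (\<lambda>y. log.cumul (1 / \<alpha> * y) / (1 / \<alpha> * y) * ((1 / \<alpha> * y) / ln (1 + exp (\<alpha> * (1 / \<alpha> * y))))) (1 / \<alpha> * l)"
      by (rule dilate) (use \<alpha> in simp)
    have "filterlim (\<lambda>y. 1 / \<alpha> * y) at_top at_top"
      using \<alpha> by (intro filterlim_tendsto_pos_mult_at_top[OF tendsto_const _ filterlim_ident]) auto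
    from eventually_compose_filterlim[OF cumul_le_log_mu[OF bd \<alpha>(1)] this]
    have ev1: "\<forall>\<^sub>F y in at_top. log.cumul (1 / \<alpha> * y) / (1 / \<alpha> * y) * ((1 / \<alpha> * y) / ln (1 + exp (\<alpha> * (1 / \<alpha> * y)))) \<le> log_mu y"
      using eventually_gt_at_top[of 0]
    proof eventually_elim
      case (elim y)
      then show ?case using \<alpha> ln_exp_pos[of y] by (simp add: field_simps)
    qed
    have R2: "R (\<lambda>y. log.cumul y / y + (top_mass + 1) / y) (l + 0)"
    proof (intro add l conv)
      show "((\<lambda>y. (top_mass + 1) / y) \<longlongrightarrow> 0) at_top" by real_asymp
    qed measurable
    have ev2: "\<forall>\<^sub>F y in at_top. log_mu y \<le> log.cumul y / y + (top_mass + 1) / y"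
      using eventually_ge_at_top[of 1] by eventually_elim (rule log_mu_le)
    show "\<exists>g h a b. R g a \<and> R h b \<and> (\<forall>\<^sub>F x in at_top. g x \<le> log_mu x) \<and>
          (\<forall>\<^sub>F x in at_top. log_mu x \<le> h x) \<and> l - e \<le> a \<and> b \<le> l + e"
      by (rule exI, rule exI, rule exI, rule exI, intro conjI, rule R1, rule R2, rule ev1, rule ev2)
        (use \<alpha>(2) e in auto)
  qed simp
qed

text \<open>The same two inequalities, solved for \<open>cumul\<close>: the dilation by \<alpha> now
  sits in the upper bound, whose limit is \<alpha> m.\<close>

lemma cumul_of_log_mu:
  assumes "limit_notion R" and m: "R log_mu m" and bd: "\<forall>\<^sub>F y in at_top. log_mu y \<le> C"
  shows "R (\<lambda>y. log.cumul y / y) m"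
proof -
  interpret limit_notion R by fact
  have m0: "0 \<le> m" by (rule nonneg[OF m]) (simp add: log_mu_nonneg)
  have bd': "\<forall>\<^sub>F y in at_top. \<bar>log_mu y\<bar> \<le> C" using bd by (simp add: log_mu_nonneg)
  show ?thesis
  proof (rule squeeze)
    fix e :: real assume e: "0 < e"
    define \<alpha> where "\<alpha> = 1 + e / (m + 1)"
    have \<alpha>: "1 < \<alpha>" "\<alpha> * m \<le> m + e"
      using e m0 by (auto simp: \<alpha>_def field_simps)
    have R1: "R (\<lambda>y. log_mu y * (ln (1 + exp y) / y) + (- (top_mass + 1)) / y) (1 * m + 0)"
    proof (intro add times_convergent[OF m _ bd'] conv)
      show "((\<lambda>y::real. ln (1 + exp y) / y) \<longlongrightarrow> 1) at_top" by real_asymp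
      show "((\<lambda>y. - (top_mass + 1) / y) \<longlongrightarrow> 0) at_top" by real_asymp
    qed measurable
    have ev1: "\<forall>\<^sub>F y in at_top. log_mu y * (ln (1 + exp y) / y) + (- (top_mass + 1)) / y \<le> log.cumul y / y"
      using eventually_gt_at_top[of 0]
    proof eventually_elim
      case (elim y)
      have "mu_int (exp y) - (top_mass + 1) \<le> log.cumul y" using mu_int_le_cumul[of y] elim by simp
      then have "(mu_int (exp y) - (top_mass + 1)) / y \<le> log.cumul y / y"
        using elim by (intro divide_right_mono) auto
      then show ?case using ln_exp_pos[of y] by (simp add: log_mu_def diff_divide_distrib add_divide_distrib)
    qed
    have "R (\<lambda>y. log_mu y * (ln (1 + exp y) / (1 / \<alpha> * y))) (\<alpha> * m)"
    proof (rule times_convergent[OF m _ bd'])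
      have "((\<lambda>y::real. ln (1 + exp y) / y) \<longlongrightarrow> 1) at_top" by real_asymp
      from tendsto_mult_left[OF this, of \<alpha>]
      show "((\<lambda>y. ln (1 + exp y) / (1 / \<alpha> * y)) \<longlongrightarrow> \<alpha>) at_top" by (simp add: mult.commute)
    qed measurable
    then have R2: "R (\<lambda>y. log_mu (\<alpha> * y) * (ln (1 + exp (\<alpha> * y)) / (1 / \<alpha> * (\<alpha> * y)))) (\<alpha> * m)"
      by (rule dilate) (use \<alpha> in simp)
    have ev2: "\<forall>\<^sub>F y in at_top. log.cumul y / y \<le> log_mu (\<alpha> * y) * (ln (1 + exp (\<alpha> * y)) / (1 / \<alpha> * (\<alpha> * y)))"
      using cumul_le_log_mu[OF bd \<alpha>(1)] eventually_gt_at_top[of 0]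
    proof eventually_elim
      case (elim y)
      then have "log.cumul y / y \<le> log_mu (\<alpha> * y) * ln (1 + exp (\<alpha> * y)) / y"
        by (intro divide_right_mono) auto
      then show ?case using \<alpha> by simp
    qed
    show "\<exists>g h a b. R g a \<and> R h b \<and> (\<forall>\<^sub>F x in at_top. g x \<le> log.cumul x / x) \<and>
          (\<forall>\<^sub>F x in at_top. log.cumul x / x \<le> h x) \<and> m - e \<le> a \<and> b \<le> m + e"
      by (rule exI, rule exI, rule exI, rule exI, intro conjI, rule R1, rule R2, rule ev1, rule ev2)
        (use \<alpha>(2) e in auto)
  qed simp
qed

end


section \<open>Zeta functions\<close>

lemma (in rearrangement) dist_fun_markov:
  assumes "0 < x" "0 < q"
  shows "ennreal (x powr q) * dist_fun x \<le> (\<integral>\<^sup>+u. ennreal (u powr q) \<partial>\<rho>)"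
proof -
  have "ennreal (x powr q) * dist_fun x = (\<integral>\<^sup>+u. ennreal (x powr q) * indicator {x<..} u \<partial>\<rho>)"
    by (simp add: nn_integral_cmult dist_fun_def)
  also have "\<dots> \<le> (\<integral>\<^sup>+u. ennreal (u powr q) \<partial>\<rho>)"
    using assms by (intro nn_integral_mono) (auto simp: indicator_def intro!: ennreal_leI powr_mono2)
  finally show ?thesis .
qed

lemma (in rearrangement) fin_rearrangement_if_power_int:
  assumes "0 < q" "(\<integral>\<^sup>+u. ennreal (u powr q) \<partial>\<rho>) < \<infinity>"
  shows "fin_rearrangement \<rho> K"
proof unfold_locales
  fix x :: real assume x: "0 < x"
  have "ennreal (x powr q) * dist_fun x < \<infinity>"
    using dist_fun_markov[OF x assms(1)] assms(2) by (rule order_le_less_trans)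
  moreover have "ennreal (x powr q) \<noteq> 0" using x by simp
  ultimately show "dist_fun x < \<infinity>"
    by (metis ennreal_mult_eq_top_iff infinity_ennreal_def less_top top.not_eq_extremum)
qed

text \<open>The logarithmic form of membership in L^(1,\<infinity>). Both alternatives in (a) lead
  here, and the limit theorems proceed from this bound.\<close>

locale bounded_rearrangement = fin_rearrangement +
  assumes log_mu_bd: "\<exists>C. \<forall>\<^sub>F y in at_top. log_mu y \<le> C"

text \<open>The chain cumul(y) <= e laplace(y) <= e power_int(1 + 1/y) <= e C y turns a bound on the
  zeta side into one on the singular values.\<close>

lemma (in rearrangement) bounded_rearrangement_if_power_int:
  assumes r0: "1 \<le> r0"
    and le: "\<And>r. r0 \<le> r \<Longrightarrow> (\<integral>\<^sup>+u. ennreal (u powr (1 + 1 / r)) \<partial>\<rho>) \<le> ennreal (C * r)"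
  shows "bounded_rearrangement \<rho> K"
proof -
  have "(\<integral>\<^sup>+u. ennreal (u powr (1 + 1 / r0)) \<partial>\<rho>) < \<infinity>"
    using le[OF order_refl] by (rule order_le_less_trans) simp
  moreover have "0 < 1 + 1 / r0" using r0 by (simp add: add_pos_nonneg)
  ultimately interpret fin_rearrangement \<rho> K by (intro fin_rearrangement_if_power_int)
  have "\<forall>\<^sub>F y in at_top. log.cumul y \<le> (exp 1 * max 0 C) * y"
    using eventually_ge_at_top[of r0]
  proof eventually_elim
    case (elim y)
    then have y: "1 \<le> y" using r0 by simp
    have "ennreal (log.cumul y) \<le> ennreal (exp 1) * log.laplace y"
      using y by (intro log.cumul_le_laplace) simp
    also have "\<dots> \<le> ennreal (exp 1) * power_int (1 + 1 / y)"
      unfolding power_int_split[OF y] by (intro mult_left_mono) auto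
    also have "\<dots> \<le> ennreal (exp 1) * ennreal (max 0 C * y)"
    proof (rule mult_left_mono)
      have "power_int (1 + 1 / y) \<le> ennreal (C * y)"
        unfolding power_int_def by (rule le[OF elim])
      also have "\<dots> \<le> ennreal (max 0 C * y)" using y by (intro ennreal_leI mult_right_mono) auto
      finally show "power_int (1 + 1 / y) \<le> ennreal (max 0 C * y)" .
    qed simp
    also have "\<dots> = ennreal (exp 1 * max 0 C * y)"
      using y by (simp add: mult.assoc flip: ennreal_mult)
    finally show ?case using y by (subst (asm) ennreal_le_iff) auto
  qed
  from log_mu_bounded[OF this] show ?thesis by unfold_locales blast
qed

context bounded_rearrangement
begin

lemma laplace_linear:
  obtains C D where "0 \<le> C" "0 \<le> D" "\<And>r. 0 < r \<Longrightarrow> log.laplace r \<le> ennreal (C * r + D)"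
proof -
  obtain C where "\<forall>\<^sub>F y in at_top. log_mu y \<le> C" using log_mu_bd by blast
  then obtain D where D: "0 \<le> D" "\<forall>\<^sub>F y in at_top. log.cumul y \<le> D * y" by (rule cumul_bounded)
  obtain E where "0 \<le> E" "\<And>r. 0 < r \<Longrightarrow> log.laplace r \<le> ennreal (D * r + E)"
    using log.laplace_bounded[OF D(2,1)] by blast
  then show ?thesis using D(1) that by blast
qed

sublocale log: finite_laplace log_measure
proof
  fix r :: real assume "0 < r"
  obtain C D where "log.laplace r \<le> ennreal (C * r + D)" using laplace_linear \<open>0 < r\<close> by metis
  then show "log.laplace r < \<infinity>" by (rule order_le_less_trans) simp
qed

lemma lap_bounded: "\<exists>C. \<forall>\<^sub>F r in at_top. \<bar>log.lap r / r\<bar> \<le> C"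
proof -
  obtain C D where CD: "0 \<le> C" "0 \<le> D" "\<And>r. 0 < r \<Longrightarrow> log.laplace r \<le> ennreal (C * r + D)"
    using laplace_linear by metis
  have "\<forall>\<^sub>F r in at_top. \<bar>log.lap r / r\<bar> \<le> C + D"
    using eventually_ge_at_top[of 1]
  proof eventually_elim
    case (elim r)
    then have r: "0 < r" by simp
    have "log.lap r \<le> C * r + D"
      using CD(3)[OF r] CD(1,2) r unfolding log.laplace_lap[OF r] by (subst (asm) ennreal_le_iff) auto
    also have "\<dots> \<le> (C + D) * r"
      using elim CD(2) by (simp add: distrib_right mult_left_mono[of 1 r D, simplified])
    finally show ?case using r log.lap_nonneg[of r] by (simp add: field_simps)
  qed
  then show ?thesis by blast
qed

text \<open>The finite-valued form of the zeta mean. With S = T^p one has T^(p + 1/r) = S^(1 + 1/(p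
  r)), so the transform is taken at p r but divided by r; this is the origin of the factor p in the
  theorem.\<close>

definition zeta_fun :: "real \<Rightarrow> real \<Rightarrow> real" where
  "zeta_fun p r = (log.lap (p * r) + tail (p * r)) / r"

lemma zeta_fun_measurable [measurable]: "zeta_fun p \<in> borel_measurable borel"
  unfolding zeta_fun_def[abs_def] by measurable

lemma power_int_zeta:
  assumes "0 < r" "1 \<le> p * r"
  shows "ennreal (1 / r) * power_int (1 + 1 / (p * r)) = ennreal (zeta_fun p r)"
  using assms log.lap_nonneg[of "p * r"] tail_nonneg[of "p * r"]
  by (simp add: power_int_split log.laplace_lap zeta_fun_def flip: ennreal_plus ennreal_mult)

lemma tail_null:
  assumes "0 < c" shows "((\<lambda>r. tail (c * r) / r) \<longlongrightarrow> 0) at_top"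
proof (rule Lim_null_comparison)
  show "\<forall>\<^sub>F r in at_top. norm (tail (c * r) / r) \<le> tail_max / r"
    using eventually_ge_at_top[of "1 / c"] eventually_gt_at_top[of 0]
  proof eventually_elim
    case (elim r)
    then have "1 \<le> c * r" using assms by (simp add: field_simps)
    then show ?case using elim tail_le[of "c * r"] tail_nonneg[of "c * r"]
      by (simp add: divide_right_mono)
  qed
  show "((\<lambda>r. tail_max / r) \<longlongrightarrow> 0) at_top" by real_asymp
qed

lemma zeta_fun_of_lap:
  assumes "limit_notion R" "0 < p" and l: "R (\<lambda>r. log.lap r / r) l"
  shows "R (zeta_fun p) (p * l)"
proof -
  interpret limit_notion R by fact
  have "R (\<lambda>r. p * (log.lap (p * r) / (p * r)) + tail (p * r) / r) (p * l + 0)"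
    using assms tail_null[OF assms(2)]
    by (intro add conv cmult dilate[OF l]) auto
  moreover have "p * (log.lap (p * r) / (p * r)) + tail (p * r) / r = zeta_fun p r" for r
    using assms by (simp add: zeta_fun_def add_divide_distrib)
  ultimately show ?thesis by simp
qed

lemma lap_of_zeta_fun:
  assumes "0 < p" and l: "((zeta_fun p) \<longlongrightarrow> p * l) at_top"
  shows "((\<lambda>r. log.lap r / r) \<longlongrightarrow> l) at_top"
proof -
  have "((\<lambda>r. 1 / p * zeta_fun p (1 / p * r) + (- 1) * (tail (1 * r) / r)) \<longlongrightarrow> 1 / p * (p * l) + (- 1) * 0) at_top"
    using assms by (intro lim.add lim.cmult lim.dilate[OF l] tail_null) auto
  moreover have "1 / p * zeta_fun p (1 / p * r) + (- 1) * (tail (1 * r) / r) = log.lap r / r" for r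
    using assms by (simp add: zeta_fun_def add_divide_distrib)
  ultimately show ?thesis using assms by simp
qed

text \<open>The Laplace mean is the starting point because it is bounded and so has a generalised
  limit; Karamata leads from it to the singular values and a dilation by p leads to the zeta
  mean.\<close>

theorem limit_transfer:
  assumes "limit_notion R" "0 < p" "R (\<lambda>r. log.lap r / r) l"
  shows "R (zeta_fun p) (p * l)" "R log_mu l"
proof -
  show "R (zeta_fun p) (p * l)" by (rule zeta_fun_of_lap[OF assms])
  show "R log_mu l"
    using log_mu_bd log_mu_of_cumul[OF assms(1) log.karamata[OF assms(1,3)]] by blast
qed

text \<open>One direction is Karamata's; the other runs from the singular values to
  \<open>cumul\<close>, and by the Abelian theorem to the Laplace transform.\<close>

theorem true_limit_iff:
  assumes "0 < p"
  shows "((zeta_fun p) \<longlongrightarrow> p * l) at_top \<longleftrightarrow> (log_mu \<longlongrightarrow> l) at_top"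
proof
  assume "((zeta_fun p) \<longlongrightarrow> p * l) at_top"
  from limit_transfer(2)[OF limit_notion_tendsto assms lap_of_zeta_fun[OF assms this]]
  show "(log_mu \<longlongrightarrow> l) at_top" .
next
  assume l: "(log_mu \<longlongrightarrow> l) at_top"
  obtain C where "\<forall>\<^sub>F y in at_top. log_mu y \<le> C" using log_mu_bd by blast
  have "((\<lambda>y. log.cumul y / y) \<longlongrightarrow> l) at_top"
    by (rule cumul_of_log_mu[where R="\<lambda>f l. (f \<longlongrightarrow> l) at_top", OF limit_notion_tendsto l])
      (rule \<open>\<forall>\<^sub>F y in at_top. log_mu y \<le> C\<close>)
  then have "((\<lambda>r. log.lap r / r) \<longlongrightarrow> l) at_top" by (rule log.abel)
  then show "((zeta_fun p) \<longlongrightarrow> p * l) at_top"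
    by (rule zeta_fun_of_lap[where R="\<lambda>f l. (f \<longlongrightarrow> l) at_top", OF limit_notion_tendsto assms])
qed

end

section \<open>Generalised limits\<close>

lemma L_infinity_borel:
  assumes "F \<in> borel_measurable borel" "\<And>x. cmod (F x) \<le> C"
  shows "F \<in> L_infinity pos_reals_measure" "F \<in> L_infinity lebesgue"
proof -
  have "F \<in> borel_measurable lebesgue" using assms(1) by (intro measurable_completion) simp
  then show "F \<in> L_infinity pos_reals_measure" "F \<in> L_infinity lebesgue"
    using assms(2) by (auto simp: L_infinity_def intro: measurable_restrict_space1)
qed

text \<open>Admissibility bounds the state by the essential upper limit, which is at most
  \<open>c\<close> as soon as the function is so beyond some N.\<close>

lemma admissible_le:
  assumes \<omega>: "admissible_state \<omega>" and f: "(\<lambda>x. complex_of_real (f x)) \<in> L_infinity pos_reals_measure"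
    and le: "\<forall>\<^sub>F x in at_top. f x \<le> c"
  shows "Re (\<omega> (\<lambda>x. complex_of_real (f x))) \<le> c"
proof -
  obtain N where N: "0 < N" "\<And>x. N < x \<Longrightarrow> f x \<le> c"
    using le by (auto simp: eventually_at_top_linorder) (metis less_imp_le less_max_iff_disj max.strict_boundedE zero_less_one)
  have [measurable]: "(\<lambda>x. complex_of_real (f x)) \<in> borel_measurable pos_reals_measure"
    using f by (simp add: L_infinity_def)
  have "(\<lambda>x. Re (complex_of_real (f x))) \<in> borel_measurable pos_reals_measure" by measurable
  then have "f \<in> borel_measurable (lebesgue_on {0<..})" by simp
  then have m: "f \<in> borel_measurable (lebesgue_on {N<..})"
    by (rule measurable_restrict_mono) (use N in auto)
  have "esssup (lebesgue_on {N<..}) (\<lambda>t. ereal (f t)) \<le> ereal c"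
    by (rule esssup_I) (use m N in \<open>auto intro!: AE_I2 simp: space_restrict_space\<close>)
  then have "ess_limsup f \<le> ereal c"
    unfolding ess_limsup_def using N(1) by (intro INF_lower2[of N]) auto
  moreover have "ereal (Re (\<omega> (\<lambda>x. complex_of_real (f x)))) \<le> ess_limsup f"
    using \<omega> f unfolding admissible_state_def by blast
  ultimately show ?thesis using order_trans ereal_less_eq(3) by blast
qed

text \<open>The value of \<omega> composed with L on a bounded Borel representative. The function
  itself may be unbounded or irregular for small arguments, where a state in L_infinity could not
  read it.\<close>

definition gen_lim :: "((real \<Rightarrow> complex) \<Rightarrow> complex) \<Rightarrow> (real \<Rightarrow> real) \<Rightarrow> real \<Rightarrow> bool" where
  "gen_lim \<omega> f l \<longleftrightarrow> (\<exists>g. g \<in> borel_measurable borel \<and> (\<exists>C. \<forall>x. \<bar>g x\<bar> \<le> C) \<and>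
     (\<forall>\<^sub>F x in at_top. f x = g x) \<and> \<omega> (\<lambda>x. complex_of_real (g (ln x))) = complex_of_real l)"

locale invariant_state =
  fixes \<omega> :: "(real \<Rightarrow> complex) \<Rightarrow> complex"
  assumes adm: "admissible_state \<omega>" and inv: "\<And>\<alpha>. 1 < \<alpha> \<Longrightarrow> P_invariant \<alpha> \<omega>"
begin

abbreviation lg :: "(real \<Rightarrow> real) \<Rightarrow> real \<Rightarrow> complex" where
  "lg g \<equiv> (\<lambda>x. complex_of_real (g (ln x)))"

definition state_val :: "(real \<Rightarrow> real) \<Rightarrow> real" where "state_val g = Re (\<omega> (lg g))"

definition bdd_fun :: "(real \<Rightarrow> real) set" where
  "bdd_fun = {g \<in> borel_measurable borel. \<exists>C. \<forall>x. \<bar>g x\<bar> \<le> C}"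

lemma bdd_fun_measurable: "g \<in> bdd_fun \<Longrightarrow> g \<in> borel_measurable borel" by (simp add: bdd_fun_def)

lemma lg_L_infinity: "g \<in> bdd_fun \<Longrightarrow> lg g \<in> L_infinity pos_reals_measure"
proof -
  assume g: "g \<in> bdd_fun"
  note [measurable] = bdd_fun_measurable[OF g]
  obtain C where "\<And>x. \<bar>g x\<bar> \<le> C" using g by (auto simp: bdd_fun_def)
  then show ?thesis by (intro L_infinity_borel(1)[where C=C]) auto
qed

lemma state: "state_on pos_reals_measure \<omega>"
  using adm by (simp add: admissible_state_def)

lemma bdd_fun_add: "f \<in> bdd_fun \<Longrightarrow> g \<in> bdd_fun \<Longrightarrow> (\<lambda>x. f x + g x) \<in> bdd_fun"
proof -
  assume a: "f \<in> bdd_fun" "g \<in> bdd_fun"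
  note [measurable] = a[THEN bdd_fun_measurable]
  obtain C D where "\<And>x. \<bar>f x\<bar> \<le> C" "\<And>x. \<bar>g x\<bar> \<le> D" using a by (auto simp: bdd_fun_def)
  then have "\<bar>f x + g x\<bar> \<le> C + D" for x by (meson abs_triangle_ineq add_mono order_trans)
  then show ?thesis by (auto simp: bdd_fun_def)
qed

lemma bdd_fun_cmult: "f \<in> bdd_fun \<Longrightarrow> (\<lambda>x. c * f x) \<in> bdd_fun"
proof -
  assume a: "f \<in> bdd_fun"
  note [measurable] = a[THEN bdd_fun_measurable]
  obtain C where C: "\<And>x. \<bar>f x\<bar> \<le> C" using a by (auto simp: bdd_fun_def)
  then have "\<bar>c * f x\<bar> \<le> \<bar>c\<bar> * C" for x by (simp add: abs_mult mult_left_mono)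
  then show ?thesis by (auto simp: bdd_fun_def)
qed

lemma bdd_fun_const: "(\<lambda>x. c) \<in> bdd_fun" by (auto simp: bdd_fun_def)

lemma bdd_fun_compose: "f \<in> bdd_fun \<Longrightarrow> (\<lambda>x. f (c * x)) \<in> bdd_fun"
proof -
  assume a: "f \<in> bdd_fun"
  note [measurable] = a[THEN bdd_fun_measurable]
  show ?thesis using a by (auto simp: bdd_fun_def)
qed

lemma state_add:
  "F \<in> L_infinity pos_reals_measure \<Longrightarrow> G \<in> L_infinity pos_reals_measure \<Longrightarrow> \<omega> (\<lambda>x. F x + G x) = \<omega> F + \<omega> G"
  using state unfolding state_on_def by blast

lemma state_cmult: "F \<in> L_infinity pos_reals_measure \<Longrightarrow> \<omega> (\<lambda>x. c * F x) = c * \<omega> F"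
  using state unfolding state_on_def by blast

lemma state_nonneg:
  "F \<in> L_infinity pos_reals_measure \<Longrightarrow> AE x in pos_reals_measure. F x \<in> \<real>\<^sub>\<ge>\<^sub>0 \<Longrightarrow> \<omega> F \<in> \<real>\<^sub>\<ge>\<^sub>0"
  using state unfolding state_on_def by blast

lemma state_cong:
  "F \<in> L_infinity pos_reals_measure \<Longrightarrow> G \<in> L_infinity pos_reals_measure \<Longrightarrow>
   AE x in pos_reals_measure. F x = G x \<Longrightarrow> \<omega> F = \<omega> G"
  using state unfolding state_on_def by blast

lemma omega_add: "f \<in> bdd_fun \<Longrightarrow> g \<in> bdd_fun \<Longrightarrow> \<omega> (lg (\<lambda>x. f x + g x)) = \<omega> (lg f) + \<omega> (lg g)"
  unfolding of_real_add by (intro state_add lg_L_infinity)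

lemma omega_cmult: "f \<in> bdd_fun \<Longrightarrow> \<omega> (lg (\<lambda>x. c * f x)) = complex_of_real c * \<omega> (lg f)"
  unfolding of_real_mult by (intro state_cmult lg_L_infinity)

lemma omega_const: "\<omega> (lg (\<lambda>x. c)) = complex_of_real c"
proof -
  have "\<omega> (\<lambda>x. 1) = 1" using state unfolding state_on_def by blast
  then show ?thesis using omega_cmult[OF bdd_fun_const[of 1], of c] by simp
qed

text \<open>Adding a bound makes the function nonnegative; its value is then a nonnegative real, and
  so the imaginary part vanishes.\<close>

lemma omega_real: "f \<in> bdd_fun \<Longrightarrow> \<omega> (lg f) = complex_of_real (state_val f)"
proof -
  assume f: "f \<in> bdd_fun"
  obtain C where C: "\<And>x. \<bar>f x\<bar> \<le> C" using f by (auto simp: bdd_fun_def)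
  have "0 \<le> f x + C" for x using C[of x] by linarith
  then have "AE x in pos_reals_measure. lg (\<lambda>x. f x + C) x \<in> \<real>\<^sub>\<ge>\<^sub>0"
    by (intro AE_I2) (simp add: nonneg_Reals_of_real_iff del: of_real_add)
  moreover have "lg (\<lambda>x. f x + C) \<in> L_infinity pos_reals_measure"
    by (intro lg_L_infinity bdd_fun_add f bdd_fun_const)
  ultimately have "\<omega> (lg (\<lambda>x. f x + C)) \<in> \<real>\<^sub>\<ge>\<^sub>0" by (intro state_nonneg)
  then have "\<omega> (lg f) + complex_of_real C \<in> \<real>\<^sub>\<ge>\<^sub>0"
    by (simp only: omega_add[OF f bdd_fun_const] omega_const)
  then have "Im (\<omega> (lg f)) = 0" by (simp add: complex_nonneg_Reals_iff)
  then show ?thesis by (simp add: state_val_def complex_eq_iff)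
qed

lemma state_val_add: "f \<in> bdd_fun \<Longrightarrow> g \<in> bdd_fun \<Longrightarrow> state_val (\<lambda>x. f x + g x) = state_val f + state_val g"
  unfolding state_val_def by (subst omega_add) auto

lemma state_val_cmult: "f \<in> bdd_fun \<Longrightarrow> state_val (\<lambda>x. c * f x) = c * state_val f"
  unfolding state_val_def by (subst omega_cmult) auto

lemma state_val_le: "f \<in> bdd_fun \<Longrightarrow> \<forall>\<^sub>F x in at_top. f x \<le> c \<Longrightarrow> state_val f \<le> c"
  unfolding state_val_def
  by (rule admissible_le[OF adm lg_L_infinity]) (auto intro: eventually_compose_filterlim ln_at_top)

lemma state_val_mono:
  assumes f: "f \<in> bdd_fun" and g: "g \<in> bdd_fun" and le: "\<forall>\<^sub>F x in at_top. f x \<le> g x"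
  shows "state_val f \<le> state_val g"
proof -
  have "state_val (\<lambda>x. f x + (-1) * g x) \<le> 0"
  proof (rule state_val_le)
    show "(\<lambda>x. f x + (-1) * g x) \<in> bdd_fun" by (intro bdd_fun_add bdd_fun_cmult f g)
    show "\<forall>\<^sub>F x in at_top. f x + (-1) * g x \<le> 0" using le by eventually_elim simp
  qed
  then have "state_val f + (-1) * state_val g \<le> 0" by (simp only: state_val_add[OF f bdd_fun_cmult[OF g]] state_val_cmult[OF g])
  then show ?thesis by simp
qed

lemma state_val_const: "state_val (\<lambda>x. c) = c"
  unfolding state_val_def omega_const by simp

text \<open>ln(x^c) = c ln x on the positive reals, so invariance under P^c becomes invariance under
  dilation by c after composition with ln.\<close>

lemma state_val_dilate_gt_1:
  assumes f: "f \<in> bdd_fun" and c: "1 < c" shows "state_val (\<lambda>x. f (c * x)) = state_val f"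
proof -
  have Li: "lg f \<in> L_infinity pos_reals_measure" "lg (\<lambda>x. f (c * x)) \<in> L_infinity pos_reals_measure"
    by (intro lg_L_infinity bdd_fun_compose f)+
  note [measurable] = bdd_fun_measurable[OF f]
  obtain C where C: "\<And>x. \<bar>f x\<bar> \<le> C" using f by (auto simp: bdd_fun_def)
  have "(\<lambda>x. lg f (x powr c)) \<in> L_infinity pos_reals_measure"
    by (rule L_infinity_borel(1)[where C=C]) (use C in auto)
  moreover have "AE x in pos_reals_measure. lg f (x powr c) = lg (\<lambda>x. f (c * x)) x"
    by (intro AE_I2) (simp add: space_restrict_space ln_powr)
  ultimately have "\<omega> (\<lambda>x. lg f (x powr c)) = \<omega> (lg (\<lambda>x. f (c * x)))"
    by (intro state_cong Li(2))
  moreover have "\<omega> (\<lambda>x. lg f (x powr c)) = \<omega> (lg f)"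
    by (rule bspec[OF inv[OF c, unfolded P_invariant_def] Li(1)])
  ultimately show ?thesis by (simp add: state_val_def)
qed

lemma state_val_dilate:
  assumes f: "f \<in> bdd_fun" and c: "0 < c" shows "state_val (\<lambda>x. f (c * x)) = state_val f"
proof -
  consider "1 < c" | "c = 1" | "1 < 1 / c" using c by (auto simp: field_simps) linarith
  then show ?thesis
  proof cases
    \<comment> \<open>For c < 1 the reciprocal dilation is applied to the already dilated
      function.\<close>
    case 3
    from state_val_dilate_gt_1[OF bdd_fun_compose[OF f, of c] this] c show ?thesis by simp
  qed (auto simp: state_val_dilate_gt_1[OF f])
qed

lemma gen_lim_iff:
  "gen_lim \<omega> f l \<longleftrightarrow> (\<exists>g\<in>bdd_fun. (\<forall>\<^sub>F x in at_top. f x = g x) \<and> state_val g = l)"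
  unfolding gen_lim_def using omega_real by (auto simp: bdd_fun_def) (metis of_real_eq_iff)+

lemma truncate_bdd_fun:
  assumes "f \<in> borel_measurable borel" "\<forall>\<^sub>F x in at_top. \<bar>f x\<bar> \<le> C"
  obtains g where "g \<in> bdd_fun" "\<forall>\<^sub>F x in at_top. f x = g x"
proof -
  note [measurable] = assms(1)
  obtain X where X: "\<And>x. X \<le> x \<Longrightarrow> \<bar>f x\<bar> \<le> C" using assms(2) by (auto simp: eventually_at_top_linorder)
  define g where "g x = (if X \<le> x then f x else 0)" for x
  have [measurable]: "g \<in> borel_measurable borel" unfolding g_def[abs_def] by measurable
  have "\<bar>g x\<bar> \<le> max 0 C" for x using X[of x] by (auto simp: g_def)
  then have "g \<in> bdd_fun" by (auto simp: bdd_fun_def)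
  moreover have "\<forall>\<^sub>F x in at_top. f x = g x"
    using eventually_ge_at_top[of X] by eventually_elim (simp add: g_def)
  ultimately show ?thesis by (rule that)
qed

lemma gen_lim_exists:
  assumes "f \<in> borel_measurable borel" "\<forall>\<^sub>F x in at_top. \<bar>f x\<bar> \<le> C"
  shows "\<exists>l. gen_lim \<omega> f l"
  using truncate_bdd_fun[OF assms] gen_lim_iff by metis

text \<open>Linearity, positivity and dilation invariance pass through the representatives, since
  agreement at large arguments fixes the value of the state.\<close>

lemma limit_notion_gen_lim: "limit_notion (gen_lim \<omega>)"
proof
  fix f g a b assume "gen_lim \<omega> f a" "gen_lim \<omega> g b"
  then obtain f' g' where fg: "f' \<in> bdd_fun" "\<forall>\<^sub>F x in at_top. f x = f' x" "state_val f' = a"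
    "g' \<in> bdd_fun" "\<forall>\<^sub>F x in at_top. g x = g' x" "state_val g' = b" by (auto simp: gen_lim_iff)
  have "\<forall>\<^sub>F x in at_top. f x + g x = f' x + g' x" using fg(2,5) by eventually_elim simp
  then show "gen_lim \<omega> (\<lambda>x. f x + g x) (a + b)"
    unfolding gen_lim_iff using fg by (intro bexI[of _ "\<lambda>x. f' x + g' x"]) (auto simp: state_val_add bdd_fun_add)
next
  fix f a c assume "gen_lim \<omega> f a"
  then obtain f' where f: "f' \<in> bdd_fun" "\<forall>\<^sub>F x in at_top. f x = f' x" "state_val f' = a"
    by (auto simp: gen_lim_iff)
  have "\<forall>\<^sub>F x in at_top. c * f x = c * f' x" using f(2) by eventually_elim simp
  then show "gen_lim \<omega> (\<lambda>x. c * f x) (c * a)"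
    unfolding gen_lim_iff using f by (intro bexI[of _ "\<lambda>x. c * f' x"]) (auto simp: state_val_cmult bdd_fun_cmult)
  assume c: "0 < c"
  then have "filterlim (\<lambda>x. c * x) at_top at_top"
    by (intro filterlim_tendsto_pos_mult_at_top[OF tendsto_const _ filterlim_ident])
  from eventually_compose_filterlim[OF f(2) this]
  show "gen_lim \<omega> (\<lambda>x. f (c * x)) a"
    unfolding gen_lim_iff using f c by (intro bexI[of _ "\<lambda>x. f' (c * x)"]) (auto simp: state_val_dilate bdd_fun_compose)
next
  fix f :: "real \<Rightarrow> real" and a assume f: "f \<in> borel_measurable borel" "(f \<longlongrightarrow> a) at_top"
  have ev: "\<forall>\<^sub>F x in at_top. \<bar>f x - a\<bar> < e" if "0 < e" for e
    using tendstoD[OF f(2) that] by (simp add: dist_real_def)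
  have "\<forall>\<^sub>F x in at_top. \<bar>f x\<bar> \<le> \<bar>a\<bar> + 1"
    using ev[of 1, OF zero_less_one] by eventually_elim linarith
  from truncate_bdd_fun[OF f(1) this] obtain g where g: "g \<in> bdd_fun" "\<forall>\<^sub>F x in at_top. f x = g x" .
  have "\<bar>state_val g - a\<bar> \<le> e" if "0 < e" for e
  proof -
    have "\<forall>\<^sub>F x in at_top. g x \<le> a + e" "\<forall>\<^sub>F x in at_top. a - e \<le> g x"
      using ev[OF that] g(2) by (eventually_elim, linarith)+
    then have "state_val g \<le> a + e" "a - e \<le> state_val g"
      using state_val_le[OF g(1)] state_val_mono[OF bdd_fun_const g(1)] state_val_const by metis+
    then show ?thesis by linarith
  qed
  then have "state_val g = a" using field_le_epsilon[of "\<bar>state_val g - a\<bar>" 0] by simp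
  then show "gen_lim \<omega> f a" unfolding gen_lim_iff using g by blast
next
  fix f a assume "gen_lim \<omega> f a" "\<forall>\<^sub>F x in at_top. 0 \<le> f x"
  then obtain g where g: "g \<in> bdd_fun" "\<forall>\<^sub>F x in at_top. f x = g x" "state_val g = a"
    by (auto simp: gen_lim_iff)
  have "\<forall>\<^sub>F x in at_top. 0 \<le> g x" using g(2) \<open>\<forall>\<^sub>F x in at_top. 0 \<le> f x\<close> by eventually_elim simp
  then show "0 \<le> a" using state_val_mono[OF bdd_fun_const g(1), of 0] by (simp add: state_val_const g(3))
next
  fix f :: "real \<Rightarrow> real" and l assume f: "f \<in> borel_measurable borel" and
    sq: "\<And>e. 0 < e \<Longrightarrow> \<exists>g h a b. gen_lim \<omega> g a \<and> gen_lim \<omega> h b \<and> (\<forall>\<^sub>F x in at_top. g x \<le> f x) \<and>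
          (\<forall>\<^sub>F x in at_top. f x \<le> h x) \<and> l - e \<le> a \<and> b \<le> l + e"
  have sq': "\<exists>g\<in>bdd_fun. \<exists>h\<in>bdd_fun. (\<forall>\<^sub>F x in at_top. g x \<le> f x) \<and> (\<forall>\<^sub>F x in at_top. f x \<le> h x) \<and>
      l - e \<le> state_val g \<and> state_val h \<le> l + e" if e: "0 < e" for e
  proof -
    obtain g h a b where gh: "gen_lim \<omega> g a" "gen_lim \<omega> h b" "\<forall>\<^sub>F x in at_top. g x \<le> f x"
      "\<forall>\<^sub>F x in at_top. f x \<le> h x" "l - e \<le> a" "b \<le> l + e" using sq[OF e] by blast
    obtain g' where g': "g' \<in> bdd_fun" "\<forall>\<^sub>F x in at_top. g x = g' x" "state_val g' = a"
      using gh(1) by (auto simp: gen_lim_iff)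
    obtain h' where h': "h' \<in> bdd_fun" "\<forall>\<^sub>F x in at_top. h x = h' x" "state_val h' = b"
      using gh(2) by (auto simp: gen_lim_iff)
    have "\<forall>\<^sub>F x in at_top. g' x \<le> f x" using gh(3) g'(2) by eventually_elim simp
    moreover have "\<forall>\<^sub>F x in at_top. f x \<le> h' x" using gh(4) h'(2) by eventually_elim simp
    ultimately show ?thesis
      using g' h' gh(5,6) by (intro bexI[of _ g'] bexI[of _ h']) auto
  qed
  \<comment> \<open>The bounds for e = 1 already make \<open>f\<close> eventually bounded, which
    supplies the representative whose value is then pinned down by all e.\<close>
  obtain g h where gh: "g \<in> bdd_fun" "h \<in> bdd_fun" "\<forall>\<^sub>F x in at_top. g x \<le> f x" "\<forall>\<^sub>F x in at_top. f x \<le> h x"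
    using sq'[OF zero_less_one] by blast
  obtain C D where CD: "\<And>x. \<bar>g x\<bar> \<le> C" "\<And>x. \<bar>h x\<bar> \<le> D" using gh(1,2) by (auto simp: bdd_fun_def)
  have "\<forall>\<^sub>F x in at_top. \<bar>f x\<bar> \<le> max C D"
    using gh(3,4)
  proof eventually_elim
    case (elim x)
    then show ?case using CD(1)[of x] CD(2)[of x] by linarith
  qed
  from truncate_bdd_fun[OF f this] obtain F where F: "F \<in> bdd_fun" "\<forall>\<^sub>F x in at_top. f x = F x" .
  have "\<bar>state_val F - l\<bar> \<le> e" if e: "0 < e" for e
  proof -
    obtain g h where gh: "g \<in> bdd_fun" "h \<in> bdd_fun" "\<forall>\<^sub>F x in at_top. g x \<le> f x" "\<forall>\<^sub>F x in at_top. f x \<le> h x"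
      "l - e \<le> state_val g" "state_val h \<le> l + e"
      using sq'[OF e] by blast
    have "\<forall>\<^sub>F x in at_top. g x \<le> F x" using gh(3) F(2) by eventually_elim simp
    moreover have "\<forall>\<^sub>F x in at_top. F x \<le> h x" using gh(4) F(2) by eventually_elim simp
    ultimately have "state_val g \<le> state_val F" "state_val F \<le> state_val h" using state_val_mono gh(1,2) F(1) by auto
    then show ?thesis using gh(5,6) by linarith
  qed
  then have "state_val F = l" using field_le_epsilon[of "\<bar>state_val F - l\<bar>" 0] by simp
  then show "gen_lim \<omega> f l" unfolding gen_lim_iff using F by blast
qed

lemma state_lim_log_transfer:
  assumes "gen_lim \<omega> f l" "\<forall>\<^sub>F r in at_top. \<phi> r = ereal (f r)"
  shows "state_lim lebesgue (log_transfer \<omega>) \<phi> l"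
proof -
  obtain g C where g: "g \<in> borel_measurable borel" "\<And>x. \<bar>g x\<bar> \<le> C" "\<forall>\<^sub>F x in at_top. f x = g x"
    "\<omega> (lg g) = complex_of_real l" using assms(1) by (auto simp: gen_lim_def)
  note [measurable] = g(1)
  have "(\<lambda>t. complex_of_real (g t)) \<in> L_infinity lebesgue"
    by (rule L_infinity_borel(2)[where C=C]) (use g(2) in auto)
  moreover have "\<forall>\<^sub>F r in at_top. \<phi> r = ereal (g r)" using assms(2) g(3) by eventually_elim simp
  moreover have "log_transfer \<omega> (\<lambda>t. complex_of_real (g t)) = complex_of_real l"
    using g(4) by (simp add: log_transfer_def comp_def)
  ultimately show ?thesis unfolding state_lim_def by blast
qed

lemma state_lim_pos_reals:
  assumes "gen_lim \<omega> f l" "\<forall>\<^sub>F t in at_top. M t = f (ln t)"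
  shows "state_lim pos_reals_measure \<omega> (\<lambda>t. ereal (M t)) l"
proof -
  obtain g C where g: "g \<in> borel_measurable borel" "\<And>x. \<bar>g x\<bar> \<le> C" "\<forall>\<^sub>F x in at_top. f x = g x"
    "\<omega> (lg g) = complex_of_real l" using assms(1) by (auto simp: gen_lim_def)
  note [measurable] = g(1)
  have "(\<lambda>t. complex_of_real (g (ln t))) \<in> L_infinity pos_reals_measure"
    by (rule L_infinity_borel(1)[where C=C]) (use g(2) in auto)
  moreover have "\<forall>\<^sub>F t in at_top. ereal (M t) = ereal (g (ln t))"
    using assms(2) eventually_compose_filterlim[OF g(3) ln_at_top] by eventually_elim simp
  ultimately show ?thesis unfolding state_lim_def using g(4) by (intro exI[of _ "\<lambda>t. g (ln t)"]) simp
qed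

text \<open>Two representatives agree for large arguments, so their difference is eventually at most
  0 and so is its value. Used in both directions, this makes the description in
  \<open>dixmier_trace\<close> unambiguous.\<close>

lemma state_lim_unique:
  assumes "state_lim pos_reals_measure \<omega> \<phi> l" "state_lim pos_reals_measure \<omega> \<phi> l'"
  shows "l \<le> l'"
proof -
  obtain g where g: "(\<lambda>t. complex_of_real (g t)) \<in> L_infinity pos_reals_measure"
    "\<forall>\<^sub>F t in at_top. \<phi> t = ereal (g t)" "\<omega> (\<lambda>t. complex_of_real (g t)) = complex_of_real l"
    using assms(1) by (auto simp: state_lim_def)
  obtain h where h: "(\<lambda>t. complex_of_real (h t)) \<in> L_infinity pos_reals_measure"
    "\<forall>\<^sub>F t in at_top. \<phi> t = ereal (h t)" "\<omega> (\<lambda>t. complex_of_real (h t)) = complex_of_real l'"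
    using assms(2) by (auto simp: state_lim_def)
  obtain C D where CD: "AE x in pos_reals_measure. cmod (complex_of_real (g x)) \<le> C"
    "AE x in pos_reals_measure. cmod (complex_of_real (h x)) \<le> D"
    using g(1) h(1) by (auto simp: L_infinity_def)
  have mh: "(\<lambda>t. (-1) * complex_of_real (h t)) \<in> L_infinity pos_reals_measure"
    using h(1) by (auto simp: L_infinity_def)
  have "AE x in pos_reals_measure. cmod (complex_of_real (g x - h x)) \<le> C + D"
    using CD by eventually_elim (unfold norm_of_real, linarith)
  moreover have "(\<lambda>t. complex_of_real (g t - h t)) \<in> borel_measurable pos_reals_measure"
    using g(1) h(1) by (auto simp: L_infinity_def)
  ultimately have L: "(\<lambda>t. complex_of_real (g t - h t)) \<in> L_infinity pos_reals_measure"
    by (auto simp: L_infinity_def)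
  have "\<omega> (\<lambda>t. complex_of_real (g t - h t)) = \<omega> (\<lambda>t. complex_of_real (g t) + (-1) * complex_of_real (h t))"
    by simp
  also have "\<dots> = \<omega> (\<lambda>t. complex_of_real (g t)) + \<omega> (\<lambda>t. (-1) * complex_of_real (h t))"
    by (rule state_add[OF g(1) mh])
  also have "\<omega> (\<lambda>t. (-1) * complex_of_real (h t)) = (-1) * \<omega> (\<lambda>t. complex_of_real (h t))"
    by (rule state_cmult[OF h(1)])
  finally have "Re (\<omega> (\<lambda>t. complex_of_real (g t - h t))) = l - l'" by (simp add: g(3) h(3))
  moreover have "Re (\<omega> (\<lambda>t. complex_of_real (g t - h t))) \<le> 0"
  proof (rule admissible_le[OF adm L])
    show "\<forall>\<^sub>F x in at_top. g x - h x \<le> 0" using g(2) h(2) by eventually_elim simp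
  qed
  ultimately show ?thesis by simp
qed

lemma dixmier_trace_eqI:
  assumes "gen_lim \<omega> f l" "\<forall>\<^sub>F t in at_top. log_mean \<tau> S t = f (ln t)"
  shows "dixmier_trace \<tau> \<omega> S = l"
proof -
  have l: "state_lim pos_reals_measure \<omega> (\<lambda>t. ereal (log_mean \<tau> S t)) l"
    by (rule state_lim_pos_reals[OF assms])
  show ?thesis
    unfolding dixmier_trace_def
  proof (rule the_equality)
    show "state_lim pos_reals_measure \<omega> (\<lambda>t. ereal (log_mean \<tau> S t)) l" by (rule l)
    fix l' assume "state_lim pos_reals_measure \<omega> (\<lambda>t. ereal (log_mean \<tau> S t)) l'"
    from state_lim_unique[OF this l] state_lim_unique[OF l this] show "l' = l" by simp
  qed
qed

end


section \<open>The main theorem\<close>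

lemma psi_pos: "0 < t \<Longrightarrow> 0 < psi p t"
  by (auto simp: psi_def)

section \<open>From traces of powers to boundedness and limits\<close>

context traced_family
begin

lemma rearrangement_push:
  assumes h: "h \<in> bdd_borel {0..K}" and L: "0 \<le> L" "\<And>u. u \<in> {0..K} \<Longrightarrow> 0 \<le> h u \<and> h u \<le> L"
  shows "rearrangement (distr trace_measure borel h) L"
proof
  note [measurable] = bdd_borel_measurable[OF h]
  show "AE u in distr trace_measure borel h. u \<in> {0..L}"
    by (subst AE_distr_iff) (use L(2) in \<open>auto intro!: eventually_mono[OF trace_measure_support]\<close>)
qed (use L in auto)

lemma sing_val_integral_calc:
  assumes h: "h \<in> bdd_borel {0..K}" and L: "0 \<le> L" "\<And>u. u \<in> {0..K} \<Longrightarrow> 0 \<le> h u \<and> h u \<le> L"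
  shows "sing_val_integral \<tau> (calc h) t = rearrangement.mu_int (distr trace_measure borel h) t"
proof -
  interpret R: rearrangement "distr trace_measure borel h" L by (rule rearrangement_push[OF assms])
  have "sing_val \<tau> s (calc h) = R.mu s" for s
    unfolding R.mu_def R.dist_fun_def using h L(2) by (intro sing_val_calc_measure) auto
  then show ?thesis by (simp add: sing_val_integral_def R.mu_int_def)
qed

context
  fixes p :: real
  assumes p: "1 < p"
begin

abbreviation \<rho> :: "real measure" where "\<rho> \<equiv> distr trace_measure borel (\<lambda>u. u powr p)"

lemma rearrangement_rho: "rearrangement \<rho> (K powr p)"
  using p by (intro rearrangement_push bdd_borel_powr) (auto intro: powr_mono2)

lemma trace_powr_rho:
  assumes "0 < r"
  shows "\<tau> (powr_op T (p + 1 / r)) = (\<integral>\<^sup>+u. ennreal (u powr (1 + 1 / (p * r))) \<partial>\<rho>)"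
proof -
  have e: "p * (1 + 1 / (p * r)) = p + 1 / r" using p assms by (simp add: field_simps)
  have "0 < p + 1 / r" using p assms by (simp add: add_pos_pos)
  then show ?thesis
    by (simp add: trace_powr_op nn_integral_distr powr_powr e)
qed

text \<open>With s = p + 1/r the limsup condition concerns large r. Near p the root exponent 1/s
  stays in a compact subset of (0, \<infinity>), so taking roots does not affect
  boundedness.\<close>

lemma zeta_space_iff:
  assumes "positive_op T"
  shows "T \<in> zeta_space N \<tau> p \<longleftrightarrow>
    (\<exists>C r0. \<forall>r\<ge>r0. ennreal (1 / r) * \<tau> (powr_op T (p + 1 / r)) \<le> ennreal C)"
proof
  let ?x = "\<lambda>s. ennreal (s - p) * \<tau> (powr_op T s)"
  assume "T \<in> zeta_space N \<tau> p"
  then have "Limsup (at_right p) (\<lambda>s. ennreal_powr (?x s) (1 / s)) < \<infinity>" by (simp add: zeta_space_def)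
  then obtain c where c: "Limsup (at_right p) (\<lambda>s. ennreal_powr (?x s) (1 / s)) < c" "c < \<infinity>"
    using dense by blast
  from Limsup_lessD[OF c(1)] obtain b where b: "p < b" "\<And>s. p < s \<Longrightarrow> s < b \<Longrightarrow> ennreal_powr (?x s) (1 / s) < c"
    unfolding eventually_at_right_field by blast
  \<comment> \<open>Being at least 1 makes powers of \<open>D\<close> increase with the exponent, so
    D^s <= D^b for all s below b.\<close>
  define D where "D = max 1 (enn2real c)"
  have cD: "c \<le> ennreal D" using c(2) by (cases c) (auto simp: D_def ennreal_leI)
  have "?x s \<le> ennreal (D powr b)" if s: "p < s" "s < b" for s
  proof -
    have lt: "ennreal_powr (?x s) (1 / s) < ennreal D" using b(2)[OF s] cD by simp
    then have fin: "?x s \<noteq> \<infinity>" by (auto simp: ennreal_powr_def)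
    then obtain y where y: "0 \<le> y" "?x s = ennreal y" by (metis ennreal_cases infinity_ennreal_def)
    have "y powr (1 / s) < D"
      using lt fin y by (simp add: ennreal_powr_def ennreal_less_iff)
    then have "(y powr (1 / s)) powr s \<le> D powr s" using s p by (intro powr_mono2) auto
    also have "\<dots> \<le> D powr b" using s by (intro powr_mono) (auto simp: D_def)
    finally have "y \<le> D powr b" using y s p by (simp add: powr_powr)
    then show ?thesis using y by (simp add: ennreal_leI)
  qed note bd = this
  \<comment> \<open>The factor 2 in the threshold makes 1/r strictly less than b - p.\<close>
  have "ennreal (1 / r) * \<tau> (powr_op T (p + 1 / r)) \<le> ennreal (D powr b)" if r: "2 / (b - p) \<le> r" for r
  proof -
    have pos: "0 < 2 / (b - p)" using b by simp
    then have "0 < r" using r by linarith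
    have "1 / r < b - p" using r b(1) \<open>0 < r\<close> by (simp add: field_simps)
    then show ?thesis using bd[of "p + 1 / r"] \<open>0 < r\<close> by simp
  qed
  then show "\<exists>C r0. \<forall>r\<ge>r0. ennreal (1 / r) * \<tau> (powr_op T (p + 1 / r)) \<le> ennreal C" by blast
next
  let ?x = "\<lambda>s. ennreal (s - p) * \<tau> (powr_op T s)"
  assume "\<exists>C r0. \<forall>r\<ge>r0. ennreal (1 / r) * \<tau> (powr_op T (p + 1 / r)) \<le> ennreal C"
  then obtain C r0 where C: "\<And>r. r0 \<le> r \<Longrightarrow> ennreal (1 / r) * \<tau> (powr_op T (p + 1 / r)) \<le> ennreal C" by blast
  define D where "D = max 1 C"
  define r1 where "r1 = max 1 r0"
  have "ennreal_powr (?x s) (1 / s) \<le> ennreal D" if s: "p < s" "s < p + 1 / r1" for s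
  proof -
    have "r0 \<le> 1 / (s - p)"
    proof -
      have "s - p < 1 / r1" "0 < r1" using s by (auto simp: r1_def)
      then have "r1 \<le> 1 / (s - p)" using s by (simp add: field_simps)
      then show ?thesis by (simp add: r1_def)
    qed
    from C[OF this] have "?x s \<le> ennreal C" using s by simp
    also have "\<dots> \<le> ennreal D" by (intro ennreal_leI) (simp add: D_def)
    finally have le: "?x s \<le> ennreal D" .
    then have fin: "?x s \<noteq> \<infinity>" by (auto simp: top_unique)
    then obtain y where y: "0 \<le> y" "?x s = ennreal y" by (metis ennreal_cases infinity_ennreal_def)
    have "y \<le> D" using le y by (simp add: D_def)
    have "y powr (1 / s) \<le> D powr (1 / s)" using y \<open>y \<le> D\<close> s p by (intro powr_mono2) auto
    also have "\<dots> \<le> D powr 1" using s p by (intro powr_mono) (auto simp: D_def)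
    finally have "y powr (1 / s) \<le> D" by (simp add: D_def)
    then show ?thesis using y fin by (simp add: ennreal_powr_def ennreal_leI)
  qed
  moreover have "p < p + 1 / r1" by (simp add: r1_def)
  ultimately have "\<forall>\<^sub>F s in at_right p. ennreal_powr (?x s) (1 / s) \<le> ennreal D"
    unfolding eventually_at_right_field by blast
  then have "Limsup (at_right p) (\<lambda>s. ennreal_powr (?x s) (1 / s)) \<le> ennreal D"
    by (rule Limsup_bounded)
  then have "Limsup (at_right p) (\<lambda>s. ennreal_powr (?x s) (1 / s)) < \<infinity>"
    by (rule order_le_less_trans) simp
  then show "T \<in> zeta_space N \<tau> p" using T_in assms by (simp add: zeta_space_def pos_part_def)
qed

text \<open>The bound at r/p is the linear bound on the power integral of T^p at r, because T^(p +
  p/r) is the power 1 + 1/r of T^p.\<close>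

lemma bounded_if_zeta_space:
  assumes "\<And>r. r0 \<le> r \<Longrightarrow> ennreal (1 / r) * \<tau> (powr_op T (p + 1 / r)) \<le> ennreal C"
  shows "bounded_rearrangement \<rho> (K powr p)"
proof -
  interpret R: rearrangement \<rho> "K powr p" by (rule rearrangement_rho)
  show ?thesis
  proof (rule R.bounded_rearrangement_if_power_int)
    show "1 \<le> p * max 1 r0" using p mult_mono[of 1 p 1 "max 1 r0"] by simp
    fix r assume r: "p * max 1 r0 \<le> r"
    have r': "r0 \<le> r / p" "0 < r / p"
    proof -
      have "max 1 r0 \<le> r / p" using divide_right_mono[OF r, of p] p by simp
      then show "r0 \<le> r / p" "0 < r / p" by auto
    qed
    have "(\<integral>\<^sup>+u. ennreal (u powr (1 + 1 / r)) \<partial>\<rho>) = \<tau> (powr_op T (p + 1 / (r / p)))"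
      using trace_powr_rho[OF r'(2)] p by simp
    also have "\<dots> = ennreal (r / p) * (ennreal (1 / (r / p)) * \<tau> (powr_op T (p + 1 / (r / p))))"
    proof -
      have "ennreal (r / p) * ennreal (1 / (r / p)) = ennreal (r / p * (1 / (r / p)))"
        by (intro ennreal_mult[symmetric] divide_nonneg_pos r' less_imp_le[OF r'(2)]) auto
      also have "r / p * (1 / (r / p)) = 1" using r'(2) by auto
      finally show ?thesis by (simp only: mult.assoc[symmetric] ennreal_1 mult_1)
    qed
    also have "\<dots> \<le> ennreal (r / p) * ennreal (max 0 C)"
      using assms[OF r'(1)] by (intro mult_left_mono order_trans[OF assms[OF r'(1)]] ennreal_leI) auto
    also have "\<dots> = ennreal (max 0 C / p * r)"
    proof -
      have "ennreal (r / p) * ennreal (max 0 C) = ennreal (r / p * max 0 C)"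
        by (intro ennreal_mult[symmetric] less_imp_le[OF r'(2)] max.cobounded1)
      then show ?thesis by (simp add: mult.commute)
    qed
    finally show "(\<integral>\<^sup>+u. ennreal (u powr (1 + 1 / r)) \<partial>\<rho>) \<le> ennreal (max 0 C / p * r)" .
  qed
qed

text \<open>Monotonicity turns the bound on the integral into mu_t(T) <= C t^(-1/p). Comparing
  distribution functions gives mu_t(T^p) <= C^p/t for t >= 1, whose integral grows
  logarithmically.\<close>

lemma bounded_if_weak_ideal:
  assumes "T \<in> weak_ideal N \<tau> p"
  shows "bounded_rearrangement \<rho> (K powr p)"
proof -
  interpret S: rearrangement "distr trace_measure borel (\<lambda>u. u)" K
    by (intro rearrangement_push bdd_borel_id K) auto
  interpret R: rearrangement \<rho> "K powr p" by (rule rearrangement_rho)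
  have J: "sing_val_integral \<tau> T t = S.mu_int t" for t
    using sing_val_integral_calc[OF bdd_borel_id K] by (simp add: calc_id)
  have "(SUP t\<in>{0<..}. ereal (1 / psi p t * S.mu_int t)) < \<infinity>"
    using assms by (simp add: weak_ideal_def J)
  then obtain B where B: "(SUP t\<in>{0<..}. ereal (1 / psi p t * S.mu_int t)) \<le> ereal B"
    by (cases "SUP t\<in>{0<..}. ereal (1 / psi p t * S.mu_int t)") auto
  \<comment> \<open>The lower bound 1 keeps \<open>C\<close>, and with it A = C^p, positive.\<close>
  define C where "C = max 1 B"
  have C: "1 \<le> C" by (simp add: C_def)
  have S_le: "S.mu_int t \<le> C * t powr (1 - 1 / p)" if t: "1 \<le> t" for t
  proof -
    have "ereal (1 / psi p t * S.mu_int t) \<le> ereal B"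
      using t by (intro order_trans[OF SUP_upper B]) auto
    then have "S.mu_int t \<le> B * psi p t"
      using psi_pos[of t p] t by (simp add: field_simps)
    also have "\<dots> \<le> C * psi p t"
      using psi_pos[of t p] t by (intro mult_right_mono) (auto simp: C_def)
    also have "psi p t = t powr (1 - 1 / p)"
      using t p by (auto simp: psi_def)
    finally show ?thesis .
  qed
  have S_mu: "S.mu t \<le> C * t powr (- (1 / p))" if t: "1 \<le> t" for t
  proof -
    have "t * S.mu t \<le> C * t powr (1 - 1 / p)"
      using S.mu_int_ge[of t] S_le[OF t] t by linarith
    also have "\<dots> = t * (C * t powr (- (1 / p)))"
      using t by (simp add: powr_diff powr_minus field_simps)
    finally show ?thesis using t by (simp add: mult_le_cancel_left)
  qed
  \<comment> \<open>The map u -> u^p is used as strictly increasing on the nonnegative reals, which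
    carry the trace measure.\<close>
  have dist_eq: "R.dist_fun (x powr p) = S.dist_fun x" if x: "0 \<le> x" for x
  proof -
    have "R.dist_fun (x powr p) = emeasure trace_measure {u. x powr p < u powr p}"
      unfolding R.dist_fun_def by (subst emeasure_distr) (auto simp: vimage_def)
    also have "\<dots> = emeasure trace_measure {x<..}"
    proof (rule emeasure_eq_AE)
      show "AE u in trace_measure. u \<in> {u. x powr p < u powr p} \<longleftrightarrow> u \<in> {x<..}"
        using trace_measure_support
      proof (rule eventually_mono)
        fix u assume u: "u \<in> {0..K}"
        show "u \<in> {u. x powr p < u powr p} \<longleftrightarrow> u \<in> {x<..}"
          using x u p powr_less_mono2[of p x u] powr_mono2[of p u x] by (auto simp: not_less[symmetric])
      qed
    qed auto
    also have "\<dots> = S.dist_fun x"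
      unfolding S.dist_fun_def by (simp add: distr_id2)
    finally show ?thesis .
  qed
  define A where "A = C powr p"
  have A: "0 < A" using C by (simp add: A_def)
  have dist: "R.dist_fun (A / t) \<le> ennreal t" if t: "1 \<le> t" for t
  proof -
    let ?x = "C * t powr (- (1 / p))"
    have x: "0 \<le> ?x" using C by simp
    have "?x powr p = A / t"
    proof -
      have "?x powr p = C powr p * (t powr (- (1 / p))) powr p" using C by (intro powr_mult)
      also have "(t powr (- (1 / p))) powr p = t powr - 1" using p by (simp add: powr_powr)
      also have "t powr - 1 = 1 / t" using t by (simp add: powr_minus_divide)
      finally show ?thesis by (simp add: A_def)
    qed
    then have "R.dist_fun (A / t) = S.dist_fun ?x" using dist_eq[OF x] by simp
    also have "\<dots> \<le> ennreal t"
      using S_mu[OF t] S.less_mu_iff[OF x, of t] by (simp add: not_less)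
    finally show ?thesis .
  qed
  interpret F: fin_rearrangement \<rho> "K powr p"
  proof unfold_locales
    fix x :: real assume x: "0 < x"
    define t where "t = max 1 (A / x)"
    have "A / t \<le> x" using x A by (auto simp: t_def field_simps max_def)
    then have "R.dist_fun x \<le> R.dist_fun (A / t)" by (rule R.dist_fun_antimono)
    also have "\<dots> \<le> ennreal t" by (rule dist) (simp add: t_def)
    finally show "R.dist_fun x < \<infinity>" by (rule order_le_less_trans) simp
  qed
  have mu: "R.mu t \<le> A / t" if "1 \<le> t" for t
    using R.mu_le[OF _ dist[OF that]] A that by simp
  \<comment> \<open>Up to s = 1 the constant bound K^p is used, and from there on the bound
    A/s.\<close>
  have int: "R.mu_int t \<le> K powr p + A * ln t" if t: "1 \<le> t" for t
  proof -
    have "ennreal (R.mu_int t) \<le> (\<integral>\<^sup>+s. ennreal (K powr p) * indicator {0..1} s + ennreal (A / s) * indicator {1..t} s \<partial>lborel)"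
      unfolding R.mu_int_nn
    proof (intro nn_integral_mono)
      fix s :: real
      show "indicator {0..t} s * ennreal (R.mu s)
          \<le> ennreal (K powr p) * indicator {0..1} s + ennreal (A / s) * indicator {1..t} s"
        using R.mu_le_K[of s] mu[of s]
        by (cases "s \<le> 1") (auto simp: indicator_def add_increasing2 intro: ennreal_leI)
    qed
    also have "\<dots> = ennreal (K powr p) + (\<integral>\<^sup>+s. ennreal (A / s) * indicator {1..t} s \<partial>lborel)"
      by (subst nn_integral_add) (auto simp: nn_integral_cmult)
    also have "(\<integral>\<^sup>+s. ennreal (A / s) * indicator {1..t} s \<partial>lborel) = ennreal (A * ln t - A * ln 1)"
      using t A by (intro nn_integral_FTC_Icc) (auto intro!: derivative_eq_intros)
    finally show ?thesis
      using t A by (simp flip: ennreal_plus)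
  qed
  have "\<forall>\<^sub>F y in at_top. F.log_mu y \<le> K powr p + A"
    using eventually_ge_at_top[of 1]
  proof eventually_elim
    case (elim y)
    have "R.mu_int (exp y) \<le> K powr p + A * y" using int[of "exp y"] elim by simp
    also have "\<dots> \<le> (K powr p + A) * y"
      using elim mult_left_mono[of 1 y "K powr p"] by (simp add: distrib_right)
    also have "\<dots> \<le> (K powr p + A) * ln (1 + exp y)"
      using F.ln_exp_ge[of y] A by (intro mult_left_mono) auto
    finally show ?case using F.ln_exp_pos[of y] by (simp add: F.log_mu_def field_simps)
  qed
  then show ?thesis by unfold_locales blast
qed

lemma zeta_mean_eventually:
  assumes "bounded_rearrangement \<rho> (K powr p)"
  shows "\<forall>\<^sub>F r in at_top. zeta_mean \<tau> p T r = ereal (bounded_rearrangement.zeta_fun \<rho> p r)"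
proof -
  interpret B: bounded_rearrangement \<rho> "K powr p" by fact
  show ?thesis using eventually_ge_at_top[of 1]
  proof eventually_elim
    case (elim r)
    have "1 \<le> p * r" using elim p mult_mono[of 1 p 1 r] by simp
    have "0 \<le> B.zeta_fun p r"
      using elim B.log.lap_nonneg[of "p * r"] B.tail_nonneg[of "p * r"] by (simp add: B.zeta_fun_def)
    then show ?case
      using elim B.power_int_zeta[of r p] \<open>1 \<le> p * r\<close>
      by (simp add: zeta_mean_def trace_powr_rho B.power_int_def enn2ereal_ennreal)
  qed
qed

lemma log_mean_eventually:
  assumes "bounded_rearrangement \<rho> (K powr p)"
  shows "\<forall>\<^sub>F t in at_top. log_mean \<tau> (powr_op T p) t = fin_rearrangement.log_mu \<rho> (ln t)"
proof -
  interpret B: bounded_rearrangement \<rho> "K powr p" by fact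
  have "sing_val_integral \<tau> (powr_op T p) t = B.mu_int t" for t
    using sing_val_integral_calc[OF bdd_borel_powr, of p "K powr p" t] p
    by (simp add: powr_op_T powr_mono2)
  note J = this
  show ?thesis using eventually_gt_at_top[of 0]
    by eventually_elim (simp add: log_mean_def B.log_mu_def J)
qed

lemma zeta_limit_iff:
  assumes "bounded_rearrangement \<rho> (K powr p)"
  shows "(zeta_mean \<tau> p T \<longlongrightarrow> ereal l) at_top \<longleftrightarrow> (log_mean \<tau> (powr_op T p) \<longlongrightarrow> l / p) at_top"
proof -
  interpret B: bounded_rearrangement \<rho> "K powr p" by fact
  have "(zeta_mean \<tau> p T \<longlongrightarrow> ereal l) at_top \<longleftrightarrow> (B.zeta_fun p \<longlongrightarrow> l) at_top"
    using tendsto_cong[OF zeta_mean_eventually[OF assms]] by simp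
  also have "\<dots> \<longleftrightarrow> (B.log_mu \<longlongrightarrow> l / p) at_top"
    using B.true_limit_iff[of p "l / p"] p by simp
  also have "\<dots> \<longleftrightarrow> ((\<lambda>t. B.log_mu (ln t)) \<longlongrightarrow> l / p) at_top"
  proof
    assume "(B.log_mu \<longlongrightarrow> l / p) at_top"
    then show "((\<lambda>t. B.log_mu (ln t)) \<longlongrightarrow> l / p) at_top"
      by (rule filterlim_compose[OF _ ln_at_top])
  next
    assume "((\<lambda>t. B.log_mu (ln t)) \<longlongrightarrow> l / p) at_top"
    from filterlim_compose[OF this exp_at_top] show "(B.log_mu \<longlongrightarrow> l / p) at_top" by simp
  qed
  also have "\<dots> \<longleftrightarrow> (log_mean \<tau> (powr_op T p) \<longlongrightarrow> l / p) at_top"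
    using tendsto_cong[OF log_mean_eventually[OF assms]] by simp
  finally show ?thesis .
qed

text \<open>Boundedness of the Laplace mean provides some generalised limit l; transfer identifies
  the Dixmier trace with l and the zeta limit with p l.\<close>

lemma zeta_state_lim:
  assumes "bounded_rearrangement \<rho> (K powr p)" "invariant_state \<omega>"
  shows "state_lim lebesgue (log_transfer \<omega>) (zeta_mean \<tau> p T) (p * dixmier_trace \<tau> \<omega> (powr_op T p))"
proof -
  interpret B: bounded_rearrangement \<rho> "K powr p" by fact
  interpret invariant_state \<omega> by fact
  obtain C where "\<forall>\<^sub>F r in at_top. \<bar>B.log.lap r / r\<bar> \<le> C" using B.lap_bounded by blast
  then obtain l where l: "gen_lim \<omega> (\<lambda>r. B.log.lap r / r) l"
    using gen_lim_exists[of "\<lambda>r. B.log.lap r / r" C] by auto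
  have p0: "0 < p" using p by simp
  note lt = B.limit_transfer[OF limit_notion_gen_lim p0 l]
  have "dixmier_trace \<tau> \<omega> (powr_op T p) = l"
    by (rule dixmier_trace_eqI[OF lt(2) log_mean_eventually[OF assms(1)]])
  then show ?thesis
    using state_lim_log_transfer[OF lt(1) zeta_mean_eventually[OF assms(1)]] by simp
qed

end

end

theorem mainTheorem7:
  fixes N :: "('h::complex_hilbert_space \<Rightarrow>\<^sub>L 'h) set"
    and \<tau> :: "('h \<Rightarrow>\<^sub>L 'h) \<Rightarrow> ennreal"
    and T :: "'h \<Rightarrow>\<^sub>L 'h"
    and p :: real
    and \<omega> :: "(real \<Rightarrow> complex) \<Rightarrow> complex"
  assumes "separable_space (euclidean :: 'h topology)"
    and "von_neumann_algebra N"
    and "trace_on N \<tau>" and "faithful_trace N \<tau>" and "normal_trace N \<tau>" and "semifinite_trace N \<tau>"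
    and "p > 1"
    and "T \<in> N" and "positive_op T"
    and "admissible_state \<omega>"
    and "D_invariant 2 \<omega>"
    and "\<And>\<alpha>. \<alpha> > 1 \<Longrightarrow> P_invariant \<alpha> \<omega>"
  shows "(T \<in> zeta_space N \<tau> p \<or> T \<in> weak_ideal N \<tau> p \<longrightarrow>
            state_lim lebesgue (log_transfer \<omega>) (zeta_mean \<tau> p T)
              (p * dixmier_trace \<tau> \<omega> (powr_op T p)) \<and>
            ((\<exists>l::real. (zeta_mean \<tau> p T \<longlongrightarrow> ereal l) at_top) \<longleftrightarrow>
             (\<exists>m::real. (log_mean \<tau> (powr_op T p) \<longlongrightarrow> m) at_top))) \<and>
         (\<forall>l::real. (zeta_mean \<tau> p T \<longlongrightarrow> ereal l) at_top \<longrightarrow>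
            T \<in> zeta_space N \<tau> p \<and>
            (\<exists>m::real. (log_mean \<tau> (powr_op T p) \<longlongrightarrow> m) at_top \<and> l = p * m))"
proof -
  obtain K m where "moment_family T K m" using moment_family_exists[OF assms(9)] .
  then interpret traced_family T K m N \<tau>
    by (rule traced_family.intro) (use assms in \<open>simp add: traced_family_axioms_def\<close>)
  let ?bdd = "bounded_rearrangement (distr trace_measure borel (\<lambda>u. u powr p)) (K powr p)"
  have inv: "invariant_state \<omega>" using assms(10,12) by (simp add: invariant_state_def)
  have p0: "p \<noteq> 0" using assms(7) by simp
  have bdd: ?bdd if "T \<in> zeta_space N \<tau> p \<or> T \<in> weak_ideal N \<tau> p"
    using that bounded_if_weak_ideal[OF assms(7)] bounded_if_zeta_space[OF assms(7)]
      zeta_space_iff[OF assms(7,9)] by blast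
  have limits: "(\<exists>l::real. (zeta_mean \<tau> p T \<longlongrightarrow> ereal l) at_top) \<longleftrightarrow>
      (\<exists>m::real. (log_mean \<tau> (powr_op T p) \<longlongrightarrow> m) at_top)" if ?bdd
    unfolding zeta_limit_iff[OF assms(7) that] using p0 by (metis nonzero_mult_div_cancel_left)
  \<comment> \<open>A finite limit bounds the zeta means for large r, which is the criterion for
    Z_p; the case (b) is thereby brought under the bounded one.\<close>
  have zeta: "T \<in> zeta_space N \<tau> p" if l: "(zeta_mean \<tau> p T \<longlongrightarrow> ereal l) at_top" for l :: real
  proof -
    have "\<forall>\<^sub>F r in at_top. zeta_mean \<tau> p T r < ereal (l + 1)"
      using order_tendstoD(2)[OF l, of "ereal (l + 1)"] by simp
    then obtain r0 where r0: "\<And>r. r0 \<le> r \<Longrightarrow> zeta_mean \<tau> p T r < ereal (l + 1)"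
      by (auto simp: eventually_at_top_linorder)
    have "ennreal (1 / r) * \<tau> (powr_op T (p + 1 / r)) \<le> ennreal (l + 1)" if "r0 \<le> r" for r
    proof -
      have "e2ennreal (zeta_mean \<tau> p T r) \<le> e2ennreal (ereal (l + 1))"
        using r0[OF that] by (intro e2ennreal_mono) simp
      then show ?thesis by (simp add: zeta_mean_def e2ennreal_ereal)
    qed
    then show ?thesis using zeta_space_iff[OF assms(7,9)] by blast
  qed
  have "\<exists>m::real. (log_mean \<tau> (powr_op T p) \<longlongrightarrow> m) at_top \<and> l = p * m"
    if l: "(zeta_mean \<tau> p T \<longlongrightarrow> ereal l) at_top" for l :: real
  proof -
    have "(log_mean \<tau> (powr_op T p) \<longlongrightarrow> l / p) at_top"
      using zeta_limit_iff[OF assms(7) bdd] zeta[OF l] l by blast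
    then show ?thesis using p0 by (intro exI[of _ "l / p"]) simp
  qed
  then show ?thesis
    using zeta zeta_state_lim[OF assms(7) bdd inv] limits[OF bdd] by blast
qed

end
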